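(* Let $G$ and $H$ be finite abelian groups and $e$ the exponent of $G$. Let $F$ be a field such that $\operatorname{char}(F)\nmid|G|$ and such that, whenever $p^n$ is a prime power dividing $e$ for which $F$ contains no primitive $p^n$-th root of unity, and $\zeta$ is a primitive $p^n$-th root of unity in an extension field of $F$, the field $F(\zeta)$ contains no primitive $p^{n+1}$-th root of unity. Then $G\sim_F H$ implies $G\cong H$.
   Context: For a field $F$ and finite group $G$, $H^2(G,F^* )$ is the second cohomology group with trivial action; for $\alpha\in Z^2(G,F^* )$ the twisted group algebra $F^\alpha G$ has $F$-basis $\{u_g\}$, $F$ central, $u_gu_h=\alpha(g,h)u_{gh}$. $G\sim_F H$ means there is a group isomorphism $\psi:H^2(G,F^* )\to H^2(H,F^* )$ with $F^\alpha G\cong F^{\psi(\alpha)}H$ as rings for all $[\alpha]\in H^2(G,F^* )$. *)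

theory Defs
  imports "HOL-Algebra.Algebra" "HOL-Algebra.Algebraic_Closure_Type"
begin

definition group_exponent :: "('g, 'b) monoid_scheme \<Rightarrow> nat" where
  "group_exponent G = (LEAST m. 0 < m \<and> (\<forall>x\<in>carrier G. x [^]\<^bsub>G\<^esub> m = \<one>\<^bsub>G\<^esub>))"

definition primitive_root_of_unity :: "nat \<Rightarrow> 'a::comm_ring_1 \<Rightarrow> bool" where
  "primitive_root_of_unity m z \<longleftrightarrow>
     0 < m \<and> z ^ m = 1 \<and> (\<forall>k. 0 < k \<and> k < m \<longrightarrow> z ^ k \<noteq> 1)"

definition subfield_set :: "'k::field set \<Rightarrow> bool" where
  "subfield_set S \<longleftrightarrow> 0 \<in> S \<and> 1 \<in> S \<and>
     (\<forall>x\<in>S. \<forall>y\<in>S. x + y \<in> S \<and> x * y \<in> S) \<and>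
     (\<forall>x\<in>S. - x \<in> S \<and> inverse x \<in> S)"

text \<open>The field \<open>F(\<zeta>)\<close> for \<open>\<zeta>\<close> in the algebraic closure of \<open>F\<close>
  (every algebraic extension of \<open>F\<close> embeds there), as the smallest subfield
  containing the image of \<open>F\<close> and \<open>\<zeta>\<close>.\<close>
definition adjoin :: "'f::field alg_closure \<Rightarrow> 'f alg_closure set" where
  "adjoin \<zeta> = \<Inter>{S. subfield_set S \<and> range to_ac \<subseteq> S \<and> \<zeta> \<in> S}"

text \<open>2-cocycles \<open>Z\<^sup>2(G,F\<^sup>*)\<close> (trivial action); values outside the carrier are irrelevant.\<close>
definition cocycles :: "('g, 'b) monoid_scheme \<Rightarrow> ('g \<Rightarrow> 'g \<Rightarrow> 'f::field) set" where
  "cocycles G = {\<alpha>. (\<forall>g\<in>carrier G. \<forall>h\<in>carrier G. \<alpha> g h \<noteq> 0) \<and>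
     (\<forall>g\<in>carrier G. \<forall>h\<in>carrier G. \<forall>k\<in>carrier G.
        \<alpha> g h * \<alpha> (g \<otimes>\<^bsub>G\<^esub> h) k = \<alpha> h k * \<alpha> g (h \<otimes>\<^bsub>G\<^esub> k))}"

definition cohomologous :: "('g, 'b) monoid_scheme \<Rightarrow> ('g \<Rightarrow> 'g \<Rightarrow> 'f::field) rel" where
  "cohomologous G = {(\<alpha>, \<beta>). \<alpha> \<in> cocycles G \<and> \<beta> \<in> cocycles G \<and>
     (\<exists>c. (\<forall>g\<in>carrier G. c g \<noteq> 0) \<and>
        (\<forall>g\<in>carrier G. \<forall>h\<in>carrier G. \<beta> g h = \<alpha> g h * c g * c h / c (g \<otimes>\<^bsub>G\<^esub> h)))}"

definition H2 :: "('g, 'b) monoid_scheme \<Rightarrow> 'f itself \<Rightarrow> ('g \<Rightarrow> 'g \<Rightarrow> 'f::field) set monoid" where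
  "H2 G F = \<lparr> carrier = cocycles G // cohomologous G,
      monoid.mult = (\<lambda>A B. cohomologous G `` {(\<lambda>g h. (SOME \<alpha>. \<alpha> \<in> A) g h * (SOME \<beta>. \<beta> \<in> B) g h)}),
      one = cohomologous G `` {(\<lambda>g h. 1)} \<rparr>"

text \<open>\<open>F\<^sup>\<alpha>G\<close>: elements are \<open>\<Sum> x(g) u\<^sub>g\<close>, encoded as functions on the carrier;
  \<open>u\<^sub>g u\<^sub>h = \<alpha>(g,h) u\<^sub>g\<^sub>h\<close>; the identity is \<open>\<alpha>(1,1)\<^sup>-\<^sup>1 u\<^sub>1\<close>.\<close>
definition twisted_group_algebra ::
  "('g, 'b) monoid_scheme \<Rightarrow> ('g \<Rightarrow> 'g \<Rightarrow> 'f::field) \<Rightarrow> ('g \<Rightarrow> 'f) ring" where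
  "twisted_group_algebra G \<alpha> = \<lparr>
     carrier = carrier G \<rightarrow>\<^sub>E UNIV,
     monoid.mult = (\<lambda>x y. \<lambda>k\<in>carrier G.
        \<Sum>(g, h)\<in>{(g, h). g \<in> carrier G \<and> h \<in> carrier G \<and> g \<otimes>\<^bsub>G\<^esub> h = k}.
          x g * y h * \<alpha> g h),
     one = (\<lambda>g\<in>carrier G. if g = \<one>\<^bsub>G\<^esub> then inverse (\<alpha> \<one>\<^bsub>G\<^esub> \<one>\<^bsub>G\<^esub>) else 0),
     ring.zero = (\<lambda>g\<in>carrier G. 0),
     ring.add = (\<lambda>x y. \<lambda>g\<in>carrier G. x g + y g) \<rparr>"

definition twisted_equiv ::
  "'f::field itself \<Rightarrow> ('g, 'b) monoid_scheme \<Rightarrow> ('h, 'c) monoid_scheme \<Rightarrow> bool" where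
  "twisted_equiv F G H \<longleftrightarrow>
     (\<exists>\<psi>. \<psi> \<in> iso (H2 G F) (H2 H F) \<and>
        (\<forall>C\<in>carrier (H2 G F). \<forall>\<alpha>\<in>C. \<forall>\<beta>\<in>\<psi> C.
           twisted_group_algebra G \<alpha> \<simeq> twisted_group_algebra H \<beta>))"

end

theory Submission
  imports Defs
begin

text \<open>
  Write \<open>G = C\<^bsub>n\<^sub>1\<^esub> \<times> C\<^bsub>n\<^sub>2\<^esub> \<times> \<dots>\<close> with \<open>n\<^sub>2\<close> dividing \<open>n\<^sub>1\<close>, \<open>n\<^sub>3\<close> dividing \<open>n\<^sub>2\<close>, and so on. For a prime \<open>p\<close> let
  \<open>a\<^sub>1 \<ge> a\<^sub>2 \<ge> \<dots>\<close> be the exponents of \<open>p\<close> in the \<open>n\<^sub>j\<close>, and \<open>p\<^sup>m\<close> the largest power of \<open>p\<close>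
  dividing the exponent of \<open>G\<close> for which \<open>F\<close> has a primitive root of unity. Two invariants
  determine the \<open>a\<^sub>j\<close>.

  Since \<open>F\<^sup>\<alpha>G\<close> is commutative exactly if \<open>\<alpha>\<close> is symmetric, \<open>\<psi>\<close> respects the map sending \<open>\<alpha>\<close> to the
  alternating bicharacter \<open>\<alpha>(g,h) / \<alpha>(h,g)\<close>. Every alternating bicharacter arises in this way, and
  those with values in the \<open>p\<^sup>k\<close>-th roots of unity, \<open>k \<le> m\<close>, number \<open>p\<close> to the power
  \<open>\<Sum> (j - 1) min(a\<^sub>j, k)\<close>; so \<open>min(a\<^sub>j, m)\<close> is determined for \<open>j \<ge> 2\<close>.

  The trivial class is fixed by \<open>\<psi>\<close>, so \<open>FG\<close> and \<open>FH\<close> are isomorphic rings. Their simple components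
  are the fields \<open>F(\<chi>)\<close> generated by characters \<open>\<chi>\<close> with values in the algebraic closure; a ring
  isomorphism, although it need not fix \<open>F\<close>, preserves each \<open>F(\<chi>)\<close> as a subfield of the closure,
  because it preserves orders of roots of unity. The number of \<open>\<chi>\<close> giving the same component is the
  number of \<open>F\<close>-embeddings of \<open>F(\<chi>)\<close>. Hence for every intermediate field \<open>K\<close> the groups \<open>G\<close> and \<open>H\<close>
  have equally many characters with values in \<open>K\<close>. If \<open>K\<close> has a primitive \<open>p\<^sup>k\<close>-th but no
  primitive \<open>p\<^bsup>k+1\<^esup>\<close>-th root of unity, the exponent of \<open>p\<close> in this number is \<open>\<Sum> min(a\<^sub>j, k)\<close>. By
  hypothesis \<open>K = F(\<zeta>)\<close> is such a field for \<open>m \<le> k \<le> a\<^sub>1\<close> if \<open>m < a\<^sub>1\<close>, and \<open>K\<close> the whole closure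
  yields \<open>|G| = |H|\<close>.
\<close>

section \<open>Invariant factors of finite abelian groups\<close>

text \<open>An internal direct product of the cyclic group generated by \<open>x\<close> and a
  subgroup \<open>K\<close>, given through the coordinates
  \<open>g = x [^] e g \<otimes> r g\<close>, so that maps on \<open>G\<close> can be defined from
  data on the two factors. Since \<open>x\<close> has order \<open>n\<close> and
  \<open>exponent\<close> holds in all of \<open>G\<close>, a further factor split off from
  \<open>K\<close> has order dividing \<open>n\<close>.\<close>

locale cyclic_split = comm_group G for G :: "'g monoid" (structure) +
  fixes x :: 'g and n :: nat and K :: "'g set" and e :: "'g \<Rightarrow> nat" and r :: "'g \<Rightarrow> 'g"
  assumes finite_carrier: "finite (carrier G)"
    and n_gt_1: "1 < n"
    and exponent: "\<And>y. y \<in> carrier G \<Longrightarrow> y [^] n = \<one>"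
    and subgroup_K: "subgroup K G"
    and x_closed: "x \<in> carrier G"
    and e_less: "\<And>g. g \<in> carrier G \<Longrightarrow> e g < n"
    and e_mult: "\<And>g h. g \<in> carrier G \<Longrightarrow> h \<in> carrier G \<Longrightarrow> e (g \<otimes> h) = (e g + e h) mod n"
    and e_x: "e x = 1"
    and e_K: "\<And>k. k \<in> K \<Longrightarrow> e k = 0"
    and r_closed: "\<And>g. g \<in> carrier G \<Longrightarrow> r g \<in> K"
    and r_mult: "\<And>g h. g \<in> carrier G \<Longrightarrow> h \<in> carrier G \<Longrightarrow> r (g \<otimes> h) = r g \<otimes> r h"
    and r_x: "r x = \<one>"
    and r_K: "\<And>k. k \<in> K \<Longrightarrow> r k = k"
    and e_r: "\<And>g. g \<in> carrier G \<Longrightarrow> x [^] e g \<otimes> r g = g"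

text \<open>Each factor is the exponent of the group from which it is split off, so the list is that
  of the invariant factors, the largest first.\<close>

inductive decomposition :: "'g monoid \<Rightarrow> nat list \<Rightarrow> bool" where
  trivial: "comm_group G \<Longrightarrow> carrier G = {\<one>\<^bsub>G\<^esub>} \<Longrightarrow> decomposition G []"
| split: "cyclic_split G x n K e r \<Longrightarrow> decomposition (G\<lparr>carrier := K\<rparr>) ns \<Longrightarrow> decomposition G (n # ns)"

text \<open>Let \<open>N\<close> be the order of the product. Raising
  \<open>x [^] N \<otimes> y [^] N = \<one>\<close> to the power \<open>ord x\<close> kills the
  first factor, so \<open>ord y\<close> divides \<open>N * ord x\<close> and by coprimality
  \<open>N\<close>; likewise with the roles exchanged.\<close>

lemma (in comm_group) ord_mult_coprime:
  assumes "x \<in> carrier G" "y \<in> carrier G" "coprime (ord x) (ord y)"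
  shows "ord (x \<otimes> y) = ord x * ord y"
proof (rule dvd_antisym)
  show "ord (x \<otimes> y) dvd ord x * ord y"
    using assms by (intro abelian_ord_mul_divides)
  define N where "N = ord (x \<otimes> y)"
  have N: "x [^] N \<otimes> y [^] N = \<one>"
    using assms by (simp add: N_def flip: nat_pow_distrib)
  have "(x [^] N \<otimes> y [^] N) [^] ord x = y [^] (N * ord x)"
    using assms
    by (simp add: nat_pow_distrib nat_pow_pow) (metis assms(1) dvd_triv_right pow_eq_id l_one nat_pow_closed)
  hence "ord y dvd N * ord x"
    using assms N by (simp flip: pow_eq_id)
  hence y: "ord y dvd N" using assms(3) by (metis coprime_commute coprime_dvd_mult_left_iff)
  have "(x [^] N \<otimes> y [^] N) [^] ord y = x [^] (N * ord y)"
    using assms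
    by (simp add: nat_pow_distrib nat_pow_pow) (metis assms(2) dvd_triv_right pow_eq_id r_one nat_pow_closed)
  hence "ord x dvd N * ord y"
    using assms N by (simp flip: pow_eq_id)
  hence x: "ord x dvd N" using assms(3) by (metis coprime_dvd_mult_left_iff)
  show "ord x * ord y dvd ord (x \<otimes> y)"
    using x y assms(3) by (fold N_def) (rule divides_mult)
qed

text \<open>An element \<open>x\<close> of maximal order works. If \<open>ord y\<close> contained a
  higher power of a prime \<open>p\<close> than \<open>ord x\<close>, the product of the
  \<open>p\<close>-part of \<open>y\<close> and the part of \<open>x\<close> of order prime to
  \<open>p\<close> would have larger order.\<close>

lemma (in comm_group) exists_exponent_element:
  assumes fin: "finite (carrier G)"
  shows "\<exists>x\<in>carrier G. \<forall>y\<in>carrier G. y [^] ord x = \<one>"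
proof -
  have "finite (ord ` carrier G)" "ord ` carrier G \<noteq> {}" using fin by auto
  from Max_in[OF this] obtain x where x: "x \<in> carrier G" "ord x = Max (ord ` carrier G)" by auto
  have mx: "ord y \<le> ord x" if "y \<in> carrier G" for y
    using that fin x by auto
  have "ord y dvd ord x" if y: "y \<in> carrier G" for y
  proof (rule ccontr)
    assume nd: "\<not> ord y dvd ord x"
    have pos: "ord x > 0" "ord y > 0" using fin x y ord_ge_1 by (metis One_nat_def Suc_le_eq)+
    obtain p where p: "Factorial_Ring.prime p" "multiplicity p (ord x) < multiplicity p (ord y)"
      using nd pos by (metis gr_implies_not0 multiplicity_le_imp_dvd not_le)
    define a b where "a = multiplicity p (ord x)" and "b = multiplicity p (ord y)"
    obtain m where m: "ord x = p ^ a * m" "\<not> p dvd m"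
      using multiplicity_decompose'[of "ord x" p] pos p not_prime_unit by (metis a_def less_irrefl)
    obtain l where l: "ord y = p ^ b * l" "\<not> p dvd l"
      using multiplicity_decompose'[of "ord y" p] pos p not_prime_unit by (metis b_def less_irrefl)
    have p0: "p > 0" using p prime_gt_0_nat by blast
    have ox: "ord (x [^] (p ^ a)) = m"
      using ord_pow[of x "p ^ a"] x(1) m p0 by simp
    have "l > 0" using l pos by (auto intro: Nat.gr0I)
    hence oy: "ord (y [^] l) = p ^ b"
      using ord_pow[of y l] y l by simp
    have "coprime m (p ^ b)" using m p
      by (metis coprime_commute coprime_power_right_iff prime_imp_coprime_nat)
    hence "ord (x [^] (p ^ a) \<otimes> y [^] l) = m * p ^ b"
      using ord_mult_coprime[of "x [^] (p ^ a)" "y [^] l"] x(1) y ox oy by simp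
    moreover have "m * p ^ b > ord x"
    proof -
      have "p ^ a < p ^ b" using p prime_gt_1_nat by (auto simp: a_def b_def intro: power_strict_increasing)
      thus ?thesis using m pos by simp
    qed
    ultimately show False using mx[of "x [^] (p ^ a) \<otimes> y [^] l"] x(1) y by simp
  qed
  thus ?thesis using x pow_eq_id by blast
qed

text \<open>A largest subgroup \<open>K\<close> that meets the cyclic group \<open>C\<close>
  trivially is a complement: an element outside the product of \<open>C\<close> and \<open>K\<close>
  could be used to enlarge \<open>K\<close>.\<close>

lemma (in comm_group) exists_complement:
  assumes fin: "finite (carrier G)" and x: "x \<in> carrier G"
    and ex: "\<And>y. y \<in> carrier G \<Longrightarrow> y [^] ord x = \<one>"
  shows "\<exists>K. subgroup K G \<and> generate G {x} \<inter> K = {\<one>} \<and> generate G {x} <#> K = carrier G"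
proof -
  define C where "C = generate G {x}"
  have C: "subgroup C G" unfolding C_def using x by (intro generate_is_subgroup) auto
  have xC: "x [^] (i::int) \<in> C" for i unfolding C_def using x by (auto simp: generate_pow)
  define S where "S = {K. subgroup K G \<and> C \<inter> K = {\<one>}}"
  have "S \<subseteq> Pow (carrier G)" by (auto simp: S_def dest: subgroup.subset)
  hence fS: "finite S" using fin finite_subset by blast
  have "{\<one>} \<in> S" using triv_subgroup C by (auto simp: S_def subgroup.one_closed)
  hence "S \<noteq> {}" by auto
  then obtain K where KS: "K \<in> S" and mx: "\<And>L. L \<in> S \<Longrightarrow> card L \<le> card K"
    using Max_in[of "card ` S"] Max_ge[of "card ` S"] fS by (metis (no_types, lifting) finite_imageI image_iff image_is_empty)
  have K: "subgroup K G" "C \<inter> K = {\<one>}" using KS by (auto simp: S_def)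
  define M where "M = C <#> K"
  have M: "subgroup M G" unfolding M_def by (rule mult_subgroups[OF C K(1)])
  have CM: "C \<subseteq> M" unfolding M_def set_mult_def using subgroup.one_closed[OF K(1)] subgroup.subset[OF C] by force
  have KM: "K \<subseteq> M" unfolding M_def set_mult_def using subgroup.one_closed[OF C] subgroup.subset[OF K(1)] by force
  have "M = carrier G"
  proof (rule ccontr)
    assume "M \<noteq> carrier G"
    then obtain y where y: "y \<in> carrier G" "y \<notin> M" using subgroup.subset[OF M] by blast
    have E0: "ord x > 0" using ord_ge_1[OF fin x] by simp
    \<comment> \<open>\<open>n\<close> is the order of \<open>y\<close> modulo
      \<open>M\<close>.\<close>
    define n where "n = (LEAST n. n > 0 \<and> y [^] (n::nat) \<in> M)"
    have "ord x > 0 \<and> y [^] ord x \<in> M" using E0 ex[OF y(1)] subgroup.one_closed[OF M] by simp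
    from LeastI[of "\<lambda>n. n > 0 \<and> y [^] (n::nat) \<in> M", OF this] have n: "n > 0" "y [^] n \<in> M"
      by (auto simp: n_def)
    have n_min: "n \<le> m" if "m > 0" "y [^] m \<in> M" for m
      unfolding n_def using that by (intro Least_le) auto
    have n_dvd: "int n dvd i" if "y [^] i \<in> M" for i :: int
    proof (rule ccontr)
      assume "\<not> int n dvd i"
      hence m: "nat (i mod int n) > 0" using n by (simp add: dvd_eq_mod_eq_0 order.not_eq_order_implies_strict)
      have "y [^] (i mod int n) = y [^] (i - int n * (i div int n))" by (simp add: minus_mult_div_eq_mod)
      also have "\<dots> = y [^] i \<otimes> inv ((y [^] n) [^] (i div int n))"
        using y by (simp add: int_pow_diff int_pow_pow flip: int_pow_int)
      also have "\<dots> \<in> M" using that n(2) M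
        by (meson subgroup.m_closed subgroup.m_inv_closed subgroup_int_pow_closed)
      finally have "y [^] nat (i mod int n) \<in> M" using n by (simp flip: int_pow_int)
      from n_min[OF m this] show False using n by (simp add: nat_le_iff le_nat_iff) (smt (verit) pos_mod_bound n(1) of_nat_0_less_iff)
    qed
    obtain c k where ck: "c \<in> C" "k \<in> K" "y [^] n = c \<otimes> k"
      using n(2) unfolding M_def set_mult_def by auto
    obtain s :: int where s: "c = x [^] s" using ck(1) x unfolding C_def by (auto simp: generate_pow)
    have kc: "k \<in> carrier G" using ck(2) subgroup.mem_carrier[OF K(1)] by blast
    have "int n dvd int (ord x)" by (rule n_dvd) (simp add: int_pow_int ex y subgroup.one_closed[OF M])
    hence "n dvd ord x" by simp
    then obtain d where d: "ord x = n * d" by auto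
    have d0: "d > 0" using E0 d by (auto intro: Nat.gr0I)
    \<comment> \<open>Here it matters that \<open>ord x\<close> kills \<open>y\<close>: raising
      \<open>y [^] n = c \<otimes> k\<close> to the power \<open>d\<close> shows that
      \<open>x [^] (s * int d)\<close> lies in both \<open>C\<close> and \<open>K\<close>. It is
      therefore trivial, so \<open>n * d\<close> divides \<open>s * d\<close> and \<open>n\<close>
      divides \<open>s\<close>.\<close>
    have "\<one> = (y [^] n) [^] d" using y ex by (simp add: nat_pow_pow flip: d)
    also have "\<dots> = x [^] (s * int d) \<otimes> k [^] d"
      using ck s x kc by (simp add: int_pow_distrib int_pow_pow flip: int_pow_int)
    finally have "x [^] (s * int d) = inv (k [^] d)"
      using x kc by (metis int_pow_closed inv_equality nat_pow_closed)
    moreover have "inv (k [^] d) \<in> K" using ck K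
      by (metis int_pow_int subgroup.m_inv_closed subgroup_int_pow_closed)
    ultimately have "x [^] (s * int d) = \<one>" using xC[of "s * int d"] K(2) by auto
    hence "int (ord x) dvd s * int d" using x by (simp add: int_pow_eq_id)
    hence "int n dvd s" using d d0 by simp
    then obtain t where t: "s = int n * t" by auto
    \<comment> \<open>Correcting \<open>y\<close> by a power of \<open>x\<close> moves its \<open>n\<close>-th power into \<open>K\<close>, so adjoining the result to \<open>K\<close> keeps the intersection with \<open>C\<close> trivial.\<close>
    define z where "z = y \<otimes> x [^] (- t)"
    have z: "z \<in> carrier G" using x y by (simp add: z_def)
    have zn: "z [^] n = k"
    proof -
      have "z [^] n = y [^] n \<otimes> x [^] (- s)"
        using x y by (simp add: z_def int_pow_distrib t int_pow_pow mult.commute flip: int_pow_int)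
      also have "\<dots> = k" using ck s x kc by (simp add: int_pow_neg m_assoc m_lcomm)
      finally show ?thesis .
    qed
    have zi: "y [^] i \<in> M" if "z [^] i \<in> M" for i :: int
    proof -
      have "y [^] i = z [^] i \<otimes> x [^] (t * i)"
        using x y by (simp add: z_def int_pow_distrib int_pow_pow m_assoc flip: int_pow_mult)
      thus ?thesis using that xC[of "t * i"] CM M by (auto intro: subgroup.m_closed)
    qed
    define L where "L = K <#> generate G {z}"
    have L: "subgroup L G" unfolding L_def
      using z by (intro mult_subgroups K generate_is_subgroup) auto
    have "w = \<one>" if w: "w \<in> C" "w \<in> L" for w
    proof -
      obtain k1 i where k1: "k1 \<in> K" "w = k1 \<otimes> z [^] (i::int)"
        using w(2) z unfolding L_def set_mult_def by (auto simp: generate_pow)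
      have k1c: "k1 \<in> carrier G" using k1(1) subgroup.mem_carrier[OF K(1)] by blast
      have "z [^] i = inv k1 \<otimes> w" using k1 k1c z by (simp add: inv_solve_left)
      also have "\<dots> \<in> M" using k1 w CM KM M by (meson subgroup.m_closed subgroup.m_inv_closed subsetD)
      finally have "int n dvd i" using zi n_dvd by blast
      then obtain j where "i = int n * j" by auto
      hence "z [^] i = k [^] j" using z by (simp add: int_pow_pow flip: int_pow_int zn)
      hence "w \<in> K" using k1 ck K by (metis subgroup.m_closed subgroup_int_pow_closed)
      thus ?thesis using w K by auto
    qed
    hence "L \<in> S" using L C by (auto simp: S_def subgroup.one_closed)
    hence "card L \<le> card K" by (rule mx)
    moreover have "K \<subset> L"
    proof
      have g: "\<one> \<in> generate G {z}" "z \<in> generate G {z}" by (auto intro: generate.intros)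
      show "K \<subseteq> L" unfolding L_def set_mult_def using g subgroup.mem_carrier[OF K(1)] by force
      have "z \<in> L" unfolding L_def set_mult_def using g z subgroup.one_closed[OF K(1)] by force
      moreover have "z \<notin> K"
      proof
        assume "z \<in> K"
        hence "z [^] (1::int) \<in> M" using KM z by auto
        hence "y [^] (1::int) \<in> M" by (rule zi)
        thus False using y by simp
      qed
      ultimately show "K \<noteq> L" by blast
    qed
    moreover have "finite L" using L fin subgroup.subset finite_subset by blast
    ultimately show False by (meson leD psubset_card_mono)
  qed
  thus ?thesis using K by (auto simp: C_def M_def)
qed

text \<open>Take \<open>x\<close> of order equal to the exponent and a complement \<open>K\<close>
  of the group it generates.\<close>

lemma exists_cyclic_split:
  fixes G :: "'g monoid" (structure)
  assumes "comm_group G" and fin: "finite (carrier G)" and nt: "carrier G \<noteq> {\<one>}"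
  shows "\<exists>x n K e r. cyclic_split G x n K e r"
proof -
  interpret comm_group G by fact
  obtain x where x: "x \<in> carrier G" and ex: "\<And>y. y \<in> carrier G \<Longrightarrow> y [^] ord x = \<one>"
    using exists_exponent_element[OF fin] by blast
  obtain K where K: "subgroup K G" "generate G {x} \<inter> K = {\<one>}" "generate G {x} <#> K = carrier G"
    using exists_complement[OF fin x ex] by blast
  define n where "n = ord x"
  have n0: "n > 0" using ord_ge_1[OF fin x] by (simp add: n_def)
  have n1: "n > 1"
  proof (rule ccontr)
    assume "\<not> n > 1"
    hence "ord x = 1" using n0 by (simp add: n_def)
    hence "y = \<one>" if "y \<in> carrier G" for y using ex[OF that] that by simp
    thus False using nt by blast
  qed
  have Kc: "k \<in> carrier G" if "k \<in> K" for k using that subgroup.mem_carrier[OF K(1)] by blast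
  have gen: "generate G {x} = {x [^] k | k. k \<in> (UNIV :: nat set)}"
    using generate_pow_nat[OF x] n0 by (simp add: n_def)
  have powmod: "x [^] (k mod n) = x [^] k" for k :: nat
  proof -
    have "x [^] k = x [^] (n * (k div n) + k mod n)" by simp
    also have "\<dots> = (x [^] n) [^] (k div n) \<otimes> x [^] (k mod n)"
      using x by (simp only: nat_pow_pow nat_pow_mult)
    also have "\<dots> = x [^] (k mod n)" using x by (simp add: n_def)
    finally show ?thesis by simp
  qed
  have ex1: "\<exists>i k. i < n \<and> k \<in> K \<and> x [^] i \<otimes> k = g" if g: "g \<in> carrier G" for g
  proof -
    have "g \<in> generate G {x} <#> K" using g K(3) by simp
    then obtain i k where "k \<in> K" "g = x [^] (i::nat) \<otimes> k"
      unfolding set_mult_def gen by auto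
    thus ?thesis using powmod[of i] n0 by (intro exI[of _ "i mod n"] exI[of _ k]) auto
  qed
  \<comment> \<open>The quotient of the two powers of \<open>x\<close> equals
    \<open>l \<otimes> inv k\<close>; it lies in both factors and is trivial.\<close>
  have uniq: "i mod n = j mod n \<and> k = l" if "x [^] i \<otimes> k = x [^] j \<otimes> l" "k \<in> K" "l \<in> K" for i j :: nat and k l
  proof -
    have "x [^] (int i - int j) = x [^] i \<otimes> inv (x [^] j)"
      using x by (simp add: int_pow_diff int_pow_int)
    also have "\<dots> = l \<otimes> inv k"
    proof -
      have c: "x [^] i \<in> carrier G" "x [^] j \<in> carrier G" "k \<in> carrier G" "l \<in> carrier G"
        using x Kc that by auto
      hence "x [^] i = (x [^] j \<otimes> l) \<otimes> inv k" using that(1) by (simp add: inv_solve_right)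
      also have "\<dots> = (l \<otimes> inv k) \<otimes> x [^] j" using c by (simp add: m_ac)
      finally show ?thesis using c by (simp add: m_assoc)
    qed
    finally have *: "x [^] (int i - int j) = l \<otimes> inv k" .
    have "l \<otimes> inv k \<in> K" using that K by (meson subgroup.m_closed subgroup.m_inv_closed)
    moreover have "x [^] (int i - int j) \<in> generate G {x}" using x by (auto simp: generate_pow)
    ultimately have 1: "x [^] (int i - int j) = \<one>" using * K(2) by auto
    hence "int n dvd int i - int j" using x by (simp add: int_pow_eq_id n_def)
    hence "int i mod int n = int j mod int n" by (simp add: mod_eq_dvd_iff)
    hence "i mod n = j mod n" by (simp flip: zmod_int)
    moreover have "k = l" using * 1 Kc that by (metis inv_solve_right' l_one one_closed)
    ultimately show ?thesis ..
  qed
  from ex1 have "\<forall>g\<in>carrier G. \<exists>p. fst p < n \<and> snd p \<in> K \<and> x [^] fst p \<otimes> snd p = g" by force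
  then obtain p where p: "\<And>g. g \<in> carrier G \<Longrightarrow> fst (p g) < n \<and> snd (p g) \<in> K \<and> x [^] fst (p g) \<otimes> snd (p g) = g"
    by metis
  define e r where "e g = fst (p g)" and "r g = snd (p g)" for g
  have er: "e g < n" "r g \<in> K" "x [^] e g \<otimes> r g = g" if "g \<in> carrier G" for g
    using p[OF that] by (auto simp: e_def r_def)
  \<comment> \<open>By uniqueness any product representation of \<open>g\<close> reveals its
    coordinates, so each remaining axiom on \<open>e\<close> and \<open>r\<close> is proved by
    exhibiting one.\<close>
  have eI: "e g = i mod n \<and> r g = k" if "g = x [^] i \<otimes> k" "k \<in> K" for g i k
  proof -
    have "g \<in> carrier G" using that x Kc by simp
    from uniq[of "e g" "r g" i k] er[OF this] that show ?thesis by simp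
  qed
  have "cyclic_split G x n K e r"
  proof (intro cyclic_split.intro[OF comm_group_axioms] cyclic_split_axioms.intro)
    fix g h assume gh: "g \<in> carrier G" "h \<in> carrier G"
    have c: "r g \<in> carrier G" "r h \<in> carrier G" using er gh Kc by auto
    have "g \<otimes> h = (x [^] e g \<otimes> r g) \<otimes> (x [^] e h \<otimes> r h)" using er gh by simp
    also have "\<dots> = x [^] (e g + e h) \<otimes> (r g \<otimes> r h)"
      using x c by (simp add: nat_pow_mult[symmetric] m_ac)
    finally have "e (g \<otimes> h) = (e g + e h) mod n \<and> r (g \<otimes> h) = r g \<otimes> r h"
      using er gh K by (intro eI) (auto intro: subgroup.m_closed)
    thus "e (g \<otimes> h) = (e g + e h) mod n" "r (g \<otimes> h) = r g \<otimes> r h" by auto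
  next
    have "e x = 1 mod n \<and> r x = \<one>" using x K by (intro eI) (auto intro: subgroup.one_closed)
    thus "e x = 1" "r x = \<one>" using n1 by auto
  next
    fix k assume "k \<in> K"
    hence "e k = 0 mod n \<and> r k = k" using Kc by (intro eI) auto
    thus "e k = 0" "r k = k" by auto
  qed (use fin n1 K x er ex in \<open>auto simp: n_def\<close>)
  thus ?thesis by blast
qed

context cyclic_split begin

lemma K_carrier: "k \<in> K \<Longrightarrow> k \<in> carrier G"
  by (rule subgroup.mem_carrier[OF subgroup_K])

lemma finite_K: "finite K"
  using finite_carrier K_carrier by (meson finite_subset subsetI)

lemma comm_group_K: "comm_group (G\<lparr>carrier := K\<rparr>)"
  by (intro group.group_comm_groupI subgroup_imp_group subgroup_K) (auto simp: m_comm K_carrier)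

lemma e_pow: "e (x [^] i) = i mod n" "r (x [^] i) = \<one>" for i :: nat
  using subgroup.one_closed[OF subgroup_K] e_K r_K n_gt_1
  by (induction i) (auto simp: e_mult r_mult x_closed e_x r_x mod_Suc_eq)

lemma e_r_pair:
  fixes i :: nat
  assumes "k \<in> K"
  shows "e (x [^] i \<otimes> k) = i mod n" "r (x [^] i \<otimes> k) = k"
  using assms by (simp_all add: e_mult r_mult x_closed K_carrier e_pow e_K r_K)

lemma bij_betw_split: "bij_betw (\<lambda>g. (e g, r g)) (carrier G) ({..<n} \<times> K)"
  by (rule bij_betw_byWitness[where f' = "\<lambda>(i, k). x [^] i \<otimes> k"])
     (auto simp: e_r e_r_pair e_less r_closed K_carrier x_closed)

lemma card_carrier: "card (carrier G) = n * card K"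
  using bij_betw_same_card[OF bij_betw_split] by (simp add: card_cartesian_product)

lemma dvd_of_exponent:
  assumes "x [^] N = \<one>" shows "n dvd N"
proof -
  have "N mod n = 0" using e_pow(1)[of N] e_K[of \<one>] subgroup.one_closed[OF subgroup_K] assms by simp
  thus ?thesis by auto
qed

end

lemma decomposition_card: "decomposition G ns \<Longrightarrow> finite (carrier G) \<and> card (carrier G) = prod_list ns"
proof (induction rule: decomposition.induct)
  case (split G x n K e r ns)
  interpret cyclic_split G x n K e r by (rule split.hyps)
  show ?case using split.IH card_carrier finite_carrier by simp
qed auto

lemma decomposition_gt_1: "decomposition G ns \<Longrightarrow> \<forall>m\<in>set ns. m > 1"
  by (induction rule: decomposition.induct) (auto simp: cyclic_split_def cyclic_split_axioms_def)

lemma decomposition_dvd_exponent: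
  "decomposition G ns \<Longrightarrow> \<forall>y\<in>carrier G. y [^]\<^bsub>G\<^esub> N = \<one>\<^bsub>G\<^esub> \<Longrightarrow> \<forall>m\<in>set ns. m dvd (N::nat)"
proof (induction rule: decomposition.induct)
  case (split G x n K e r ns)
  interpret cyclic_split G x n K e r by (rule split.hyps)
  have "n dvd N" using split.prems x_closed by (intro dvd_of_exponent) auto
  moreover have "\<forall>y\<in>carrier (G\<lparr>carrier := K\<rparr>). y [^]\<^bsub>G\<lparr>carrier := K\<rparr>\<^esub> N = \<one>\<^bsub>G\<lparr>carrier := K\<rparr>\<^esub>"
    using split.prems K_carrier by (simp flip: nat_pow_consistent)
  ultimately show ?case using split.IH by auto
qed auto

text \<open>All elements of \<open>K\<close> are killed by \<open>n\<close>, and the invariant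
  factors of a group divide every number that kills the group.\<close>

lemma decomposition_sorted: "decomposition G ns \<Longrightarrow> sorted_wrt (\<lambda>a b. b dvd a) ns"
proof (induction rule: decomposition.induct)
  case (split G x n K e r ns)
  interpret cyclic_split G x n K e r by (rule split.hyps)
  have "\<forall>m\<in>set ns. m dvd n"
    using K_carrier exponent
    by (intro decomposition_dvd_exponent[OF split.hyps(2)]) (auto simp flip: nat_pow_consistent)
  thus ?case using split.IH by auto
qed auto

lemma exists_decomposition:
  assumes "comm_group G" "finite (carrier G)"
  shows "\<exists>ns. decomposition G ns"
  using assms
proof (induction "card (carrier G)" arbitrary: G rule: less_induct)
  case less
  interpret comm_group G by fact
  show ?case
  proof (cases "carrier G = {\<one>\<^bsub>G\<^esub>}")
    case True
    thus ?thesis using decomposition.trivial[OF less.prems(1) True] by blast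
  next
    case False
    then obtain x n K e r where s: "cyclic_split G x n K e r"
      using exists_cyclic_split[OF less.prems False] by blast
    then interpret cyclic_split G x n K e r .
    have "card K > 0" using finite_K subgroup.one_closed[OF subgroup_K] by (auto simp: card_gt_0_iff)
    hence "card K < card (carrier G)" using card_carrier n_gt_1 by simp
    then obtain ns where "decomposition (G\<lparr>carrier := K\<rparr>) ns"
      using less.hyps[of "G\<lparr>carrier := K\<rparr>"] comm_group_K finite_K by auto
    thus ?thesis using decomposition.split[OF s] by blast
  qed
qed

lemma decomposition_group_exponent:
  assumes "decomposition G ns"
  shows "group_exponent G = (case ns of [] \<Rightarrow> 1 | n # _ \<Rightarrow> n)"
  using assms
proof cases
  case trivial
  thus ?thesis unfolding group_exponent_def
    by (auto intro!: Least_equality simp: comm_group_def monoid.nat_pow_one group.is_monoid)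
next
  case (split x n K e r ms)
  interpret cyclic_split G x n K e r by (rule split)
  have "group_exponent G = n" unfolding group_exponent_def
    by (rule Least_equality) (use n_gt_1 exponent dvd_of_exponent x_closed in \<open>auto intro: dvd_imp_le\<close>)
  thus ?thesis using split(1) by simp
qed

text \<open>The isomorphism matches coordinates: it sends \<open>x\<close> to \<open>x'\<close>, and
  \<open>K\<close> to \<open>K'\<close> by induction.\<close>

lemma decomposition_iso:
  fixes G :: "'g monoid" and H :: "'h monoid"
  assumes "decomposition G ns" "decomposition H ns"
  shows "G \<cong> H"
  using assms
proof (induction arbitrary: H rule: decomposition.induct)
  case (trivial G)
  from trivial.prems have H: "comm_group H" "carrier H = {\<one>\<^bsub>H\<^esub>}"
    by (cases; simp)+
  then interpret H: comm_group H by simp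
  interpret G: comm_group G by fact
  have "(\<lambda>_. \<one>\<^bsub>H\<^esub>) \<in> iso G H" using trivial H by (auto simp: iso_def hom_def bij_betw_def)
  thus ?case by (auto simp: is_iso_def)
next
  case (split G x n K e r ns)
  interpret G: cyclic_split G x n K e r by (rule split.hyps)
  from split.prems obtain x' K' e' r' where
    H: "cyclic_split H x' n K' e' r'" "decomposition (H\<lparr>carrier := K'\<rparr>) ns" by cases auto
  then interpret H: cyclic_split H x' n K' e' r' by simp
  obtain \<phi> where "\<phi> \<in> iso (G\<lparr>carrier := K\<rparr>) (H\<lparr>carrier := K'\<rparr>)"
    using split.IH[OF H(2)] by (auto simp: is_iso_def)
  hence \<phi>: "bij_betw \<phi> K K'" "\<And>k. k \<in> K \<Longrightarrow> \<phi> k \<in> K'"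
      "\<And>k l. k \<in> K \<Longrightarrow> l \<in> K \<Longrightarrow> \<phi> (k \<otimes>\<^bsub>G\<^esub> l) = \<phi> k \<otimes>\<^bsub>H\<^esub> \<phi> l"
    by (auto simp: iso_def hom_def)
  define f where "f g = x' [^]\<^bsub>H\<^esub> e g \<otimes>\<^bsub>H\<^esub> \<phi> (r g)" for g
  have 1: "bij_betw (map_prod id \<phi>) ({..<n} \<times> K) ({..<n} \<times> K')"
    using \<phi> by (intro bij_betw_map_prod) auto
  have 2: "bij_betw (\<lambda>(i, k). x' [^]\<^bsub>H\<^esub> i \<otimes>\<^bsub>H\<^esub> k) ({..<n} \<times> K') (carrier H)"
    by (rule bij_betw_byWitness[where f' = "\<lambda>g. (e' g, r' g)"])
       (auto simp: H.e_r H.e_r_pair H.e_less H.r_closed H.K_carrier H.x_closed)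
  from bij_betw_trans[OF bij_betw_trans[OF G.bij_betw_split 1] 2]
  have "bij_betw f (carrier G) (carrier H)" by (simp add: f_def[abs_def] comp_def)
  moreover have "f (g \<otimes>\<^bsub>G\<^esub> h) = f g \<otimes>\<^bsub>H\<^esub> f h" if "g \<in> carrier G" "h \<in> carrier G" for g h
  proof -
    have c: "\<phi> (r g) \<in> carrier H" "\<phi> (r h) \<in> carrier H" using that \<phi> G.r_closed H.K_carrier by auto
    have *: "x' [^]\<^bsub>H\<^esub> (k mod n) = x' [^]\<^bsub>H\<^esub> k" for k :: nat
      using H.e_r[of "x' [^]\<^bsub>H\<^esub> k"] by (simp add: H.e_pow H.x_closed)
    show ?thesis using that \<phi> c G.r_closed
      by (simp add: f_def G.e_mult G.r_mult * H.m_ac H.x_closed H.nat_pow_mult[symmetric])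
  qed
  ultimately have "f \<in> iso G H" by (auto simp: iso_def hom_def bij_betw_def)
  thus ?case by (auto simp: is_iso_def)
qed

section \<open>Characters and alternating bicharacters\<close>

text \<open>Extensional functions, here and for bicharacters, so that they are determined by their
  values on the carrier and can be counted. The value set \<open>U\<close> varies between roots of
  unity in \<open>F\<close> and the units of fields between \<open>F\<close> and its
  closure.\<close>

definition characters :: "('g, 'b) monoid_scheme \<Rightarrow> 'a::field set \<Rightarrow> ('g \<Rightarrow> 'a) set" where
  "characters G U = {\<chi> \<in> carrier G \<rightarrow>\<^sub>E U.
     \<forall>g\<in>carrier G. \<forall>h\<in>carrier G. \<chi> (g \<otimes>\<^bsub>G\<^esub> h) = \<chi> g * \<chi> h}"

definition bicharacters :: "('g, 'b) monoid_scheme \<Rightarrow> 'a::field set \<Rightarrow> ('g \<Rightarrow> 'g \<Rightarrow> 'a) set" where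
  "bicharacters G U = {b \<in> carrier G \<rightarrow>\<^sub>E carrier G \<rightarrow>\<^sub>E U.
     \<forall>g\<in>carrier G. \<forall>h\<in>carrier G. \<forall>k\<in>carrier G.
       b (g \<otimes>\<^bsub>G\<^esub> h) k = b g k * b h k \<and> b g (h \<otimes>\<^bsub>G\<^esub> k) = b g h * b g k}"

definition alternating_bicharacters :: "('g, 'b) monoid_scheme \<Rightarrow> 'a::field set \<Rightarrow> ('g \<Rightarrow> 'g \<Rightarrow> 'a) set" where
  "alternating_bicharacters G U = {b \<in> bicharacters G U. \<forall>g\<in>carrier G. b g g = 1}"

definition mult_subgroup :: "'a::field set \<Rightarrow> bool" where
  "mult_subgroup U \<longleftrightarrow> 1 \<in> U \<and> 0 \<notin> U \<and> (\<forall>a\<in>U. \<forall>b\<in>U. a * b \<in> U) \<and> (\<forall>a\<in>U. inverse a \<in> U)"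

lemma mult_subgroup_power: "mult_subgroup U \<Longrightarrow> a \<in> U \<Longrightarrow> a ^ n \<in> U"
  by (induction n) (auto simp: mult_subgroup_def)

lemma mult_subgroup_roots: "mult_subgroup U \<Longrightarrow> 0 < n \<Longrightarrow> mult_subgroup {z \<in> U. z ^ n = 1}"
  by (auto simp: mult_subgroup_def power_mult_distrib field_simps power_inverse)

lemma power_eq_1_mod:
  fixes z :: "'a::field"
  assumes "z ^ n = 1"
  shows "z ^ (k mod n) = z ^ k"
proof -
  have "z ^ k = z ^ (n * (k div n) + k mod n)" by simp
  also have "\<dots> = z ^ (k mod n)" unfolding power_add power_mult using assms by simp
  finally show ?thesis by (rule sym)
qed

lemma characters_closed: "\<chi> \<in> characters G U \<Longrightarrow> g \<in> carrier G \<Longrightarrow> \<chi> g \<in> U"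
  by (auto simp: characters_def)

lemma characters_mult:
  "\<chi> \<in> characters G U \<Longrightarrow> g \<in> carrier G \<Longrightarrow> h \<in> carrier G \<Longrightarrow> \<chi> (g \<otimes>\<^bsub>G\<^esub> h) = \<chi> g * \<chi> h"
  by (auto simp: characters_def)

lemma characters_nonzero:
  "mult_subgroup U \<Longrightarrow> \<chi> \<in> characters G U \<Longrightarrow> g \<in> carrier G \<Longrightarrow> \<chi> g \<noteq> 0"
  by (metis characters_closed mult_subgroup_def)

lemma characters_one:
  fixes G (structure)
  assumes "group G" "mult_subgroup U" "\<chi> \<in> characters G U"
  shows "\<chi> \<one> = 1"
proof -
  interpret group G by fact
  have "\<chi> (\<one> \<otimes> \<one>) = \<chi> \<one> * \<chi> \<one>"
    using assms(3) by (intro characters_mult) auto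
  moreover have "\<chi> \<one> \<noteq> 0" using assms by (intro characters_nonzero) auto
  ultimately show ?thesis by simp
qed

lemma characters_pow:
  assumes "group G" "mult_subgroup U" "\<chi> \<in> characters G U" "g \<in> carrier G"
  shows "\<chi> (g [^]\<^bsub>G\<^esub> (n::nat)) = \<chi> g ^ n"
proof -
  interpret group G by fact
  show ?thesis
    using assms by (induction n) (auto simp: characters_one characters_mult)
qed

context cyclic_split begin

text \<open>A character can be prescribed freely on the two factors, its value at \<open>x\<close>
  being any \<open>n\<close>-th root of unity in \<open>U\<close>: in the inverse map,
  \<open>z ^ n = 1\<close> absorbs the reduction modulo \<open>n\<close> that occurs in
  \<open>e_mult\<close>.\<close>

lemma characters_split:
  assumes U: "mult_subgroup U"
  shows "bij_betw (\<lambda>\<chi>. (\<chi> x, restrict \<chi> K)) (characters G U)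
           ({z \<in> U. z ^ n = 1} \<times> characters (G\<lparr>carrier := K\<rparr>) U)"
proof (rule bij_betw_byWitness[where f' = "\<lambda>(z, \<xi>). \<lambda>g\<in>carrier G. z ^ e g * \<xi> (r g)"])
  have oneK: "\<one> \<in> K" using subgroup.one_closed[OF subgroup_K] .
  interpret K: comm_group "G\<lparr>carrier := K\<rparr>" by (rule comm_group_K)
  have m: "a * b \<in> U" if "a \<in> U" "b \<in> U" for a b using that U by (auto simp: mult_subgroup_def)
  have mK: "k \<otimes> l \<in> K" if "k \<in> K" "l \<in> K" for k l using that subgroup.m_closed[OF subgroup_K] by blast
  have \<chi>1: "\<chi> (x [^] i \<otimes> k) = \<chi> x ^ i * \<chi> k" if "\<chi> \<in> characters G U" "k \<in> K" for \<chi> k and i :: nat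
    using that characters_pow[OF is_group U that(1)] x_closed K_carrier
    by (auto simp: characters_def)
  show "\<forall>\<chi>\<in>characters G U. (case (\<chi> x, restrict \<chi> K) of (z, \<xi>) \<Rightarrow> \<lambda>g\<in>carrier G. z ^ e g * \<xi> (r g)) = \<chi>"
  proof
    fix \<chi> assume \<chi>: "\<chi> \<in> characters G U"
    have "\<chi> x ^ e g * \<chi> (r g) = \<chi> g" if "g \<in> carrier G" for g
      using \<chi>1[OF \<chi> r_closed[OF that], of "e g"] e_r[OF that] by simp
    thus "(case (\<chi> x, restrict \<chi> K) of (z, \<xi>) \<Rightarrow> \<lambda>g\<in>carrier G. z ^ e g * \<xi> (r g)) = \<chi>"
      using \<chi> r_closed by (auto simp: characters_def fun_eq_iff restrict_def PiE_def extensional_def)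
  qed
  have 2: "(\<lambda>g\<in>carrier G. z ^ e g * \<xi> (r g)) \<in> characters G U"
    if "z \<in> U" "z ^ n = 1" "\<xi> \<in> characters (G\<lparr>carrier := K\<rparr>) U" for z \<xi>
    using that r_closed U power_eq_1_mod[OF that(2)]
    by (auto simp: characters_def e_mult r_mult power_add PiE_iff intro!: m mult_subgroup_power)
  show "\<forall>a'\<in>{z \<in> U. z ^ n = 1} \<times> characters (G\<lparr>carrier := K\<rparr>) U.
       ((case a' of (z, \<xi>) \<Rightarrow> \<lambda>g\<in>carrier G. z ^ e g * \<xi> (r g)) x,
        restrict (case a' of (z, \<xi>) \<Rightarrow> \<lambda>g\<in>carrier G. z ^ e g * \<xi> (r g)) K) = a'"
    using characters_one[OF K.is_group U] K_carrier
    by (auto simp: x_closed e_x r_x e_K r_K restrict_def fun_eq_iff)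
       (auto simp: characters_def PiE_iff extensional_def)
  show "(\<lambda>\<chi>. (\<chi> x, restrict \<chi> K)) ` characters G U
    \<subseteq> {z \<in> U. z ^ n = 1} \<times> characters (G\<lparr>carrier := K\<rparr>) U"
  proof safe
    fix \<chi> assume \<chi>: "\<chi> \<in> characters G U"
    show "\<chi> x \<in> U" using \<chi> x_closed by (auto simp: characters_def)
    show "\<chi> x ^ n = 1" using characters_pow[OF is_group U \<chi> x_closed, of n] exponent[OF x_closed]
      characters_one[OF is_group U \<chi>] by simp
    show "restrict \<chi> K \<in> characters (G\<lparr>carrier := K\<rparr>) U"
      using \<chi> K_carrier mK by (auto simp: characters_def)
  qed
  show "(\<lambda>(z, \<xi>). \<lambda>g\<in>carrier G. z ^ e g * \<xi> (r g)) ` ({z \<in> U. z ^ n = 1} \<times> characters (G\<lparr>carrier := K\<rparr>) U)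
    \<subseteq> characters G U"
    using 2 by auto
qed

end

lemma bicharacters_mult:
  assumes "b \<in> bicharacters G U" "g \<in> carrier G" "h \<in> carrier G" "k \<in> carrier G"
  shows "b (g \<otimes>\<^bsub>G\<^esub> h) k = b g k * b h k" "b g (h \<otimes>\<^bsub>G\<^esub> k) = b g h * b g k"
  using assms by (auto simp: bicharacters_def)

text \<open>Expand \<open>b (g \<otimes> h) (g \<otimes> h) = 1\<close> in both arguments.\<close>

lemma alternating_skew:
  fixes G (structure)
  assumes "group G" "b \<in> alternating_bicharacters G U" "g \<in> carrier G" "h \<in> carrier G"
  shows "b g h * b h g = 1"
proof -
  interpret group G by fact
  have b: "b \<in> bicharacters G U" "\<And>g. g \<in> carrier G \<Longrightarrow> b g g = 1"
    using assms(2) by (auto simp: alternating_bicharacters_def)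
  have "1 = b (g \<otimes> h) (g \<otimes> h)" using b assms by simp
  also have "\<dots> = (b g g * b g h) * (b h g * b h h)"
    using assms by (simp add: bicharacters_mult[OF b(1)])
  also have "\<dots> = b g h * b h g" using b assms by simp
  finally show ?thesis by simp
qed

lemma bicharacters_fix:
  assumes "b \<in> bicharacters G U" "g \<in> carrier G" "group G"
  shows "b g \<in> characters G U" "(\<lambda>h\<in>carrier G. b h g) \<in> characters G U"
proof -
  interpret group G by fact
  show "b g \<in> characters G U" using assms by (auto simp: bicharacters_def characters_def)
  show "(\<lambda>h\<in>carrier G. b h g) \<in> characters G U"
    using assms by (auto simp: bicharacters_def characters_def)
qed

context cyclic_split begin

text \<open>An alternating form is trivial on the cyclic factor, and its values at
  \<open>(k, x)\<close> are the inverses of those at \<open>(x, k)\<close>. What remains is the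
  pairing of \<open>x\<close> with \<open>K\<close> and the form on \<open>K\<close>.\<close>

lemma alternating_split:
  assumes U: "mult_subgroup U"
  shows "bij_betw (\<lambda>b. (restrict (b x) K, \<lambda>k\<in>K. restrict (b k) K)) (alternating_bicharacters G U)
           (characters (G\<lparr>carrier := K\<rparr>) U \<times> alternating_bicharacters (G\<lparr>carrier := K\<rparr>) U)"
proof -
  interpret K: comm_group "G\<lparr>carrier := K\<rparr>" by (rule comm_group_K)
  have mK: "k \<otimes> l \<in> K" if "k \<in> K" "l \<in> K" for k l using that subgroup.m_closed[OF subgroup_K] by blast
  have oneK: "\<one> \<in> K" using subgroup.one_closed[OF subgroup_K] .
  have m: "a * b \<in> U" if "a \<in> U" "b \<in> U" for a b using that U by (auto simp: mult_subgroup_def)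
  have i: "inverse a \<in> U" if "a \<in> U" for a using that U by (auto simp: mult_subgroup_def)
  let ?f = "\<lambda>b. (restrict (b x) K, \<lambda>k\<in>K. restrict (b k) K)"
  \<comment> \<open>The inverse map comes from expanding a form at
    \<open>x [^] e g \<otimes> r g\<close> and \<open>x [^] e h \<otimes> r h\<close>.\<close>
  define F where "F \<xi> c = (\<lambda>g\<in>carrier G. \<lambda>h\<in>carrier G. \<xi> (r h) ^ e g * inverse (\<xi> (r g)) ^ e h * c (r g) (r h))"
    for \<xi> :: "'g \<Rightarrow> 'a" and c :: "'g \<Rightarrow> 'g \<Rightarrow> 'a"
  have F: "F \<xi> c \<in> alternating_bicharacters G U \<and> ?f (F \<xi> c) = (\<xi>, c)"
    if \<xi>: "\<xi> \<in> characters (G\<lparr>carrier := K\<rparr>) U" and c: "c \<in> alternating_bicharacters (G\<lparr>carrier := K\<rparr>) U" for \<xi> c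
  proof
    \<comment> \<open>Since \<open>n\<close> kills \<open>K\<close>, every character of
      \<open>K\<close> has values in the \<open>n\<close>-th roots of unity and may serve as the
      pairing with \<open>x\<close>.\<close>
    have \<xi>n: "\<xi> k ^ n = 1" if "k \<in> K" for k
    proof -
      have "\<xi> (k [^]\<^bsub>G\<lparr>carrier := K\<rparr>\<^esub> n) = \<xi> k ^ n"
        using that by (intro characters_pow[OF K.is_group U \<xi>]) auto
      thus ?thesis using exponent[OF K_carrier[OF that]] characters_one[OF K.is_group U \<xi>]
        by (simp flip: nat_pow_consistent)
    qed
    have \<xi>p: "\<xi> k ^ (j mod n) = \<xi> k ^ j" "inverse (\<xi> k) ^ (j mod n) = inverse (\<xi> k) ^ j" if "k \<in> K" for k j
      using power_eq_1_mod[OF \<xi>n[OF that]] by (simp_all add: power_inverse)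
    have \<xi>U: "\<xi> k \<in> U" if "k \<in> K" for k
      using that \<xi> by (auto simp: characters_def)
    hence \<xi>0: "\<xi> k \<noteq> 0" if "k \<in> K" for k
      using that U by (metis mult_subgroup_def)
    have \<xi>m: "\<xi> (k \<otimes> l) = \<xi> k * \<xi> l" if "k \<in> K" "l \<in> K" for k l
      using that \<xi> by (auto simp: characters_def)
    have \<xi>1: "\<xi> \<one> = 1" using characters_one[OF K.is_group U \<xi>] by simp
    have cU: "c k l \<in> U" if "k \<in> K" "l \<in> K" for k l
      using that c by (auto simp: alternating_bicharacters_def bicharacters_def)
    have cm: "c (k \<otimes> l) j = c k j * c l j" "c j (k \<otimes> l) = c j k * c j l" if "k \<in> K" "l \<in> K" "j \<in> K" for k l j
      using that c by (auto simp: alternating_bicharacters_def bicharacters_def)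
    have c1: "c k k = 1" if "k \<in> K" for k using that c by (auto simp: alternating_bicharacters_def)
    have c2: "c k \<one> = 1" "c \<one> k = 1" if "k \<in> K" for k
    proof -
      have c': "c \<in> bicharacters (G\<lparr>carrier := K\<rparr>) U" using c by (simp add: alternating_bicharacters_def)
      show "c k \<one> = 1" "c \<one> k = 1"
        using characters_one[OF K.is_group U bicharacters_fix(1)[OF c' _ K.is_group]]
          characters_one[OF K.is_group U bicharacters_fix(2)[OF c' _ K.is_group]] that oneK by auto
    qed
    show "F \<xi> c \<in> alternating_bicharacters G U"
      unfolding alternating_bicharacters_def bicharacters_def
    proof (intro CollectI conjI ballI)
      show "F \<xi> c \<in> carrier G \<rightarrow>\<^sub>E carrier G \<rightarrow>\<^sub>E U"
        by (auto simp: F_def intro!: m i mult_subgroup_power[OF U] \<xi>U cU r_closed)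
    next
      fix g assume "g \<in> carrier G"
      thus "F \<xi> c g g = 1"
        using r_closed \<xi>0 by (auto simp: F_def c1 power_inverse)
    next
      fix g h k assume "g \<in> carrier G" "h \<in> carrier G" "k \<in> carrier G"
      thus "F \<xi> c (g \<otimes> h) k = F \<xi> c g k * F \<xi> c h k" "F \<xi> c g (h \<otimes> k) = F \<xi> c g h * F \<xi> c g k"
        using r_closed by (simp_all add: F_def e_mult r_mult \<xi>p \<xi>m cm power_add power_mult_distrib)
    qed
    have "?f (F \<xi> c) = (restrict \<xi> K, \<lambda>k\<in>K. restrict (c k) K)"
      using K_carrier x_closed oneK
      by (auto simp: F_def fun_eq_iff e_x r_x e_K r_K \<xi>1 c2)
    also have "\<dots> = (\<xi>, c)"
      using \<xi> c unfolding alternating_bicharacters_def bicharacters_def characters_def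
      by (auto simp: fun_eq_iff restrict_def PiE_iff extensional_def)
    finally show "?f (F \<xi> c) = (\<xi>, c)" .
  qed
  show ?thesis
  proof (rule bij_betw_byWitness[where f' = "\<lambda>(\<xi>, c). F \<xi> c"])
    show "\<forall>a'\<in>characters (G\<lparr>carrier := K\<rparr>) U \<times> alternating_bicharacters (G\<lparr>carrier := K\<rparr>) U.
       ?f (case a' of (\<xi>, c) \<Rightarrow> F \<xi> c) = a'" using F by fastforce
    show "(\<lambda>(\<xi>, c). F \<xi> c) ` (characters (G\<lparr>carrier := K\<rparr>) U \<times> alternating_bicharacters (G\<lparr>carrier := K\<rparr>) U)
      \<subseteq> alternating_bicharacters G U" using F by fastforce
    show "?f ` alternating_bicharacters G U
      \<subseteq> characters (G\<lparr>carrier := K\<rparr>) U \<times> alternating_bicharacters (G\<lparr>carrier := K\<rparr>) U"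
      using K_carrier x_closed mK
      by (auto simp: alternating_bicharacters_def bicharacters_def characters_def PiE_iff)
    show "\<forall>b\<in>alternating_bicharacters G U. (case ?f b of (\<xi>, c) \<Rightarrow> F \<xi> c) = b"
    proof
      fix b assume b: "b \<in> alternating_bicharacters G U"
      hence b': "b \<in> bicharacters G U" by (simp add: alternating_bicharacters_def)
      have bxx: "b x x = 1" using b x_closed by (simp add: alternating_bicharacters_def)
      have p1: "b (g [^] j) h = b g h ^ j" if "g \<in> carrier G" "h \<in> carrier G" for g h and j :: nat
        using characters_pow[OF is_group U bicharacters_fix(2)[OF b' that(2) is_group] that(1), of j] that by simp
      have p2: "b h (g [^] j) = b h g ^ j" if "g \<in> carrier G" "h \<in> carrier G" for g h and j :: nat
        using characters_pow[OF is_group U bicharacters_fix(1)[OF b' that(2) is_group] that(1), of j] that by simp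
      have "b x (r h) ^ e g * inverse (b x (r g)) ^ e h * b (r g) (r h) = b g h"
        if gh: "g \<in> carrier G" "h \<in> carrier G" for g h
      proof -
        have c: "r g \<in> carrier G" "r h \<in> carrier G" "x \<in> carrier G" using gh r_closed K_carrier x_closed by auto
        have "b g h = b (x [^] e g \<otimes> r g) (x [^] e h \<otimes> r h)" using gh by (simp add: e_r)
        also have "\<dots> = b x (r h) ^ e g * (b (r g) x ^ e h * b (r g) (r h))"
          using c by (simp add: bicharacters_mult[OF b'] p1 p2 bxx)
        also have "b (r g) x = inverse (b x (r g))"
          using alternating_skew[OF is_group b c(3,1)] by (metis inverse_unique)
        finally show ?thesis by (simp add: mult_ac)
      qed
      thus "(case ?f b of (\<xi>, c) \<Rightarrow> F \<xi> c) = b"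
        using b' r_closed by (auto simp: F_def bicharacters_def fun_eq_iff PiE_iff extensional_def restrict_def)
    qed
  qed
qed

end

section \<open>Counting characters and alternating bicharacters, and lifting alternating
  ones\<close>

lemma finite_roots_of_unity: "0 < n \<Longrightarrow> finite {z::'a::field. z ^ n = 1}"
  and card_roots_of_unity_le: "0 < n \<Longrightarrow> card {z::'a::field. z ^ n = 1} \<le> n"
proof -
  assume n: "0 < n"
  define p where "p = Polynomial.monom (1::'a) n + [:- 1:]"
  have p: "poly p z = 0 \<longleftrightarrow> z ^ n = 1" for z by (simp add: p_def poly_monom)
  have "Polynomial.degree p = n"
    unfolding p_def using n by (subst degree_add_eq_left) (auto simp: degree_monom_eq)
  moreover have "p \<noteq> 0" using calculation n by auto
  ultimately show "finite {z::'a::field. z ^ n = 1}" "card {z::'a::field. z ^ n = 1} \<le> n"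
    using poly_roots_finite[of p] card_poly_roots_bound[of p] by (auto simp: p)
qed

lemma card_characters:
  assumes "decomposition G ns" "mult_subgroup U"
  shows "finite (characters G U) \<and> card (characters G U) = (\<Prod>m\<leftarrow>ns. card {z \<in> U. z ^ m = 1})"
  using assms(1)
proof (induction rule: decomposition.induct)
  case (trivial G)
  interpret comm_group G by (rule trivial)
  have "\<chi> = (\<lambda>g\<in>carrier G. 1)" if "\<chi> \<in> characters G U" for \<chi>
  proof
    fix g
    show "\<chi> g = (\<lambda>g\<in>carrier G. 1) g"
      using characters_one[OF is_group assms(2) that] that trivial(2)
      by (cases "g \<in> carrier G") (auto simp: characters_def)
  qed
  moreover have "(\<lambda>g\<in>carrier G. 1) \<in> characters G U"
    using assms(2) trivial(2) by (simp add: characters_def mult_subgroup_def)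
  ultimately have "characters G U = {\<lambda>g\<in>carrier G. 1}" by blast
  thus ?case by simp
next
  case (split G x n K e r ns)
  interpret cyclic_split G x n K e r by (rule split.hyps)
  have "finite {z \<in> U. z ^ n = 1}"
    using n_gt_1 by (intro finite_subset[OF _ finite_roots_of_unity[of n]]) auto
  thus ?case using split.IH characters_split[OF assms(2)]
    by (auto simp: bij_betw_same_card bij_betw_finite card_cartesian_product)
qed

text \<open>Each pair of invariant factors contributes the smaller one, hence the weight of a pair depends on its later entry only.\<close>

fun card_alternating :: "(nat \<Rightarrow> nat) \<Rightarrow> nat list \<Rightarrow> nat" where
  "card_alternating f [] = 1"
| "card_alternating f (n # ns) = (\<Prod>m\<leftarrow>ns. f m) * card_alternating f ns"

lemma card_alternating_bicharacters:
  assumes "decomposition G ns" "mult_subgroup U"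
  shows "finite (alternating_bicharacters G U) \<and>
    card (alternating_bicharacters G U) = card_alternating (\<lambda>m. card {z \<in> U. z ^ m = 1}) ns"
  using assms(1)
proof (induction rule: decomposition.induct)
  case (trivial G)
  interpret comm_group G by (rule trivial)
  have "alternating_bicharacters G U = {\<lambda>g\<in>carrier G. \<lambda>h\<in>carrier G. 1}"
  proof safe
    fix b assume "b \<in> alternating_bicharacters G U"
    thus "b = (\<lambda>g\<in>carrier G. \<lambda>h\<in>carrier G. 1)" using trivial(2)
      by (auto simp: alternating_bicharacters_def bicharacters_def fun_eq_iff restrict_def PiE_iff extensional_def)
  qed (use assms(2) in \<open>auto simp: alternating_bicharacters_def bicharacters_def mult_subgroup_def\<close>)
  thus ?case by simp
next
  case (split G x n K e r ns)
  interpret cyclic_split G x n K e r by (rule split.hyps)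
  show ?case using split.IH alternating_split[OF assms(2)] card_characters[OF split.hyps(2) assms(2)]
    by (auto simp: bij_betw_same_card bij_betw_finite card_cartesian_product)
qed

text \<open>\<open>\<beta>\<close> is the upper triangular half of \<open>b\<close>: the pairing of
  \<open>x\<close> with \<open>K\<close> is kept in one order of the arguments only, and the part on
  \<open>K\<close> is taken over from \<open>\<alpha>\<close>. This replaces a square root of
  \<open>b\<close>, which may not exist in \<open>U\<close>.\<close>

lemma (in cyclic_split) alternating_lift_step:
  assumes U: "mult_subgroup U" and b: "b \<in> alternating_bicharacters G U"
    and \<alpha>: "\<alpha> \<in> bicharacters (G\<lparr>carrier := K\<rparr>) U"
      "\<And>k l. k \<in> K \<Longrightarrow> l \<in> K \<Longrightarrow> b k l * \<alpha> l k = \<alpha> k l"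
  shows "\<exists>\<beta>\<in>bicharacters G U. \<forall>g\<in>carrier G. \<forall>h\<in>carrier G. b g h * \<beta> h g = \<beta> g h"
proof -
  have b': "b \<in> bicharacters G U" using b by (simp add: alternating_bicharacters_def)
  have m: "a * b \<in> U" if "a \<in> U" "b \<in> U" for a b using that U by (auto simp: mult_subgroup_def)
  have bn: "b x k ^ (j mod n) = b x k ^ j" if "k \<in> carrier G" for k j
  proof -
    have "b x k ^ n = 1"
      using characters_pow[OF is_group U bicharacters_fix(2)[OF b' that is_group] x_closed, of n] that
        exponent[OF x_closed] characters_one[OF is_group U bicharacters_fix(2)[OF b' that is_group]] x_closed
      by simp
    thus ?thesis by (rule power_eq_1_mod)
  qed
  have bxx: "b x x = 1" using b x_closed by (simp add: alternating_bicharacters_def)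
  have p1: "b (g [^] j) h = b g h ^ j" if "g \<in> carrier G" "h \<in> carrier G" for g h and j :: nat
    using characters_pow[OF is_group U bicharacters_fix(2)[OF b' that(2) is_group] that(1), of j] that by simp
  have p2: "b h (g [^] j) = b h g ^ j" if "g \<in> carrier G" "h \<in> carrier G" for g h and j :: nat
    using characters_pow[OF is_group U bicharacters_fix(1)[OF b' that(2) is_group] that(1), of j] that by simp
  have bU: "b g h \<in> U" if "g \<in> carrier G" "h \<in> carrier G" for g h
    using that b' by (auto simp: bicharacters_def)
  have \<alpha>U: "\<alpha> g h \<in> U" if "g \<in> K" "h \<in> K" for g h using that \<alpha> by (auto simp: bicharacters_def)
  define \<beta> where "\<beta> = (\<lambda>g\<in>carrier G. \<lambda>h\<in>carrier G. b x (r h) ^ e g * \<alpha> (r g) (r h))"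
  have "\<beta> \<in> bicharacters G U" unfolding bicharacters_def
  proof (intro CollectI conjI ballI)
    show "\<beta> \<in> carrier G \<rightarrow>\<^sub>E carrier G \<rightarrow>\<^sub>E U"
      by (auto simp: \<beta>_def intro!: m mult_subgroup_power[OF U] bU \<alpha>U r_closed K_carrier[OF r_closed] x_closed)
    fix g h k assume "g \<in> carrier G" "h \<in> carrier G" "k \<in> carrier G"
    thus "\<beta> (g \<otimes> h) k = \<beta> g k * \<beta> h k" "\<beta> g (h \<otimes> k) = \<beta> g h * \<beta> g k"
      using r_closed K_carrier x_closed \<alpha>(1) b'
      by (simp_all add: \<beta>_def e_mult r_mult bn power_add power_mult_distrib bicharacters_def)
  qed
  moreover have "b g h * \<beta> h g = \<beta> g h" if gh: "g \<in> carrier G" "h \<in> carrier G" for g h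
  proof -
    have c: "r g \<in> carrier G" "r h \<in> carrier G" "x \<in> carrier G" "r g \<in> K" "r h \<in> K"
      using gh r_closed K_carrier x_closed by auto
    have "b g h = b (x [^] e g \<otimes> r g) (x [^] e h \<otimes> r h)" using gh by (simp add: e_r)
    also have "\<dots> = b x (r h) ^ e g * (b (r g) x ^ e h * b (r g) (r h))"
      using c by (simp add: bicharacters_mult[OF b'] p1 p2 bxx)
    finally have "b g h * \<beta> h g = b x (r h) ^ e g * (b (r g) x * b x (r g)) ^ e h * (b (r g) (r h) * \<alpha> (r h) (r g))"
      using gh by (simp add: \<beta>_def power_mult_distrib mult_ac)
    thus ?thesis using gh alternating_skew[OF is_group b c(1,3)] \<alpha>(2)[OF c(4,5)] by (simp add: \<beta>_def)
  qed
  ultimately show ?thesis by blast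
qed

text \<open>Bicharacters are cocycles, so this realises \<open>b\<close> as the commutator form of a
  cocycle. Its values stay in \<open>U\<close>, which later makes a power of it trivial.\<close>

lemma alternating_lift:
  assumes "decomposition G ns" "mult_subgroup U" "b \<in> alternating_bicharacters G U"
  shows "\<exists>\<alpha>\<in>bicharacters G U. \<forall>g\<in>carrier G. \<forall>h\<in>carrier G. b g h * \<alpha> h g = \<alpha> g h"
  using assms(1,3)
proof (induction arbitrary: b rule: decomposition.induct)
  case (trivial G)
  thus ?case by (intro bexI[of _ b]) (auto simp: alternating_bicharacters_def)
next
  case (split G x n K e r ns)
  interpret cyclic_split G x n K e r by (rule split.hyps)
  have "(\<lambda>k\<in>K. restrict (b k) K) \<in> alternating_bicharacters (G\<lparr>carrier := K\<rparr>) U"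
    using alternating_split[OF assms(2)] split.prems by (auto simp: bij_betw_def)
  from split.IH[OF this] obtain \<alpha> where "\<alpha> \<in> bicharacters (G\<lparr>carrier := K\<rparr>) U"
    "\<And>k l. k \<in> K \<Longrightarrow> l \<in> K \<Longrightarrow> b k l * \<alpha> l k = \<alpha> k l" by auto
  thus ?case by (rule alternating_lift_step[OF assms(2) split.prems])
qed

section \<open>Roots of unity\<close>

lemma primitive_root_power_eq_1:
  assumes "primitive_root_of_unity m z"
  shows "z ^ j = 1 \<longleftrightarrow> m dvd j"
proof
  assume "z ^ j = 1"
  have m: "0 < m" "z ^ m = 1" "\<And>k. 0 < k \<Longrightarrow> k < m \<Longrightarrow> z ^ k \<noteq> 1"
    using assms by (auto simp: primitive_root_of_unity_def)
  have "z ^ j = z ^ (m * (j div m) + j mod m)" by simp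
  also have "\<dots> = z ^ (j mod m)" unfolding power_add power_mult using m by simp
  finally have "z ^ (j mod m) = 1" using \<open>z ^ j = 1\<close> by simp
  hence "j mod m = 0" using m(3)[of "j mod m"] m(1) by (metis gr0I mod_less_divisor)
  thus "m dvd j" by auto
qed (use assms in \<open>auto simp: primitive_root_of_unity_def power_mult\<close>)

lemma primitive_root_of_unityI:
  assumes "0 < m" "\<And>j. z ^ j = 1 \<longleftrightarrow> m dvd j"
  shows "primitive_root_of_unity m z"
  using assms unfolding primitive_root_of_unity_def by (auto dest: dvd_imp_le)

lemma exists_primitive_order:
  fixes z :: "'a::comm_ring_1"
  assumes "0 < n" "z ^ n = 1"
  shows "\<exists>m. m dvd n \<and> primitive_root_of_unity m z"
proof -
  define m where "m = (LEAST m. 0 < m \<and> z ^ m = 1)"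
  have "0 < m \<and> z ^ m = 1" unfolding m_def by (rule LeastI[of _ n]) (use assms in auto)
  moreover have "z ^ k \<noteq> 1" if "0 < k" "k < m" for k
    using not_less_Least[of k "\<lambda>m. 0 < m \<and> z ^ m = 1"] that by (auto simp: m_def)
  ultimately have "primitive_root_of_unity m z" by (auto simp: primitive_root_of_unity_def)
  thus ?thesis using primitive_root_power_eq_1[of m z n] assms by blast
qed

lemma primitive_root_power:
  assumes "primitive_root_of_unity (a * b) z"
  shows "primitive_root_of_unity a (z ^ b)"
proof (rule primitive_root_of_unityI)
  have "0 < a * b" using assms by (simp add: primitive_root_of_unity_def)
  thus "0 < a" by simp
  fix j
  show "(z ^ b) ^ j = 1 \<longleftrightarrow> a dvd j"
    using primitive_root_power_eq_1[OF assms, of "b * j"] \<open>0 < a * b\<close>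
    by (simp add: power_mult mult.commute)
qed

text \<open>Multiplication by \<open>z\<close> permutes \<open>W\<close>, so it leaves the nonzero
  product over \<open>W\<close> unchanged.\<close>

lemma power_card_eq_1:
  fixes W :: "'a::field set"
  assumes "finite W" "0 \<notin> W" "z \<in> W" "\<And>a b. a \<in> W \<Longrightarrow> b \<in> W \<Longrightarrow> a * b \<in> W"
  shows "z ^ card W = 1"
proof -
  have z0: "z \<noteq> 0" using assms by auto
  have inj: "inj_on ((*) z) W" using z0 by (auto simp: inj_on_def)
  have "(*) z ` W \<subseteq> W" using assms by auto
  hence im: "(*) z ` W = W" using endo_inj_surj[OF assms(1)] inj by blast
  have "\<Prod>W = (\<Prod>w\<in>(*) z ` W. w)" using im by simp
  also have "\<dots> = z ^ card W * \<Prod>W" using inj by (subst prod.reindex) (auto simp: prod.distrib)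
  finally have "(z ^ card W - 1) * \<Prod>W = 0" by (simp add: algebra_simps)
  moreover have "\<Prod>W \<noteq> 0" using assms by (auto simp: prod_zero_iff)
  ultimately show ?thesis by simp
qed

text \<open>A form of the cyclicity of the finite group \<open>W\<close> of roots. If its order is
  \<open>p ^ s * d\<close>, the map \<open>z \<mapsto> z ^ d\<close> has fibres of at most
  \<open>d\<close> elements, since quotients within a fibre are \<open>d\<close>-th roots of unity.
  So its image \<open>V\<close> contains at least \<open>p ^ s\<close> elements, all of them roots
  of unity of exponent \<open>p ^ s\<close>, and they cannot all have exponent
  \<open>p ^ (s - 1)\<close>.\<close>

lemma prime_power_dvd_card_roots_iff:
  fixes U :: "'a::field set"
  assumes U: "mult_subgroup U" and p: "Factorial_Ring.prime (p::nat)" and n: "0 < n"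
  shows "p ^ s dvd card {z \<in> U. z ^ n = 1} \<longleftrightarrow> (\<exists>z\<in>U. z ^ n = 1 \<and> primitive_root_of_unity (p ^ s) z)"
proof -
  define W where "W = {z \<in> U. z ^ n = 1}"
  have W: "finite W" "0 \<notin> W" "1 \<in> W" "\<And>a b. a \<in> W \<Longrightarrow> b \<in> W \<Longrightarrow> a * b \<in> W"
    using mult_subgroup_roots[OF U n] finite_roots_of_unity[OF n, where 'a = 'a]
    by (auto simp: W_def mult_subgroup_def intro: finite_subset[rotated])
  have t: "card W > 0" using W by (auto simp: card_gt_0_iff)
  have "p ^ s dvd card W \<longleftrightarrow> (\<exists>z\<in>W. primitive_root_of_unity (p ^ s) z)"
  proof
    assume "\<exists>z\<in>W. primitive_root_of_unity (p ^ s) z"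
    then obtain z where z: "z \<in> W" "primitive_root_of_unity (p ^ s) z" by blast
    have "z ^ card W = 1" by (rule power_card_eq_1) (use W z in auto)
    thus "p ^ s dvd card W" using primitive_root_power_eq_1[OF z(2)] by blast
  next
    assume "p ^ s dvd card W"
    then obtain d where d: "card W = p ^ s * d" by auto
    hence d0: "d > 0" using t by (auto intro: Nat.gr0I)
    define V where "V = (\<lambda>z. z ^ d) ` W"
    have VW: "V \<subseteq> W"
      using mult_subgroup_power[OF mult_subgroup_roots[OF U n]] unfolding V_def W_def by blast
    have "card W \<le> (\<Sum>v\<in>V. card {z \<in> W. z ^ d = v})"
    proof -
      have "W = (\<Union>v\<in>V. {z \<in> W. z ^ d = v})" by (auto simp: V_def)
      thus ?thesis using card_UN_le[of V "\<lambda>v. {z \<in> W. z ^ d = v}"] W(1) by (simp add: V_def)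
    qed
    also have "\<dots> \<le> (\<Sum>v\<in>V. d)"
    proof (rule sum_mono)
      fix v assume "v \<in> V"
      then obtain w where w: "w \<in> W" "w ^ d = v" by (auto simp: V_def)
      have w0: "w \<noteq> 0" using w W by auto
      have "card {z \<in> W. z ^ d = v} = card ((\<lambda>z. z / w) ` {z \<in> W. z ^ d = v})"
        using w0 by (intro card_image[symmetric]) (auto simp: inj_on_def)
      also have "\<dots> \<le> card {z::'a. z ^ d = 1}"
        using w w0 by (intro card_mono finite_roots_of_unity d0) (auto simp: power_divide)
      also have "\<dots> \<le> d" by (rule card_roots_of_unity_le[OF d0])
      finally show "card {z \<in> W. z ^ d = v} \<le> d" .
    qed
    finally have "p ^ s \<le> card V" using d d0 by simp
    have Vs: "v ^ (p ^ s) = 1" if v: "v \<in> V" for v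
    proof -
      obtain z where "z \<in> W" "v = z ^ d" using v unfolding V_def by blast
      thus ?thesis using power_card_eq_1[OF W(1,2) \<open>z \<in> W\<close> W(4)] d by (simp add: mult.commute flip: power_mult)
    qed
    show "\<exists>z\<in>W. primitive_root_of_unity (p ^ s) z"
    proof (rule ccontr)
      assume no: "\<not> (\<exists>z\<in>W. primitive_root_of_unity (p ^ s) z)"
      have s0: "s > 0"
      proof (rule Nat.gr0I)
        assume "s = 0"
        thus False using no W by (auto simp: primitive_root_of_unity_def)
      qed
      have ps: "p ^ (s - 1) > 0" using p prime_gt_0_nat by simp
      have "V \<subseteq> {z. z ^ (p ^ (s - 1)) = 1}"
      proof
        fix v assume v: "v \<in> V"
        obtain m where m: "m dvd p ^ s" "primitive_root_of_unity m v"
          using exists_primitive_order[OF _ Vs[OF v]] p prime_gt_0_nat by auto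
        obtain i where i: "m = p ^ i" "i \<le> s" using m p divides_primepow_nat by blast
        hence "i \<noteq> s" using no m v VW by auto
        hence "m dvd p ^ (s - 1)" using i by (auto intro!: le_imp_power_dvd)
        thus "v \<in> {z. z ^ (p ^ (s - 1)) = 1}" using primitive_root_power_eq_1[OF m(2)] by simp
      qed
      hence "card V \<le> card {z::'a. z ^ (p ^ (s - 1)) = 1}"
        by (intro card_mono finite_roots_of_unity ps)
      also have "\<dots> \<le> p ^ (s - 1)" by (rule card_roots_of_unity_le[OF ps])
      also have "\<dots> < p ^ s" using p s0 prime_gt_1_nat by (intro power_strict_increasing) auto
      finally show False using \<open>p ^ s \<le> card V\<close> by simp
    qed
  qed
  thus ?thesis by (auto simp: W_def)
qed

lemma card_roots_nonzero:
  fixes U :: "'a::field set"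
  assumes "mult_subgroup U" "0 < n"
  shows "card {z \<in> U. z ^ n = 1} \<noteq> 0"
proof -
  have "1 \<in> {z \<in> U. z ^ n = 1}" using assms by (simp add: mult_subgroup_def)
  moreover have "finite {z \<in> U. z ^ n = 1}"
    using finite_roots_of_unity[OF assms(2), where 'a = 'a] by (auto intro: finite_subset[rotated])
  ultimately show ?thesis by (auto simp: card_eq_0_iff)
qed

text \<open>Both numbers have the same lower bounds \<open>s\<close>: by the preceding criterion
  \<open>p ^ s\<close> divides the cardinality exactly if \<open>U\<close> has a primitive root of
  order \<open>p ^ s\<close> dividing \<open>n\<close>, that is, if \<open>p ^ s\<close> divides
  \<open>n\<close> and \<open>s \<le> k\<close>.\<close>

lemma multiplicity_card_roots:
  fixes U :: "'a::field set"
  assumes U: "mult_subgroup U" and p: "Factorial_Ring.prime (p::nat)" and n: "0 < n"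
    and prim: "\<exists>z\<in>U. primitive_root_of_unity (p ^ k) z"
    and noprim: "\<not> (\<exists>z\<in>U. primitive_root_of_unity (p ^ (k + 1)) z)"
  shows "multiplicity p (card {z \<in> U. z ^ n = 1}) = min (multiplicity p n) k"
proof -
  let ?t = "card {z \<in> U. z ^ n = 1}"
  have np: "\<not> is_unit p" using p not_prime_unit by blast
  have t: "?t \<noteq> 0" by (rule card_roots_nonzero[OF U n])
  have "s \<le> multiplicity p ?t \<longleftrightarrow> s \<le> min (multiplicity p n) k" for s
  proof -
    have "s \<le> multiplicity p ?t \<longleftrightarrow> p ^ s dvd ?t"
      using power_dvd_iff_le_multiplicity[of ?t p s] t np by simp
    also have "\<dots> \<longleftrightarrow> (\<exists>z\<in>U. z ^ n = 1 \<and> primitive_root_of_unity (p ^ s) z)"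
      by (rule prime_power_dvd_card_roots_iff[OF U p n])
    also have "\<dots> \<longleftrightarrow> p ^ s dvd n \<and> s \<le> k"
    proof safe
      fix z assume z: "z \<in> U" "z ^ n = 1" "primitive_root_of_unity (p ^ s) z"
      show "p ^ s dvd n" using primitive_root_power_eq_1[OF z(3)] z(2) by blast
      show "s \<le> k"
      proof (rule ccontr)
        assume "\<not> s \<le> k"
        hence "p ^ s = p ^ (k + 1) * p ^ (s - (k + 1))"
          using power_add[of p "k + 1" "s - (k + 1)"] by simp
        hence "primitive_root_of_unity (p ^ (k + 1)) (z ^ (p ^ (s - (k + 1))))"
          using z by (intro primitive_root_power) simp
        thus False using noprim mult_subgroup_power[OF U z(1)] by blast
      qed
    next
      assume d: "p ^ s dvd n" "s \<le> k"
      obtain z where z: "z \<in> U" "primitive_root_of_unity (p ^ k) z" using prim by blast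
      have "p ^ k = p ^ s * p ^ (k - s)" using d by (simp flip: power_add)
      hence pr: "primitive_root_of_unity (p ^ s) (z ^ (p ^ (k - s)))"
        using z by (intro primitive_root_power) simp
      thus "\<exists>z\<in>U. z ^ n = 1 \<and> primitive_root_of_unity (p ^ s) z"
        using mult_subgroup_power[OF U z(1)] primitive_root_power_eq_1[OF pr] d by blast
    qed
    also have "\<dots> \<longleftrightarrow> s \<le> min (multiplicity p n) k"
      using power_dvd_iff_le_multiplicity[of n p s] n np by simp
    finally show ?thesis .
  qed
  thus ?thesis by (metis order.refl order.antisym)
qed

text \<open>The polynomial \<open>X^n - 1\<close> is separable: a multiple root would also be a root
  of \<open>n X^(n-1)\<close>, hence zero, which is not a root. So the multiset of its
  \<open>n\<close> roots is a set.\<close>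

lemma card_roots_of_unity_alg_closed:
  assumes n: "of_nat n \<noteq> (0::'a::alg_closed_field)"
  shows "card {z::'a. z ^ n = 1} = n"
proof -
  have n0: "n > 0" using n by (auto intro: Nat.gr0I)
  define p where "p = Polynomial.monom (1::'a) n + [:- 1:]"
  have pz: "poly p z = 0 \<longleftrightarrow> z ^ n = 1" for z by (simp add: p_def poly_monom)
  have deg: "Polynomial.degree p = n"
    unfolding p_def using n0 by (subst degree_add_eq_left) (auto simp: degree_monom_eq)
  have p0: "p \<noteq> 0" using deg n0 by auto
  have ord1: "Polynomial.order z p \<le> 1" for z
  proof (rule ccontr)
    assume "\<not> Polynomial.order z p \<le> 1"
    hence "[:- z, 1:] ^ 2 dvd [:- z, 1:] ^ Polynomial.order z p" by (intro le_imp_power_dvd) simp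
    also have "\<dots> dvd p" by (rule order_1)
    finally obtain q where q: "p = [:- z, 1:] ^ 2 * q" by auto
    have "poly (pderiv p) z = 0" unfolding q power2_eq_square pderiv_mult poly_add poly_mult by simp
    moreover have "pderiv p = Polynomial.monom (of_nat n) (n - 1)"
      by (simp add: p_def pderiv_add pderiv_monom pderiv_pCons)
    ultimately have "z = 0" using n n0 by (simp add: poly_monom)
    moreover have "poly p z = 0" unfolding q by simp
    ultimately show False using pz[of z] n0 by (simp add: power_0_left)
  qed
  obtain A where A: "size A = Polynomial.degree p" "p = smult (lead_coeff p) (\<Prod>x\<in>#A. [:-x, 1:])"
    using alg_closed_imp_factorization[OF p0] by blast
  have pr: "proots p = A"
  proof -
    have "proots p = proots (\<Prod>x\<in>#A. [:-x, 1:])"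
      by (subst A(2)) (use p0 in \<open>simp add: proots_smult\<close>)
    also have "\<dots> = A"
    proof (induction A)
      case (add x A)
      have "(\<Prod>x\<in>#A. [:- x, 1:]) \<noteq> 0" by (auto simp: prod_mset_zero_iff)
      thus ?case using add by (simp add: proots_mult del: mult_pCons_left)
    qed auto
    finally show ?thesis .
  qed
  have "A = mset_set (set_mset A)"
  proof (rule multiset_eqI)
    fix z
    have "count A z \<le> 1" using ord1[of z] p0 by (simp flip: pr)
    thus "count A z = count (mset_set (set_mset A)) z"
      by (cases "z \<in># A") (auto simp: not_in_iff Suc_le_eq intro: le_antisym)
  qed
  hence "card (set_mset A) = n" using A(1) deg by (metis size_mset_set)
  moreover have "set_mset A = {z. z ^ n = 1}" using p0 pz by (simp flip: pr)
  ultimately show ?thesis by simp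
qed

lemma exists_primitive_root_alg_closed:
  assumes p: "Factorial_Ring.prime (p::nat)" and "of_nat (p ^ k) \<noteq> (0::'a::alg_closed_field)"
  shows "\<exists>z::'a. primitive_root_of_unity (p ^ k) z"
proof -
  have U: "mult_subgroup (UNIV - {0::'a})" by (auto simp: mult_subgroup_def)
  have n: "0 < p ^ k" using p prime_gt_0_nat by simp
  have "{z \<in> UNIV - {0::'a}. z ^ (p ^ k) = 1} = {z. z ^ (p ^ k) = 1}" using n by (auto simp: power_0_left)
  hence "p ^ k dvd card {z \<in> UNIV - {0::'a}. z ^ (p ^ k) = 1}"
    using card_roots_of_unity_alg_closed[OF assms(2)] by simp
  thus ?thesis using prime_power_dvd_card_roots_iff[OF U p n, of k] by blast
qed

section \<open>Evaluation of characters on the group algebra\<close>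

abbreviation group_algebra :: "('g, 'b) monoid_scheme \<Rightarrow> ('g \<Rightarrow> 'f::field) ring" where
  "group_algebra G \<equiv> twisted_group_algebra G (\<lambda>_ _. 1)"

text \<open>The \<open>F\<close>-linear extension of \<open>\<chi>\<close> to the group algebra,
  which is a ring homomorphism if \<open>\<chi>\<close> is a character.\<close>

definition evaluation :: "('g, 'b) monoid_scheme \<Rightarrow> ('g \<Rightarrow> 'f::field alg_closure) \<Rightarrow> ('g \<Rightarrow> 'f) \<Rightarrow> 'f alg_closure" where
  "evaluation G \<chi> x = (\<Sum>g\<in>carrier G. to_ac (x g) * \<chi> g)"

text \<open>The element \<open>c u_g\<close>.\<close>

definition algebra_basis :: "('g, 'b) monoid_scheme \<Rightarrow> 'g \<Rightarrow> 'f::field \<Rightarrow> 'g \<Rightarrow> 'f" where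
  "algebra_basis G g c = (\<lambda>h\<in>carrier G. if h = g then c else 0)"

abbreviation dual :: "('g, 'b) monoid_scheme \<Rightarrow> ('g \<Rightarrow> 'f::field alg_closure) set" where
  "dual G \<equiv> characters G (UNIV - {0})"

lemma mult_subgroup_UNIV [simp]: "mult_subgroup (UNIV - {0})"
  by (auto simp: mult_subgroup_def)

lemma to_ac_eq_iff [simp]: "to_ac x = to_ac y \<longleftrightarrow> x = y" for x y :: "'f::field"
proof
  assume "to_ac x = to_ac y"
  hence "to_ac (x - y) = 0" by simp
  moreover have "to_ac (x - y) * to_ac (inverse (x - y)) = 1" if "x \<noteq> y"
    using that by (simp del: to_ac_diff to_ac_inverse flip: to_ac_mult)
  ultimately show "x = y" by fastforce
qed simp

lemma to_ac_eq_0_iff [simp]: "to_ac x = 0 \<longleftrightarrow> x = (0 :: 'f::field)"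
  using to_ac_eq_iff[of x 0] by (simp del: to_ac_eq_iff)

lemma of_nat_alg_closure_nonzero:
  "of_nat n \<noteq> (0::'f::field) \<Longrightarrow> of_nat n \<noteq> (0::'f alg_closure)"
  by (metis to_ac_eq_0_iff to_ac_of_nat)

lemma twisted_group_algebra_simps:
  "carrier (twisted_group_algebra G \<alpha>) = carrier G \<rightarrow>\<^sub>E UNIV"
  "x \<oplus>\<^bsub>twisted_group_algebra G \<alpha>\<^esub> y = (\<lambda>g\<in>carrier G. x g + y g)"
  "\<zero>\<^bsub>twisted_group_algebra G \<alpha>\<^esub> = (\<lambda>g\<in>carrier G. 0)"
  "\<one>\<^bsub>group_algebra G\<^esub> = algebra_basis G \<one>\<^bsub>G\<^esub> 1"
  by (simp_all add: twisted_group_algebra_def algebra_basis_def cong: restrict_cong if_cong)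

lemma twisted_group_algebra_mult:
  "x \<otimes>\<^bsub>twisted_group_algebra G \<alpha>\<^esub> y = (\<lambda>k\<in>carrier G.
     \<Sum>(g, h)\<in>{p \<in> carrier G \<times> carrier G. fst p \<otimes>\<^bsub>G\<^esub> snd p = k}. x g * y h * \<alpha> g h)"
  by (auto simp: twisted_group_algebra_def fun_eq_iff intro!: sum.cong)

lemma algebra_closed:
  "x \<in> carrier (group_algebra G) \<Longrightarrow> y \<in> carrier (group_algebra G) \<Longrightarrow>
     x \<oplus>\<^bsub>group_algebra G\<^esub> y \<in> carrier (group_algebra G)"
  "x \<otimes>\<^bsub>twisted_group_algebra G \<alpha>\<^esub> y \<in> carrier (twisted_group_algebra G \<alpha>)"
  "\<zero>\<^bsub>group_algebra G\<^esub> \<in> carrier (group_algebra G)"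
  "\<one>\<^bsub>group_algebra G\<^esub> \<in> carrier (group_algebra G)"
  "algebra_basis G g c \<in> carrier (group_algebra G)"
  by (simp_all add: twisted_group_algebra_simps twisted_group_algebra_mult algebra_basis_def)

locale finite_comm_group = comm_group G for G :: "'g monoid" (structure) +
  assumes finite_carrier: "finite (carrier G)"
begin

lemma evaluation_add:
  "evaluation G \<chi> (x \<oplus>\<^bsub>group_algebra G\<^esub> y) = evaluation G \<chi> x + evaluation G \<chi> y"
  by (simp add: evaluation_def twisted_group_algebra_simps algebra_simps sum.distrib)

lemma evaluation_zero: "evaluation G \<chi> \<zero>\<^bsub>group_algebra G\<^esub> = 0"
  by (simp add: evaluation_def twisted_group_algebra_simps)

lemma evaluation_diff:
  "evaluation G \<chi> (\<lambda>g\<in>carrier G. x g - y g) = evaluation G \<chi> x - evaluation G \<chi> y"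
  by (simp add: evaluation_def algebra_simps sum_subtractf)

lemma evaluation_basis:
  "g \<in> carrier G \<Longrightarrow> evaluation G \<chi> (algebra_basis G g c) = to_ac c * \<chi> g"
proof -
  assume g: "g \<in> carrier G"
  have "evaluation G \<chi> (algebra_basis G g c) = (\<Sum>h\<in>carrier G. if h = g then to_ac c * \<chi> h else 0)"
    unfolding evaluation_def algebra_basis_def by (intro sum.cong) auto
  thus ?thesis using g finite_carrier by simp
qed

lemma evaluation_one: "\<chi> \<in> dual G \<Longrightarrow> evaluation G \<chi> \<one>\<^bsub>group_algebra G\<^esub> = 1"
  by (simp add: twisted_group_algebra_simps evaluation_basis characters_one[OF is_group mult_subgroup_UNIV])

lemma evaluation_mult:
  assumes \<chi>: "\<chi> \<in> dual G"
  shows "evaluation G \<chi> (x \<otimes>\<^bsub>group_algebra G\<^esub> y) = evaluation G \<chi> x * evaluation G \<chi> y"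
proof -
  let ?S = "carrier G \<times> carrier G"
  let ?t = "\<lambda>p. to_ac (x (fst p)) * to_ac (y (snd p)) * \<chi> (fst p \<otimes> snd p)"
  have "evaluation G \<chi> (x \<otimes>\<^bsub>group_algebra G\<^esub> y)
     = (\<Sum>k\<in>carrier G. \<Sum>p\<in>{p \<in> ?S. fst p \<otimes> snd p = k}. ?t p)"
    by (auto simp: evaluation_def twisted_group_algebra_mult to_ac_sum sum_distrib_right case_prod_unfold intro!: sum.cong)
  also have "\<dots> = (\<Sum>p\<in>?S. ?t p)" using finite_carrier by (intro sum.group) auto
  also have "\<dots> = (\<Sum>g\<in>carrier G. \<Sum>h\<in>carrier G. (to_ac (x g) * \<chi> g) * (to_ac (y h) * \<chi> h))"
    by (auto simp: sum.cartesian_product case_prod_unfold characters_mult[OF \<chi>] intro!: sum.cong)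
  also have "\<dots> = evaluation G \<chi> x * evaluation G \<chi> y"
    by (simp add: evaluation_def sum_product)
  finally show ?thesis .
qed

lemma basis_mult:
  assumes "g \<in> carrier G" "h \<in> carrier G"
  shows "algebra_basis G g c \<otimes>\<^bsub>twisted_group_algebra G \<alpha>\<^esub> algebra_basis G h d
    = algebra_basis G (g \<otimes> h) (c * d * \<alpha> g h)"
proof
  fix k
  have "(\<Sum>(g', h')\<in>{p \<in> carrier G \<times> carrier G. fst p \<otimes> snd p = k}.
      algebra_basis G g c g' * algebra_basis G h d h' * \<alpha> g' h') =
    (\<Sum>p\<in>{p \<in> carrier G \<times> carrier G. fst p \<otimes> snd p = k}. if p = (g, h) then c * d * \<alpha> g h else 0)"
    by (intro sum.cong) (auto simp: algebra_basis_def split: if_splits)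
  also have "\<dots> = (if k = g \<otimes> h then c * d * \<alpha> g h else 0)"
    using assms finite_carrier by auto
  finally show "(algebra_basis G g c \<otimes>\<^bsub>twisted_group_algebra G \<alpha>\<^esub> algebra_basis G h d) k
    = algebra_basis G (g \<otimes> h) (c * d * \<alpha> g h) k"
    by (simp add: twisted_group_algebra_mult algebra_basis_def)
qed

end

section \<open>Separation and orthogonality of characters\<close>

lemma character_separating:
  assumes "decomposition G ns" "of_nat (prod_list ns) \<noteq> (0::'f::field alg_closure)"
    "g \<in> carrier G" "g \<noteq> \<one>\<^bsub>G\<^esub>"
  shows "\<exists>\<chi>::_ \<Rightarrow> 'f alg_closure. \<chi> \<in> dual G \<and> \<chi> g \<noteq> 1"
  using assms
proof (induction arbitrary: g rule: decomposition.induct)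
  case (split G x n K e r ns)
  interpret cyclic_split G x n K e r by (rule split.hyps)
  have n0: "of_nat n \<noteq> (0::'f alg_closure)" "of_nat (prod_list ns) \<noteq> (0::'f alg_closure)"
    using split.prems by auto
  let ?U = "UNIV - {0::'f alg_closure}"
  let ?P = "{z \<in> ?U. z ^ n = 1} \<times> characters (G\<lparr>carrier := K\<rparr>) ?U"
  let ?f = "\<lambda>\<chi>::'a \<Rightarrow> 'f alg_closure. (\<chi> x, restrict \<chi> K)"
  have g: "g \<in> carrier G" "g \<noteq> \<one>\<^bsub>G\<^esub>" by fact+
  have ext: "\<exists>\<chi>. \<chi> \<in> dual G \<and> \<chi> g = z ^ e g * \<xi> (r g)" if "(z, \<xi>) \<in> ?P" for z \<xi>
  proof -
    obtain \<chi> where \<chi>: "\<chi> \<in> dual G" "?f \<chi> = (z, \<xi>)"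
      using characters_split[of ?U] \<open>(z, \<xi>) \<in> ?P\<close> unfolding bij_betw_def by (metis (no_types, lifting) image_iff mult_subgroup_UNIV)
    have "\<chi> g = \<chi> (x [^]\<^bsub>G\<^esub> e g \<otimes>\<^bsub>G\<^esub> r g)" using g by (simp add: e_r)
    also have "\<dots> = \<chi> x ^ e g * \<chi> (r g)"
      using \<chi>(1) characters_pow[OF is_group mult_subgroup_UNIV \<chi>(1) x_closed] g r_closed K_carrier x_closed
      by (simp add: characters_mult)
    also have "\<chi> x = z" using \<chi>(2) by simp
    also have "\<chi> (r g) = restrict \<chi> K (r g)" using r_closed[OF g(1)] by simp
    also have "restrict \<chi> K = \<xi>" using \<chi>(2) by simp
    finally show ?thesis using \<chi>(1) by blast
  qed
  have triv: "(\<lambda>k\<in>K. 1) \<in> characters (G\<lparr>carrier := K\<rparr>) ?U"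
    using subgroup.m_closed[OF subgroup_K] by (auto simp: characters_def)
  show ?case
  \<comment> \<open>If \<open>g\<close> has no component along \<open>x\<close>, a character of
    \<open>K\<close> separating \<open>r g\<close> from one is extended; otherwise the value at
    \<open>x\<close> is chosen suitably.\<close>
  proof (cases "e g = 0")
    case True
    have "r g \<noteq> \<one>\<^bsub>G\<^esub>"
    proof
      assume "r g = \<one>\<^bsub>G\<^esub>"
      hence "g = \<one>\<^bsub>G\<^esub>" using e_r[OF g(1)] True by simp
      thus False using g by simp
    qed
    then obtain \<xi> where \<xi>: "\<xi> \<in> characters (G\<lparr>carrier := K\<rparr>) ?U" "\<xi> (r g) \<noteq> 1"
      using split.IH[OF n0(2), of "r g"] r_closed[OF g(1)] by auto
    from ext[of 1 \<xi>] \<xi> show ?thesis by auto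
  next
    case False
    \<comment> \<open>There are \<open>n\<close> solutions of \<open>z ^ n = 1\<close> in the
      closure, but at most \<open>e g < n\<close> solutions of \<open>z ^ e g = 1\<close>.\<close>
    have "\<exists>z::'f alg_closure. z ^ n = 1 \<and> z ^ e g \<noteq> 1"
    proof (rule ccontr)
      assume "\<nexists>z::'f alg_closure. z ^ n = 1 \<and> z ^ e g \<noteq> 1"
      hence "card {z::'f alg_closure. z ^ n = 1} \<le> card {z::'f alg_closure. z ^ e g = 1}"
        using False by (intro card_mono finite_roots_of_unity) auto
      also have "\<dots> \<le> e g" using False by (intro card_roots_of_unity_le) auto
      finally show False using e_less[OF g(1)] card_roots_of_unity_alg_closed[OF n0(1)] by simp
    qed
    then obtain z :: "'f alg_closure" where z: "z ^ n = 1" "z ^ e g \<noteq> 1" by blast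
    hence "z \<noteq> 0" using n_gt_1 by (auto simp: power_0_left)
    from ext[of z "\<lambda>k\<in>K. 1"] z this triv r_closed[OF g(1)] show ?thesis by auto
  qed
qed auto

lemma card_dual:
  assumes "decomposition G ns" "of_nat (prod_list ns) \<noteq> (0::'f::field alg_closure)"
  shows "card (dual G :: ('g \<Rightarrow> 'f alg_closure) set) = prod_list ns"
proof -
  have "card {z \<in> UNIV - {0::'f alg_closure}. z ^ m = 1} = m" if m: "m \<in> set ns" for m
  proof -
    have "m dvd prod_list ns" using m by (simp add: prod_list_dvd)
    hence "of_nat m \<noteq> (0::'f alg_closure)" using assms(2) by (auto elim!: dvdE)
    moreover have "{z \<in> UNIV - {0::'f alg_closure}. z ^ m = 1} = {z. z ^ m = 1}"
      using decomposition_gt_1[OF assms(1)] m by (auto simp: power_0_left)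
    ultimately show ?thesis by (simp add: card_roots_of_unity_alg_closed)
  qed
  hence "map (\<lambda>m. card {z \<in> UNIV - {0::'f alg_closure}. z ^ m = 1}) ns = ns"
    by (intro map_idI) auto
  thus ?thesis using card_characters[OF assms(1) mult_subgroup_UNIV[where 'a = "'f alg_closure"]] by simp
qed

context finite_comm_group begin

text \<open>For \<open>g \<noteq> \<one>\<close> choose a character \<open>\<chi>\<close> with
  \<open>\<chi> g \<noteq> 1\<close>. Multiplication by \<open>\<chi>\<close> permutes the
  characters and multiplies the sum by \<open>\<chi> g\<close>, so the sum vanishes.\<close>

lemma dual_orthogonality:
  assumes "decomposition G ns" "of_nat (prod_list ns) \<noteq> (0::'f::field alg_closure)" "g \<in> carrier G"
  shows "(\<Sum>\<chi>\<in>dual G. \<chi> g) = (if g = \<one> then of_nat (prod_list ns) else (0 :: 'f alg_closure))"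
proof (cases "g = \<one>")
  case True
  have "(\<Sum>\<chi>\<in>(dual G :: ('g \<Rightarrow> 'f alg_closure) set). \<chi> g) = (\<Sum>\<chi>\<in>(dual G :: ('g \<Rightarrow> 'f alg_closure) set). 1)"
    using True by (auto simp: characters_one[OF is_group mult_subgroup_UNIV] intro!: sum.cong)
  thus ?thesis using True card_dual[OF assms(1,2)] by simp
next
  case False
  then obtain \<chi> :: "'g \<Rightarrow> 'f alg_closure" where \<chi>: "\<chi> \<in> dual G" "\<chi> g \<noteq> 1"
    using character_separating[OF assms] by blast
  let ?D = "dual G :: ('g \<Rightarrow> 'f alg_closure) set"
  let ?f = "\<lambda>\<psi>. \<lambda>g\<in>carrier G. \<chi> g * \<psi> g"
  have fin: "finite ?D" using card_characters[OF assms(1) mult_subgroup_UNIV] by blast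
  have nz: "\<chi> h \<noteq> 0" if "h \<in> carrier G" for h
    using characters_nonzero[OF mult_subgroup_UNIV \<chi>(1) that] .
  have "?f ` ?D \<subseteq> ?D"
    using characters_mult[OF \<chi>(1)] nz by (auto simp: characters_def)
  moreover have inj: "inj_on ?f ?D"
  proof (rule inj_onI)
    fix \<psi> \<psi>' assume *: "\<psi> \<in> ?D" "\<psi>' \<in> ?D" "?f \<psi> = ?f \<psi>'"
    show "\<psi> = \<psi>'"
    proof (rule PiE_ext[of _ "carrier G" "\<lambda>_. UNIV - {0}"])
      fix h assume h: "h \<in> carrier G"
      have "?f \<psi> h = ?f \<psi>' h" using *(3) by simp
      thus "\<psi> h = \<psi>' h" using nz[OF h] h by simp
    qed (use * in \<open>auto simp: characters_def\<close>)
  qed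
  ultimately have "?f ` ?D = ?D" by (intro endo_inj_surj fin)
  hence "(\<Sum>\<psi>\<in>?D. \<psi> g) = (\<Sum>\<psi>\<in>?f ` ?D. \<psi> g)" by simp
  also have "\<dots> = (\<Sum>\<psi>\<in>?D. \<chi> g * \<psi> g)"
    using assms(3) by (subst sum.reindex[OF inj]) simp
  also have "\<dots> = \<chi> g * (\<Sum>\<psi>\<in>?D. \<psi> g)" by (simp add: sum_distrib_left)
  finally have "(1 - \<chi> g) * (\<Sum>\<psi>\<in>?D. \<psi> g) = 0" by (simp add: algebra_simps)
  thus ?thesis using \<chi> False by simp
qed

lemma exists_decomposition_self:
  obtains ns where "decomposition G ns" "card (carrier G) = prod_list ns"
  using exists_decomposition[OF comm_group_axioms finite_carrier] decomposition_card by blast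

lemma finite_dual: "finite (dual G :: ('g \<Rightarrow> 'f::field alg_closure) set)"
  using exists_decomposition_self card_characters[OF _ mult_subgroup_UNIV] by metis

text \<open>Fourier inversion: the sum of \<open>\<chi> (inv h) * evaluation G \<chi> x\<close> over
  all characters is the order of \<open>G\<close> times the coefficient \<open>x h\<close>.\<close>

lemma evaluation_separating:
  assumes c: "of_nat (card (carrier G)) \<noteq> (0::'f::field)"
    and x: "x \<in> carrier (group_algebra G)"
    and ev: "\<And>\<chi>. \<chi> \<in> dual G \<Longrightarrow> evaluation G \<chi> x = (0::'f alg_closure)"
  shows "x = \<zero>\<^bsub>group_algebra G\<^esub>"
proof -
  obtain ns where ns: "decomposition G ns" "card (carrier G) = prod_list ns"
    by (rule exists_decomposition_self)
  have n0: "of_nat (prod_list ns) \<noteq> (0::'f alg_closure)"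
    using of_nat_alg_closure_nonzero[OF c] ns by simp
  have "x h = 0" if h: "h \<in> carrier G" for h
  proof -
    have "0 = (\<Sum>\<chi>\<in>dual G. \<chi> (inv h) * evaluation G \<chi> x)" by (simp add: ev)
    also have "\<dots> = (\<Sum>\<chi>\<in>dual G. \<Sum>g\<in>carrier G. to_ac (x g) * \<chi> (g \<otimes> inv h))"
      unfolding evaluation_def sum_distrib_left
      using h by (intro sum.cong refl) (simp add: characters_mult)
    also have "\<dots> = (\<Sum>g\<in>carrier G. to_ac (x g) * (\<Sum>\<chi>\<in>dual G. \<chi> (g \<otimes> inv h)))"
      by (subst sum.swap) (simp add: sum_distrib_left)
    also have "\<dots> = (\<Sum>g\<in>carrier G. if g = h then to_ac (x g) * of_nat (prod_list ns) else 0)"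
    proof (intro sum.cong refl)
      fix g assume g: "g \<in> carrier G"
      have "g \<otimes> inv h = \<one> \<longleftrightarrow> g = h" using g h by (metis inv_solve_right' l_one one_closed)
      thus "to_ac (x g) * (\<Sum>\<chi>\<in>dual G. \<chi> (g \<otimes> inv h)) = (if g = h then to_ac (x g) * of_nat (prod_list ns) else 0)"
        using dual_orthogonality[OF ns(1) n0, of "g \<otimes> inv h"] g h by simp
    qed
    also have "\<dots> = to_ac (x h) * of_nat (prod_list ns)" using h finite_carrier by simp
    finally show ?thesis using n0 by simp
  qed
  thus ?thesis using x by (auto simp: twisted_group_algebra_simps fun_eq_iff PiE_iff extensional_def)
qed

end

text \<open>Closure under inverses is automatic, because every element is algebraic over the base field.\<close>

lemma subfield_of_alg_closure:
  fixes S :: "'f::field alg_closure set"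
  assumes "range to_ac \<subseteq> S" "\<And>a b. a \<in> S \<Longrightarrow> b \<in> S \<Longrightarrow> a + b \<in> S" "\<And>a b. a \<in> S \<Longrightarrow> b \<in> S \<Longrightarrow> a * b \<in> S"
  shows "subfield_set S"
proof -
  have c: "to_ac c \<in> S" for c using assms(1) by auto
  have m: "- a \<in> S" if "a \<in> S" for a
    using assms(3)[OF c[of "-1"] that] by simp
  have ev: "poly (map_poly to_ac q) a \<in> S" if "a \<in> S" for q a
    using that c assms c[of 0] by (induction q) (auto simp: map_poly_pCons)
  have inv: "inverse a \<in> S" if a: "a \<in> S" for a
  proof (cases "a = 0")
    case False
    \<comment> \<open>Induction on a polynomial \<open>c + X q\<close> annihilating
      \<open>a\<close>: if \<open>c\<close> is zero then \<open>q\<close> annihilates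
      \<open>a\<close> too, otherwise \<open>- q(a) / c\<close> is the inverse of
      \<open>a\<close>.\<close>
    have "\<exists>q. poly (map_poly to_ac q) a * a = 1" if "p \<noteq> 0" "poly (map_poly to_ac p) a = 0" for p
      using that
    proof (induction p)
      case (pCons c q)
      show ?case
      proof (cases "c = 0")
        case True
        thus ?thesis using pCons False by (auto simp: map_poly_pCons)
      next
        case c: False
        have "to_ac c + a * poly (map_poly to_ac q) a = 0" using pCons.prems by (simp add: map_poly_pCons)
        hence "a * poly (map_poly to_ac q) a = - to_ac c" by (simp add: add_eq_0_iff)
        hence "to_ac (- inverse c) * poly (map_poly to_ac q) a * a = to_ac (- inverse c) * - to_ac c"
          by (metis mult.assoc mult.commute)
        also have "\<dots> = 1" using c by simp
        finally have "to_ac (- inverse c) * poly (map_poly to_ac q) a * a = 1" .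
        moreover have "poly (map_poly to_ac (Polynomial.smult (- inverse c) q)) a = to_ac (- inverse c) * poly (map_poly to_ac q) a"
          by (subst map_poly_smult) auto
        ultimately show ?thesis by metis
      qed
    qed simp
    then obtain q where "poly (map_poly to_ac q) a * a = 1" using alg_closure_algebraic[of a] by metis
    hence "inverse a = poly (map_poly to_ac q) a" by (metis inverse_unique mult.commute)
    thus ?thesis using ev[OF a] by simp
  qed (use a in auto)
  show ?thesis unfolding subfield_set_def using assms c[of 0] c[of 1] m inv by auto
qed

section \<open>Kernels of characters\<close>

text \<open>Ring homomorphisms to the closure without \<open>F\<close>-linearity, so as to include
  evaluations composed with a ring isomorphism of group algebras.\<close>

definition algebra_hom :: "('g, 'b) monoid_scheme \<Rightarrow> (('g \<Rightarrow> 'f::field) \<Rightarrow> 'f alg_closure) \<Rightarrow> bool" where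
  "algebra_hom G \<rho> \<longleftrightarrow> \<rho> \<one>\<^bsub>group_algebra G\<^esub> = 1 \<and>
     (\<forall>x\<in>carrier (group_algebra G). \<forall>y\<in>carrier (group_algebra G).
        \<rho> (x \<oplus>\<^bsub>group_algebra G\<^esub> y) = \<rho> x + \<rho> y \<and> \<rho> (x \<otimes>\<^bsub>group_algebra G\<^esub> y) = \<rho> x * \<rho> y)"

text \<open>For semisimple \<open>FG\<close>, homomorphisms with the same kernel are those that
  factor through the same simple component.\<close>

definition same_kernel :: "('g, 'b) monoid_scheme \<Rightarrow> (('g \<Rightarrow> 'f::field) \<Rightarrow> 'f alg_closure) \<Rightarrow> (('g \<Rightarrow> 'f) \<Rightarrow> 'f alg_closure) \<Rightarrow> bool" where
  "same_kernel G \<rho> \<sigma> \<longleftrightarrow> (\<forall>x\<in>carrier (group_algebra G). \<rho> x = 0 \<longleftrightarrow> \<sigma> x = 0)"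

text \<open>The field \<open>F(\<chi>)\<close>.\<close>

definition evaluation_field :: "('g, 'b) monoid_scheme \<Rightarrow> ('g \<Rightarrow> 'f::field alg_closure) \<Rightarrow> 'f alg_closure set" where
  "evaluation_field G \<chi> = evaluation G \<chi> ` carrier (group_algebra G)"

text \<open>The \<open>F\<close>-embeddings of an intermediate field \<open>S\<close> into the
  closure, injectivity being automatic for a field; they are extensional so that they can be
  counted.\<close>

definition embeddings :: "'f::field alg_closure set \<Rightarrow> ('f alg_closure \<Rightarrow> 'f alg_closure) set" where
  "embeddings S = {\<tau> \<in> S \<rightarrow>\<^sub>E UNIV. (\<forall>a\<in>S. \<forall>b\<in>S. \<tau> (a + b) = \<tau> a + \<tau> b \<and> \<tau> (a * b) = \<tau> a * \<tau> b) \<and>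
     (\<forall>c. \<tau> (to_ac c) = to_ac c)}"

context finite_comm_group begin

lemma evaluation_algebra_hom: "\<chi> \<in> dual G \<Longrightarrow> algebra_hom G (evaluation G \<chi>)"
  by (simp add: algebra_hom_def evaluation_add evaluation_mult evaluation_one)

lemma algebra_hom_zero:
  assumes "algebra_hom G (\<rho> :: ('g \<Rightarrow> 'f::field) \<Rightarrow> 'f alg_closure)"
  shows "\<rho> \<zero>\<^bsub>group_algebra G\<^esub> = 0"
proof -
  have "\<zero>\<^bsub>group_algebra G\<^esub> \<oplus>\<^bsub>group_algebra G\<^esub> \<zero>\<^bsub>group_algebra G\<^esub> = (\<zero>\<^bsub>group_algebra G\<^esub> :: 'g \<Rightarrow> 'f)"
    by (auto simp: twisted_group_algebra_simps fun_eq_iff)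
  hence "\<rho> \<zero>\<^bsub>group_algebra G\<^esub> = \<rho> \<zero>\<^bsub>group_algebra G\<^esub> + \<rho> \<zero>\<^bsub>group_algebra G\<^esub>"
    using assms algebra_closed(3)[of G] by (metis algebra_hom_def)
  thus ?thesis by (simp only: add_cancel_right_right)
qed

lemma algebra_hom_minus_one:
  assumes "algebra_hom G (\<rho> :: ('g \<Rightarrow> 'f::field) \<Rightarrow> 'f alg_closure)"
  shows "\<rho> (algebra_basis G \<one> (- 1)) = - 1"
proof -
  have "\<one>\<^bsub>group_algebra G\<^esub> \<oplus>\<^bsub>group_algebra G\<^esub> algebra_basis G \<one> (- 1) = (\<zero>\<^bsub>group_algebra G\<^esub> :: 'g \<Rightarrow> 'f)"
    by (auto simp: twisted_group_algebra_simps algebra_basis_def fun_eq_iff)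
  moreover have "\<rho> (\<one>\<^bsub>group_algebra G\<^esub> \<oplus>\<^bsub>group_algebra G\<^esub> algebra_basis G \<one> (- 1)) =
      \<rho> \<one>\<^bsub>group_algebra G\<^esub> + \<rho> (algebra_basis G \<one> (- 1))"
    using assms by (simp add: algebra_hom_def algebra_closed(4,5))
  ultimately have "\<rho> \<one>\<^bsub>group_algebra G\<^esub> + \<rho> (algebra_basis G \<one> (- 1)) = 0"
    using algebra_hom_zero[OF assms] by simp
  thus ?thesis using assms by (simp add: algebra_hom_def add_eq_0_iff)
qed

lemma to_ac_in_evaluation_field:
  assumes "\<chi> \<in> dual G"
  shows "to_ac c \<in> evaluation_field G \<chi>"
proof -
  have "evaluation G \<chi> (algebra_basis G \<one> c) = to_ac c"
    using assms by (simp add: evaluation_basis characters_one[OF is_group mult_subgroup_UNIV])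
  thus ?thesis unfolding evaluation_field_def by (metis algebra_closed(5) imageI)
qed

lemma evaluation_field_subfield:
  assumes \<chi>: "\<chi> \<in> dual G"
  shows "subfield_set (evaluation_field G \<chi>)"
proof (rule subfield_of_alg_closure)
  show "range to_ac \<subseteq> evaluation_field G \<chi>" using to_ac_in_evaluation_field[OF \<chi>] by auto
  fix a b assume "a \<in> evaluation_field G \<chi>" "b \<in> evaluation_field G \<chi>"
  then obtain x y where "x \<in> carrier (group_algebra G)" "y \<in> carrier (group_algebra G)"
    "a = evaluation G \<chi> x" "b = evaluation G \<chi> y" by (auto simp: evaluation_field_def)
  thus "a + b \<in> evaluation_field G \<chi>" "a * b \<in> evaluation_field G \<chi>"
    unfolding evaluation_field_def
    by (auto simp flip: evaluation_add evaluation_mult[OF \<chi>] intro!: imageI algebra_closed)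
qed

lemma character_in_evaluation_field:
  assumes "g \<in> carrier G"
  shows "\<chi> g \<in> evaluation_field G \<chi>"
  using evaluation_basis[OF assms, of \<chi> 1] algebra_closed(5)[of G g 1]
  unfolding evaluation_field_def by (metis imageI mult_1 to_ac_1)

text \<open>\<open>F(\<chi>)\<close> consists of the \<open>F\<close>-linear combinations of the
  values of \<open>\<chi>\<close>. This translates the condition that a simple component lies in
  \<open>K\<close> into a condition on values.\<close>

lemma evaluation_field_subset_iff:
  assumes "\<chi> \<in> dual G" "subfield_set K" "range to_ac \<subseteq> K"
  shows "evaluation_field G \<chi> \<subseteq> K \<longleftrightarrow> \<chi> \<in> characters G (K - {0})"
proof
  assume "evaluation_field G \<chi> \<subseteq> K"
  thus "\<chi> \<in> characters G (K - {0})"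
    using assms(1) character_in_evaluation_field unfolding characters_def by (auto simp: PiE_iff)
next
  assume c: "\<chi> \<in> characters G (K - {0})"
  show "evaluation_field G \<chi> \<subseteq> K"
  proof
    fix a assume "a \<in> evaluation_field G \<chi>"
    then obtain x where x: "a = (\<Sum>g\<in>carrier G. to_ac (x g) * \<chi> g)"
      by (auto simp: evaluation_field_def evaluation_def)
    have s: "sum f A \<in> K" if "finite A" "\<And>g. g \<in> A \<Longrightarrow> f g \<in> K" for f and A :: "'g set"
      using that assms(2) by (induction rule: finite_induct) (auto simp: subfield_set_def)
    have m: "to_ac (x g) * \<chi> g \<in> K" if "g \<in> carrier G" for g
      using characters_closed[OF c that] assms(2,3) by (auto simp: subfield_set_def)
    show "a \<in> K" unfolding x by (rule s[OF finite_carrier m])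
  qed
qed

text \<open>
  The kernel of \<open>\<rho>\<close> contains the kernel of some character: otherwise a product of witnesses would vanish
  under all characters, hence be zero, but not vanish under \<open>\<rho>\<close>.
\<close>

lemma exists_character_same_kernel:
  assumes c: "of_nat (card (carrier G)) \<noteq> (0::'f::field)" and \<rho>: "algebra_hom G (\<rho> :: ('g \<Rightarrow> 'f) \<Rightarrow> 'f alg_closure)"
  shows "\<exists>\<chi>\<in>dual G. same_kernel G (evaluation G \<chi>) \<rho>"
proof -
  let ?A = "group_algebra G :: ('g \<Rightarrow> 'f) ring"
  have \<rho>m: "\<rho> (x \<otimes>\<^bsub>?A\<^esub> y) = \<rho> x * \<rho> y" "\<rho> (x \<oplus>\<^bsub>?A\<^esub> y) = \<rho> x + \<rho> y"
    if "x \<in> carrier ?A" "y \<in> carrier ?A" for x y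
    using \<rho> that by (auto simp: algebra_hom_def)
  have "\<exists>\<chi>\<in>dual G. \<forall>x\<in>carrier ?A. evaluation G \<chi> x = 0 \<longrightarrow> \<rho> x = 0"
  proof (rule ccontr)
    assume "\<not> ?thesis"
    hence *: "\<exists>x\<in>carrier ?A. evaluation G \<chi> x = 0 \<and> \<rho> x \<noteq> 0" if "\<chi> \<in> dual G" for \<chi> using that by blast
    have "\<exists>x\<in>carrier ?A. (\<forall>\<chi>\<in>D. evaluation G \<chi> x = 0) \<and> \<rho> x \<noteq> 0" if "finite D" "D \<subseteq> dual G" for D
      using that
    proof (induction rule: finite_induct)
      case empty
      show ?case using \<rho> by (intro bexI[of _ "\<one>\<^bsub>?A\<^esub>"] algebra_closed(4)) (simp add: algebra_hom_def)
    next
      case (insert \<chi> D)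
      obtain x where x: "x \<in> carrier ?A" "evaluation G \<chi> x = 0" "\<rho> x \<noteq> 0" using *[of \<chi>] insert by auto
      obtain y where y: "y \<in> carrier ?A" "\<forall>\<chi>\<in>D. evaluation G \<chi> y = 0" "\<rho> y \<noteq> 0" using insert by auto
      have "evaluation G \<psi> (x \<otimes>\<^bsub>?A\<^esub> y) = 0" if "\<psi> \<in> insert \<chi> D" for \<psi>
        using that x y insert.prems by (subst evaluation_mult) auto
      thus ?case using x y \<rho>m algebra_closed(2)[where G = G and x = x and y = y]
        by (intro bexI[of _ "x \<otimes>\<^bsub>?A\<^esub> y"]) auto
    qed
    from this[OF finite_dual] obtain x where x: "x \<in> carrier ?A" "\<forall>\<chi>\<in>dual G. evaluation G \<chi> x = 0" "\<rho> x \<noteq> 0"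
      by blast
    have "x = \<zero>\<^bsub>?A\<^esub>" by (rule evaluation_separating[OF c x(1)]) (use x in auto)
    thus False using algebra_hom_zero[OF \<rho>] x by simp
  qed
  then obtain \<chi> where \<chi>: "\<chi> \<in> dual G" "\<And>x. x \<in> carrier ?A \<Longrightarrow> evaluation G \<chi> x = 0 \<Longrightarrow> \<rho> x = 0" by blast
  \<comment> \<open>The two kernels agree because that of the evaluation is maximal, its image being
    a field.\<close>
  have "evaluation G \<chi> y = 0" if y: "y \<in> carrier ?A" "\<rho> y = 0" for y
  proof (rule ccontr)
    assume n: "evaluation G \<chi> y \<noteq> 0"
    have "evaluation G \<chi> y \<in> evaluation_field G \<chi>" using y by (auto simp: evaluation_field_def)
    hence "inverse (evaluation G \<chi> y) \<in> evaluation_field G \<chi>"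
      using evaluation_field_subfield[OF \<chi>(1)] by (auto simp: subfield_set_def)
    then obtain z where z: "z \<in> carrier ?A" "evaluation G \<chi> z = inverse (evaluation G \<chi> y)"
      unfolding evaluation_field_def by force
    \<comment> \<open>\<open>?w\<close> is \<open>y z - 1\<close>, where \<open>z\<close> is an
      inverse of \<open>y\<close> modulo the kernel of the evaluation; it would be sent to zero and
      to \<open>- 1\<close> by \<open>\<rho>\<close>.\<close>
    let ?w = "(y \<otimes>\<^bsub>?A\<^esub> z) \<oplus>\<^bsub>?A\<^esub> algebra_basis G \<one> (- 1)"
    have "evaluation G \<chi> ?w = 0"
      using n z algebra_hom_minus_one[OF evaluation_algebra_hom[OF \<chi>(1)]]
      by (simp add: evaluation_add evaluation_mult[OF \<chi>(1)])
    hence "\<rho> ?w = 0" by (intro \<chi> algebra_closed)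
    moreover have "\<rho> ?w = - 1"
      unfolding \<rho>m(2)[OF algebra_closed(2,5)] \<rho>m(1)[OF y(1) z(1)] algebra_hom_minus_one[OF \<rho>]
      using y(2) by simp
    ultimately show False by simp
  qed
  thus ?thesis using \<chi> by (auto simp: same_kernel_def)
qed

text \<open>Whether \<open>u_g ^ j - 1\<close> lies in the common kernel decides both
  \<open>\<omega> ^ j = 1\<close> and \<open>\<chi> g ^ j = 1\<close>, so
  \<open>\<omega> = \<rho> u_g\<close> and \<open>\<chi> g\<close> have the same order
  \<open>d\<close>. The powers of \<open>\<omega>\<close> exhaust the \<open>d\<close>-th roots of
  unity and hence include \<open>\<chi> g\<close>. This is how control over values survives although
  \<open>\<rho>\<close> may move \<open>F\<close>.\<close>

lemma same_kernel_character_power: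
  assumes \<chi>: "\<chi> \<in> dual G" and \<rho>: "algebra_hom G (\<rho> :: ('g \<Rightarrow> 'f::field) \<Rightarrow> 'f alg_closure)"
    and k: "same_kernel G (evaluation G \<chi>) \<rho>" and g: "g \<in> carrier G"
  shows "\<exists>i. \<chi> g = \<rho> (algebra_basis G g 1) ^ (i::nat)"
proof -
  let ?A = "group_algebra G :: ('g \<Rightarrow> 'f) ring"
  define \<omega> where "\<omega> = \<rho> (algebra_basis G g 1)"
  have \<rho>m: "\<rho> (x \<otimes>\<^bsub>?A\<^esub> y) = \<rho> x * \<rho> y" "\<rho> (x \<oplus>\<^bsub>?A\<^esub> y) = \<rho> x + \<rho> y"
    if "x \<in> carrier ?A" "y \<in> carrier ?A" for x y
    using \<rho> that by (auto simp: algebra_hom_def)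
  have pow: "\<rho> (algebra_basis G (g [^] j) 1) = \<omega> ^ j" for j :: nat
  proof (induction j)
    case 0
    show ?case using \<rho> by (simp add: algebra_hom_def twisted_group_algebra_simps)
  next
    case (Suc j)
    have "algebra_basis G (g [^] Suc j) 1 = algebra_basis G (g [^] j) 1 \<otimes>\<^bsub>?A\<^esub> algebra_basis G g 1"
      using g by (simp add: basis_mult)
    thus ?case using Suc by (simp add: \<rho>m algebra_closed(5) \<omega>_def mult.commute)
  qed
  have eq: "\<omega> ^ j = 1 \<longleftrightarrow> \<chi> g ^ j = 1" for j
  proof -
    let ?w = "algebra_basis G (g [^] j) 1 \<oplus>\<^bsub>?A\<^esub> algebra_basis G \<one> (- 1)"
    have "\<rho> ?w = \<omega> ^ j - 1" by (simp add: \<rho>m algebra_closed(5) pow algebra_hom_minus_one[OF \<rho>])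
    moreover have "evaluation G \<chi> ?w = \<chi> g ^ j - 1"
      using g algebra_hom_minus_one[OF evaluation_algebra_hom[OF \<chi>]]
      by (simp add: evaluation_add evaluation_basis characters_pow[OF is_group mult_subgroup_UNIV \<chi>])
    moreover have "?w \<in> carrier ?A" by (intro algebra_closed)
    ultimately show ?thesis using k by (auto simp: same_kernel_def)
  qed
  have "0 < card (carrier G)" using finite_carrier by (auto simp: card_gt_0_iff)
  moreover have "\<chi> g ^ card (carrier G) = 1"
    using pow_order_eq_1[OF g] characters_pow[OF is_group mult_subgroup_UNIV \<chi> g, of "Coset.order G"]
      characters_one[OF is_group mult_subgroup_UNIV \<chi>] by (simp add: Coset.order_def)
  ultimately obtain d where d: "primitive_root_of_unity d (\<chi> g)" using exists_primitive_order by blast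
  have d0: "0 < d" using d by (simp add: primitive_root_of_unity_def)
  have \<omega>d: "primitive_root_of_unity d \<omega>"
    by (rule primitive_root_of_unityI[OF d0]) (simp add: eq primitive_root_power_eq_1[OF d])
  have \<omega>0: "\<omega> \<noteq> 0" using \<omega>d d0 by (auto simp: primitive_root_of_unity_def power_0_left)
  have "inj_on (\<lambda>i. \<omega> ^ i) {..<d}"
  proof (rule linorder_inj_onI)
    fix i j assume ij: "i < j" "i \<in> {..<d}" "j \<in> {..<d}"
    show "\<omega> ^ i \<noteq> \<omega> ^ j"
    proof
      assume "\<omega> ^ i = \<omega> ^ j"
      also have "\<dots> = \<omega> ^ i * \<omega> ^ (j - i)" using ij by (simp flip: power_add)
      finally have "\<omega> ^ (j - i) = 1" using \<omega>0 by simp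
      thus False using \<omega>d ij by (auto simp: primitive_root_of_unity_def)
    qed
  qed auto
  hence "card ((\<lambda>i. \<omega> ^ i) ` {..<d}) = d" by (simp add: card_image)
  moreover have "(\<lambda>i. \<omega> ^ i) ` {..<d} \<subseteq> {z. z ^ d = 1}"
  proof safe
    fix i
    have "(\<omega> ^ i) ^ d = (\<omega> ^ d) ^ i" by (simp add: mult.commute flip: power_mult)
    thus "(\<omega> ^ i) ^ d = 1" using \<omega>d by (simp add: primitive_root_of_unity_def)
  qed
  ultimately have "(\<lambda>i. \<omega> ^ i) ` {..<d} = {z. z ^ d = 1}"
    using finite_roots_of_unity[OF d0] card_roots_of_unity_le[OF d0]
    by (intro card_seteq) auto
  moreover have "\<chi> g \<in> {z. z ^ d = 1}" using d by (simp add: primitive_root_of_unity_def)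
  ultimately show ?thesis by (auto simp: \<omega>_def)
qed

text \<open>An embedding \<open>\<tau>\<close> of \<open>F(\<chi>)\<close> corresponds to the
  character \<open>\<tau> \<circ> \<chi>\<close>. Conversely, evaluation at a character with the
  same kernel factors through evaluation at \<open>\<chi>\<close>, and the induced map on
  \<open>F(\<chi>)\<close> is an embedding.\<close>

lemma card_same_kernel:
  assumes \<chi>: "\<chi> \<in> dual G"
  shows "card {\<psi> \<in> dual G. same_kernel G (evaluation G \<chi>) (evaluation G \<psi>)} = card (embeddings (evaluation_field G \<chi>))"
proof -
  let ?ev = "evaluation G \<chi>" and ?S = "evaluation_field G \<chi>"
  let ?C = "carrier (group_algebra G) :: ('g \<Rightarrow> 'a) set"
  let ?X = "{\<psi> \<in> dual G. same_kernel G (evaluation G \<chi>) (evaluation G \<psi>)}"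
  define T where "T \<tau> = (\<lambda>g\<in>carrier G. \<tau> (\<chi> g))" for \<tau> :: "'a alg_closure \<Rightarrow> 'a alg_closure"
  define T' where "T' \<psi> = (\<lambda>a\<in>?S. evaluation G \<psi> (inv_into ?C ?ev a))" for \<psi> :: "'g \<Rightarrow> 'a alg_closure"
  have S: "subfield_set ?S" by (rule evaluation_field_subfield[OF \<chi>])
  have in_S: "?ev x \<in> ?S" if "x \<in> ?C" for x using that by (simp add: evaluation_field_def)
  have sumS: "sum f A \<in> ?S" if "finite A" "\<And>g. g \<in> A \<Longrightarrow> f g \<in> ?S" for f and A :: "'g set"
    using that S by (induction rule: finite_induct) (auto simp: subfield_set_def)
  \<comment> \<open>The preimage chosen in \<open>T'\<close> does not affect the value, as two
    preimages differ by an element of the common kernel.\<close>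
  have T'_ev: "T' \<psi> (?ev x) = evaluation G \<psi> x" if \<psi>: "\<psi> \<in> ?X" and x: "x \<in> ?C" for \<psi> x
  proof -
    let ?y = "inv_into ?C ?ev (?ev x)"
    have y: "?y \<in> ?C" "?ev ?y = ?ev x" using x by (auto simp: inv_into_into f_inv_into_f)
    have "?ev (\<lambda>g\<in>carrier G. ?y g - x g) = 0" using y by (simp add: evaluation_diff)
    moreover have "(\<lambda>g\<in>carrier G. ?y g - x g) \<in> ?C" by (simp add: twisted_group_algebra_simps)
    ultimately have "evaluation G \<psi> (\<lambda>g\<in>carrier G. ?y g - x g) = 0"
      using \<psi> by (auto simp: same_kernel_def)
    hence "evaluation G \<psi> ?y = evaluation G \<psi> x" by (simp add: evaluation_diff)
    thus ?thesis using in_S[OF x] by (simp add: T'_def)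
  qed
  have T_ev: "evaluation G (T \<tau>) x = \<tau> (?ev x)" if \<tau>: "\<tau> \<in> embeddings ?S" for \<tau> x
  proof -
    have \<tau>s: "\<tau> (sum f A) = (\<Sum>g\<in>A. \<tau> (f g))" if "finite A" "\<And>g. g \<in> A \<Longrightarrow> f g \<in> ?S" for f and A :: "'g set"
      using that
    proof (induction rule: finite_induct)
      case empty
      have "\<tau> (to_ac 0) = to_ac 0" using \<tau> unfolding embeddings_def by blast
      thus ?case by simp
    next
      case (insert g A)
      have "\<tau> (f g + sum f A) = \<tau> (f g) + \<tau> (sum f A)"
        using \<tau> insert sumS[of A f] by (auto simp: embeddings_def)
      thus ?case using insert by simp
    qed
    have m: "\<tau> (to_ac (x g) * \<chi> g) = to_ac (x g) * \<tau> (\<chi> g)" if "g \<in> carrier G" for g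
      using \<tau> to_ac_in_evaluation_field[OF \<chi>] character_in_evaluation_field[OF that, of \<chi>]
      by (auto simp: embeddings_def)
    have m': "to_ac (x g) * \<chi> g \<in> ?S" if "g \<in> carrier G" for g
      using S to_ac_in_evaluation_field[OF \<chi>] character_in_evaluation_field[OF that, of \<chi>]
      by (auto simp: subfield_set_def)
    show ?thesis using finite_carrier by (simp add: evaluation_def T_def \<tau>s m m')
  qed
  have "bij_betw T (embeddings ?S) ?X"
  proof (rule bij_betw_byWitness[where f' = T'])
    show "T ` embeddings ?S \<subseteq> ?X"
    proof safe
      fix \<tau> assume \<tau>: "\<tau> \<in> embeddings ?S"
      have \<tau>m: "\<tau> (a * b) = \<tau> a * \<tau> b" if "a \<in> ?S" "b \<in> ?S" for a b
        using \<tau> that by (auto simp: embeddings_def)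
      have \<tau>c: "\<tau> (to_ac c) = to_ac c" for c using \<tau> by (auto simp: embeddings_def)
      have \<tau>0: "\<tau> a = 0 \<longleftrightarrow> a = 0" if a: "a \<in> ?S" for a
      proof
        assume *: "\<tau> a = 0"
        show "a = 0"
        proof (rule ccontr)
          assume "a \<noteq> 0"
          hence "\<tau> (to_ac 1) = \<tau> a * \<tau> (inverse a)"
            using a S by (subst \<tau>m[symmetric]) (auto simp: subfield_set_def)
          thus False using * \<tau>c[of 1] by simp
        qed
      qed (use \<tau>c[of 0] in simp)
      have "\<tau> (\<chi> g) \<noteq> 0" if "g \<in> carrier G" for g
        using \<tau>0[OF character_in_evaluation_field[OF that]] characters_nonzero[OF mult_subgroup_UNIV \<chi> that] by simp
      thus "T \<tau> \<in> dual G"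
        using \<tau>m character_in_evaluation_field[of _ \<chi>] by (auto simp: characters_def T_def characters_mult[OF \<chi>])
      show "same_kernel G ?ev (evaluation G (T \<tau>))"
        unfolding same_kernel_def T_ev[OF \<tau>] using \<tau>0 in_S by blast
    qed
    show "T' ` ?X \<subseteq> embeddings ?S"
    proof
      fix \<tau> assume "\<tau> \<in> T' ` ?X"
      then obtain \<psi> where \<psi>: "\<psi> \<in> ?X" "\<tau> = T' \<psi>" by blast
      hence \<psi>': "\<psi> \<in> dual G" by blast
      note t = T'_ev[OF \<psi>(1), folded \<psi>(2)]
      show "\<tau> \<in> embeddings ?S" unfolding embeddings_def
      proof (intro CollectI conjI ballI allI)
        show "\<tau> \<in> ?S \<rightarrow>\<^sub>E UNIV" using \<psi> by (simp add: T'_def)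
      next
        fix a b assume "a \<in> ?S" "b \<in> ?S"
        then obtain x y where xy: "x \<in> ?C" "y \<in> ?C" "a = ?ev x" "b = ?ev y"
          unfolding evaluation_field_def by blast
        show "\<tau> (a + b) = \<tau> a + \<tau> b"
          using t[OF xy(1)] t[OF xy(2)] t[OF algebra_closed(1)[OF xy(1,2)]] xy by (simp add: evaluation_add)
        show "\<tau> (a * b) = \<tau> a * \<tau> b"
          using t[OF xy(1)] t[OF xy(2)] t[OF algebra_closed(2)[where G = G and x = x and y = y]] xy
          by (simp add: evaluation_mult \<chi> \<psi>')
      next
        fix c
        have "?ev (algebra_basis G \<one> c) = to_ac c" "evaluation G \<psi> (algebra_basis G \<one> c) = to_ac c"
          using \<chi> \<psi>' by (simp_all add: evaluation_basis characters_one[OF is_group mult_subgroup_UNIV])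
        thus "\<tau> (to_ac c) = to_ac c" using t[OF algebra_closed(5)[of G \<one> c]] by simp
      qed
    qed
    show "\<forall>\<tau>\<in>embeddings ?S. T' (T \<tau>) = \<tau>"
    proof
      fix \<tau> assume \<tau>: "\<tau> \<in> embeddings ?S"
      hence "T \<tau> \<in> ?X" using \<open>T ` embeddings ?S \<subseteq> ?X\<close> by blast
      note t = T'_ev[OF this]
      have "T' (T \<tau>) a = \<tau> a" for a
      proof (cases "a \<in> ?S")
        case True
        then obtain x where "x \<in> ?C" "a = ?ev x" unfolding evaluation_field_def by blast
        thus ?thesis using t T_ev[OF \<tau>] by simp
      qed (use \<tau> in \<open>auto simp: T'_def embeddings_def PiE_iff extensional_def\<close>)
      thus "T' (T \<tau>) = \<tau>" by blast
    qed
    show "\<forall>\<psi>\<in>?X. T (T' \<psi>) = \<psi>"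
    proof
      fix \<psi> assume \<psi>: "\<psi> \<in> ?X"
      have "T (T' \<psi>) g = \<psi> g" for g
      proof (cases "g \<in> carrier G")
        case True
        thus ?thesis using T'_ev[OF \<psi> algebra_closed(5)[of G g 1]]
          by (simp add: evaluation_basis T_def)
      qed (use \<psi> in \<open>auto simp: T_def characters_def PiE_iff extensional_def\<close>)
      thus "T (T' \<psi>) = \<psi>" by blast
    qed
  qed
  thus ?thesis by (simp add: bij_betw_same_card)
qed

end

text \<open>Give each related pair the weight \<open>1 / f x = 1 / g y\<close>. The weights at any
  single point of \<open>A\<close> or of \<open>B\<close> add up to one, so the total weight is both
  cardinalities.\<close>

lemma card_eq_by_double_counting:
  fixes f :: "'a \<Rightarrow> nat" and g :: "'b \<Rightarrow> nat"
  assumes fin: "finite A" "finite B"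
    and "\<And>x. x \<in> A \<Longrightarrow> card {y \<in> B. rel x y} = f x \<and> f x > 0"
    and "\<And>y. y \<in> B \<Longrightarrow> card {x \<in> A. rel x y} = g y \<and> g y > 0"
    and "\<And>x y. x \<in> A \<Longrightarrow> y \<in> B \<Longrightarrow> rel x y \<Longrightarrow> f x = g y"
  shows "card A = card B"
proof -
  have "rat_of_nat (card A) = (\<Sum>x\<in>A. 1)" by simp
  also have "\<dots> = (\<Sum>x\<in>A. \<Sum>y\<in>{y \<in> B. rel x y}. 1 / of_nat (f x))"
    by (intro sum.cong refl) (use assms(3) in simp)
  also have "\<dots> = (\<Sum>x\<in>A. \<Sum>y\<in>{y \<in> B. rel x y}. 1 / of_nat (g y))"
    by (intro sum.cong refl) (use assms(5) in auto)
  also have "\<dots> = (\<Sum>x\<in>A. \<Sum>y\<in>B. if rel x y then 1 / of_nat (g y) else 0)"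
    using fin by (intro sum.cong[OF refl, of A]) (simp only: sum.inter_filter)
  also have "\<dots> = (\<Sum>y\<in>B. \<Sum>x\<in>A. if rel x y then 1 / of_nat (g y) else 0)"
    by (rule sum.swap)
  also have "\<dots> = (\<Sum>y\<in>B. \<Sum>x\<in>{x \<in> A. rel x y}. 1 / of_nat (g y))"
    using fin by (intro sum.cong[OF refl, of B]) (simp only: sum.inter_filter)
  also have "\<dots> = (\<Sum>y\<in>B. 1)" by (intro sum.cong refl) (use assms(4) in simp)
  also have "\<dots> = rat_of_nat (card B)" by simp
  finally show ?thesis by simp
qed

section \<open>Isomorphic group algebras\<close>

lemma ring_iso_inv_into:
  assumes h: "h \<in> ring_iso R S"
    and cl: "\<And>x y. x \<in> carrier R \<Longrightarrow> y \<in> carrier R \<Longrightarrow> x \<otimes>\<^bsub>R\<^esub> y \<in> carrier R \<and> x \<oplus>\<^bsub>R\<^esub> y \<in> carrier R"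
      "\<one>\<^bsub>R\<^esub> \<in> carrier R"
  shows "inv_into (carrier R) h \<in> ring_iso S R"
proof -
  have b: "bij_betw h (carrier R) (carrier S)" using h by (simp add: ring_iso_def)
  have hm: "h (x \<otimes>\<^bsub>R\<^esub> y) = h x \<otimes>\<^bsub>S\<^esub> h y" "h (x \<oplus>\<^bsub>R\<^esub> y) = h x \<oplus>\<^bsub>S\<^esub> h y"
    if "x \<in> carrier R" "y \<in> carrier R" for x y
    using h that by (auto simp: ring_iso_def ring_hom_def)
  have h1: "h \<one>\<^bsub>R\<^esub> = \<one>\<^bsub>S\<^esub>" using h by (auto simp: ring_iso_def ring_hom_def)
  let ?k = "inv_into (carrier R) h"
  have k: "?k y \<in> carrier R" "h (?k y) = y" if "y \<in> carrier S" for y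
    using that b by (auto simp: bij_betw_def inv_into_into f_inv_into_f)
  have kh: "?k (h x) = x" if "x \<in> carrier R" for x
    using that b by (auto simp: bij_betw_def inv_into_f_f)
  have "?k \<in> ring_hom S R"
  proof (rule ring_hom_memI)
    fix x y assume xy: "x \<in> carrier S" "y \<in> carrier S"
    have c: "?k x \<otimes>\<^bsub>R\<^esub> ?k y \<in> carrier R" "?k x \<oplus>\<^bsub>R\<^esub> ?k y \<in> carrier R"
      using cl(1)[OF k(1)[OF xy(1)] k(1)[OF xy(2)]] by auto
    show "?k (x \<otimes>\<^bsub>S\<^esub> y) = ?k x \<otimes>\<^bsub>R\<^esub> ?k y"
      using kh[OF c(1)] hm(1)[OF k(1)[OF xy(1)] k(1)[OF xy(2)]] k(2)[OF xy(1)] k(2)[OF xy(2)] by simp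
    show "?k (x \<oplus>\<^bsub>S\<^esub> y) = ?k x \<oplus>\<^bsub>R\<^esub> ?k y"
      using kh[OF c(2)] hm(2)[OF k(1)[OF xy(1)] k(1)[OF xy(2)]] k(2)[OF xy(1)] k(2)[OF xy(2)] by simp
  next
    show "?k \<one>\<^bsub>S\<^esub> = \<one>\<^bsub>R\<^esub>" using kh[OF cl(2)] h1 by simp
  qed (rule k(1))
  thus ?thesis using bij_betw_inv_into[OF b] by (simp add: ring_iso_def)
qed

locale group_algebra_iso = G: finite_comm_group G + H: finite_comm_group H
  for G :: "'g monoid" and H :: "'h monoid" +
  fixes \<phi> :: "('g \<Rightarrow> 'f::field) \<Rightarrow> ('h \<Rightarrow> 'f)"
  assumes \<phi>: "\<phi> \<in> ring_iso (group_algebra G) (group_algebra H)"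
    and card_nonzero: "of_nat (card (carrier G)) \<noteq> (0::'f)"
begin

lemma \<phi>_closed: "x \<in> carrier (group_algebra G) \<Longrightarrow> \<phi> x \<in> carrier (group_algebra H)"
  using \<phi> by (auto simp: ring_iso_def ring_hom_def)

lemma \<phi>_hom:
  assumes "x \<in> carrier (group_algebra G)" "y \<in> carrier (group_algebra G)"
  shows "\<phi> (x \<otimes>\<^bsub>group_algebra G\<^esub> y) = \<phi> x \<otimes>\<^bsub>group_algebra H\<^esub> \<phi> y"
    "\<phi> (x \<oplus>\<^bsub>group_algebra G\<^esub> y) = \<phi> x \<oplus>\<^bsub>group_algebra H\<^esub> \<phi> y"
  using \<phi> assms by (auto simp: ring_iso_def ring_hom_def)

lemma \<phi>_one: "\<phi> \<one>\<^bsub>group_algebra G\<^esub> = \<one>\<^bsub>group_algebra H\<^esub>"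
  using \<phi> by (auto simp: ring_iso_def ring_hom_def)

lemma \<phi>_bij: "bij_betw \<phi> (carrier (group_algebra G)) (carrier (group_algebra H))"
  using \<phi> by (auto simp: ring_iso_def)

lemma \<phi>_zero: "\<phi> \<zero>\<^bsub>group_algebra G\<^esub> = \<zero>\<^bsub>group_algebra H\<^esub>"
proof -
  have z: "\<phi> \<zero>\<^bsub>group_algebra G\<^esub> \<in> carrier (group_algebra H)" by (intro \<phi>_closed algebra_closed)
  have "\<phi> (\<zero>\<^bsub>group_algebra G\<^esub> \<oplus>\<^bsub>group_algebra G\<^esub> \<zero>\<^bsub>group_algebra G\<^esub>)
      = \<phi> \<zero>\<^bsub>group_algebra G\<^esub> \<oplus>\<^bsub>group_algebra H\<^esub> \<phi> \<zero>\<^bsub>group_algebra G\<^esub>"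
    by (intro \<phi>_hom algebra_closed)
  also have "\<zero>\<^bsub>group_algebra G\<^esub> \<oplus>\<^bsub>group_algebra G\<^esub> \<zero>\<^bsub>group_algebra G\<^esub> = (\<zero>\<^bsub>group_algebra G\<^esub> :: 'g \<Rightarrow> 'f)"
    by (auto simp: twisted_group_algebra_simps fun_eq_iff)
  finally have e: "\<phi> \<zero>\<^bsub>group_algebra G\<^esub> = \<phi> \<zero>\<^bsub>group_algebra G\<^esub> \<oplus>\<^bsub>group_algebra H\<^esub> \<phi> \<zero>\<^bsub>group_algebra G\<^esub>" .
  have "\<phi> \<zero>\<^bsub>group_algebra G\<^esub> h = 0" if "h \<in> carrier H" for h
  proof -
    have "\<phi> \<zero>\<^bsub>group_algebra G\<^esub> h = (\<phi> \<zero>\<^bsub>group_algebra G\<^esub> \<oplus>\<^bsub>group_algebra H\<^esub> \<phi> \<zero>\<^bsub>group_algebra G\<^esub>) h"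
      by (rule fun_cong[OF e])
    also have "\<dots> = \<phi> \<zero>\<^bsub>group_algebra G\<^esub> h + \<phi> \<zero>\<^bsub>group_algebra G\<^esub> h"
      using that by (simp add: twisted_group_algebra_simps(2))
    finally show ?thesis by (simp only: add_cancel_right_right)
  qed
  thus ?thesis using z by (auto simp: twisted_group_algebra_simps fun_eq_iff PiE_iff extensional_def)
qed

text \<open>The group algebra of \<open>G\<close> is reduced, whereas \<open>\<Sum>u\<^sub>h\<close> squares to \<open>|H|\<close> times itself.\<close>

lemma card_nonzero': "of_nat (card (carrier H)) \<noteq> (0::'f)"
proof
  assume c: "of_nat (card (carrier H)) = (0::'f)"
  define N where "N = (\<lambda>h\<in>carrier H. 1 :: 'f)"
  have N: "N \<in> carrier (group_algebra H)" by (simp add: N_def twisted_group_algebra_simps)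
  have NN: "N \<otimes>\<^bsub>group_algebra H\<^esub> N = \<zero>\<^bsub>group_algebra H\<^esub>"
  proof
    fix k
    have "(\<Sum>p\<in>{p \<in> carrier H \<times> carrier H. fst p \<otimes>\<^bsub>H\<^esub> snd p = k}. 1) = (0::'f)" if k: "k \<in> carrier H"
    proof -
      \<comment> \<open>The pairs with product \<open>k\<close> are parametrised by their first
        component, so the coefficient of the square is the order of \<open>H\<close>, assumed here
        to be zero in \<open>F\<close>.\<close>
      have "bij_betw (\<lambda>h. (h, inv\<^bsub>H\<^esub> h \<otimes>\<^bsub>H\<^esub> k)) (carrier H) {p \<in> carrier H \<times> carrier H. fst p \<otimes>\<^bsub>H\<^esub> snd p = k}"
        by (rule bij_betw_byWitness[where f' = fst])
           (use k in \<open>auto simp: H.m_assoc[symmetric]\<close>)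
      thus ?thesis using c by (simp add: bij_betw_same_card[symmetric])
    qed
    moreover have "(\<Sum>(g, h)\<in>{p \<in> carrier H \<times> carrier H. fst p \<otimes>\<^bsub>H\<^esub> snd p = k}. N g * N h * 1)
        = (\<Sum>p\<in>{p \<in> carrier H \<times> carrier H. fst p \<otimes>\<^bsub>H\<^esub> snd p = k}. 1)"
      by (rule sum.cong) (auto simp: N_def)
    ultimately show "(N \<otimes>\<^bsub>group_algebra H\<^esub> N) k = \<zero>\<^bsub>group_algebra H\<^esub> k"
      by (cases "k \<in> carrier H") (auto simp: twisted_group_algebra_simps twisted_group_algebra_mult)
  qed
  have "N \<in> \<phi> ` carrier (group_algebra G)" using N bij_betw_imp_surj_on[OF \<phi>_bij] by simp
  then obtain y where y: "y \<in> carrier (group_algebra G)" "\<phi> y = N" by blast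
  have "\<phi> (y \<otimes>\<^bsub>group_algebra G\<^esub> y) = \<phi> \<zero>\<^bsub>group_algebra G\<^esub>"
    using y NN by (simp add: \<phi>_hom \<phi>_zero)
  hence yy: "y \<otimes>\<^bsub>group_algebra G\<^esub> y = \<zero>\<^bsub>group_algebra G\<^esub>"
    by (rule inj_onD[OF bij_betw_imp_inj_on[OF \<phi>_bij]]) (rule algebra_closed)+
  have "evaluation G \<chi> y = 0" if "\<chi> \<in> dual G" for \<chi>
    using G.evaluation_mult[OF that, of y y] yy by (simp add: G.evaluation_zero)
  hence "y = \<zero>\<^bsub>group_algebra G\<^esub>" by (rule G.evaluation_separating[OF card_nonzero y(1)])
  hence "N = \<zero>\<^bsub>group_algebra H\<^esub>" using y \<phi>_zero by simp
  hence "N \<one>\<^bsub>H\<^esub> = \<zero>\<^bsub>group_algebra H\<^esub> \<one>\<^bsub>H\<^esub>" by simp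
  thus False by (simp add: N_def twisted_group_algebra_simps)
qed

lemma algebra_hom_comp:
  assumes "\<chi>' \<in> dual H"
  shows "algebra_hom G (\<lambda>x. evaluation H \<chi>' (\<phi> x))"
  using assms by (auto simp: algebra_hom_def \<phi>_hom \<phi>_one H.evaluation_add H.evaluation_mult H.evaluation_one)

text \<open>Every value of \<open>\<chi>\<close> is a power of an element of
  \<open>F(\<chi>')\<close>, and this field contains \<open>F\<close> whatever \<open>\<phi>\<close>
  does to scalars.\<close>

lemma evaluation_field_subset:
  assumes \<chi>: "\<chi> \<in> dual G" and \<chi>': "\<chi>' \<in> dual H"
    and k: "same_kernel G (evaluation G \<chi>) (\<lambda>x. evaluation H \<chi>' (\<phi> x))"
  shows "evaluation_field G \<chi> \<subseteq> evaluation_field H \<chi>'"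
proof -
  let ?K = "evaluation_field H \<chi>'"
  have K: "subfield_set ?K" "range to_ac \<subseteq> ?K"
    using H.evaluation_field_subfield[OF \<chi>'] H.to_ac_in_evaluation_field[OF \<chi>'] by auto
  have "\<chi> g \<in> ?K" if g: "g \<in> carrier G" for g
  proof -
    obtain i :: nat where i: "\<chi> g = evaluation H \<chi>' (\<phi> (algebra_basis G g 1)) ^ i"
      using G.same_kernel_character_power[OF \<chi> algebra_hom_comp[OF \<chi>'] k g] by blast
    have "evaluation H \<chi>' (\<phi> (algebra_basis G g 1)) \<in> ?K"
      unfolding evaluation_field_def by (intro imageI \<phi>_closed algebra_closed)
    hence "evaluation H \<chi>' (\<phi> (algebra_basis G g 1)) ^ i \<in> ?K" for i
      using K by (induction i) (auto simp: subfield_set_def)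
    thus ?thesis using i by simp
  qed
  hence "\<chi> \<in> characters G (?K - {0})" using \<chi> by (auto simp: characters_def PiE_iff)
  thus ?thesis using G.evaluation_field_subset_iff[OF \<chi> K] by simp
qed

text \<open>Makes all results on \<open>\<phi>\<close> available with \<open>G\<close> and
  \<open>H\<close> exchanged, in particular the reverse inclusion of fields.\<close>

lemma inverse_iso: "group_algebra_iso H G (inv_into (carrier (group_algebra G)) \<phi>)"
proof (unfold_locales)
  show "inv_into (carrier (group_algebra G)) \<phi> \<in> ring_iso (group_algebra H) (group_algebra G)"
    by (rule ring_iso_inv_into[OF \<phi>]) (auto intro: algebra_closed)
qed (rule card_nonzero')

lemma same_kernel_inverse:
  assumes "same_kernel H (evaluation H \<chi>') (\<lambda>y. evaluation G \<chi> (inv_into (carrier (group_algebra G)) \<phi> y))"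
  shows "same_kernel G (evaluation G \<chi>) (\<lambda>x. evaluation H \<chi>' (\<phi> x))"
  unfolding same_kernel_def
proof
  fix x :: "'g \<Rightarrow> 'f" assume x: "x \<in> carrier (group_algebra G)"
  thus "(evaluation G \<chi> x = 0) = (evaluation H \<chi>' (\<phi> x) = 0)"
    using assms \<phi>_closed[OF x] \<phi>_bij by (auto simp: same_kernel_def bij_betw_def inv_into_f_f)
qed

lemma same_kernel_inverse':
  assumes "same_kernel G (evaluation G \<chi>) (\<lambda>x. evaluation H \<chi>' (\<phi> x))"
  shows "same_kernel H (evaluation H \<chi>') (\<lambda>y. evaluation G \<chi> (inv_into (carrier (group_algebra G)) \<phi> y))"
  unfolding same_kernel_def
proof
  fix y :: "'h \<Rightarrow> 'f" assume y: "y \<in> carrier (group_algebra H)"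
  hence "inv_into (carrier (group_algebra G)) \<phi> y \<in> carrier (group_algebra G)"
    "\<phi> (inv_into (carrier (group_algebra G)) \<phi> y) = y"
    using \<phi>_bij by (auto simp: bij_betw_def inv_into_into f_inv_into_f)
  thus "(evaluation H \<chi>' y = 0) = (evaluation G \<chi> (inv_into (carrier (group_algebra G)) \<phi> y) = 0)"
    using assms by (auto simp: same_kernel_def)
qed

lemma evaluation_field_eq:
  assumes \<chi>: "\<chi> \<in> dual G" and \<chi>': "\<chi>' \<in> dual H"
    and k: "same_kernel G (evaluation G \<chi>) (\<lambda>x. evaluation H \<chi>' (\<phi> x))"
  shows "evaluation_field G \<chi> = evaluation_field H \<chi>'"
  using evaluation_field_subset[OF assms]
    group_algebra_iso.evaluation_field_subset[OF inverse_iso \<chi>' \<chi> same_kernel_inverse'[OF k]] by blast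

text \<open>The pullback of the evaluation at \<open>\<chi>'\<close> has the kernel of some
  character \<open>\<chi>\<close> of \<open>G\<close>. The characters matched with
  \<open>\<chi>'\<close> are those with the kernel of \<open>\<chi>\<close>; they all generate the
  field \<open>F(\<chi>')\<close>, hence have values in \<open>K\<close>, and their number is that
  of its embeddings.\<close>

lemma card_matching_characters:
  assumes K: "subfield_set K" "range to_ac \<subseteq> K" and \<chi>': "\<chi>' \<in> characters H (K - {0})"
  shows "card {\<chi> \<in> characters G (K - {0}). same_kernel G (evaluation G \<chi>) (\<lambda>x. evaluation H \<chi>' (\<phi> x))}
      = card (embeddings (evaluation_field H \<chi>')) \<and> card (embeddings (evaluation_field H \<chi>')) > 0"
proof -
  let ?rel = "\<lambda>\<chi>. same_kernel G (evaluation G \<chi>) (\<lambda>x. evaluation H \<chi>' (\<phi> x))"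
  have sub: "characters G (K - {0}) \<subseteq> dual G" "characters H (K - {0}) \<subseteq> dual H"
    by (auto simp: characters_def PiE_iff)
  hence \<chi>'d: "\<chi>' \<in> dual H" using \<chi>' by blast
  obtain \<chi> where \<chi>: "\<chi> \<in> dual G" "?rel \<chi>"
    using G.exists_character_same_kernel[OF card_nonzero algebra_hom_comp[OF \<chi>'d]] by blast
  have eq: "evaluation_field G \<psi> = evaluation_field H \<chi>'" if "\<psi> \<in> dual G" "?rel \<psi>" for \<psi>
    using evaluation_field_eq[OF that(1) \<chi>'d that(2)] .
  have in_K: "evaluation_field H \<chi>' \<subseteq> K" using H.evaluation_field_subset_iff[OF \<chi>'d K] \<chi>' by simp
  have set_eq: "{\<psi> \<in> characters G (K - {0}). ?rel \<psi>} = {\<psi> \<in> dual G. same_kernel G (evaluation G \<chi>) (evaluation G \<psi>)}"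
  proof safe
    fix \<psi> assume \<psi>: "\<psi> \<in> characters G (K - {0})" "?rel \<psi>"
    thus "\<psi> \<in> dual G" using sub by blast
    show "same_kernel G (evaluation G \<chi>) (evaluation G \<psi>)"
      using \<psi>(2) \<chi>(2) by (simp add: same_kernel_def)
  next
    fix \<psi> assume \<psi>: "\<psi> \<in> dual G" "same_kernel G (evaluation G \<chi>) (evaluation G \<psi>)"
    thus r: "?rel \<psi>" using \<chi>(2) by (simp add: same_kernel_def)
    show "\<psi> \<in> characters G (K - {0})"
      using G.evaluation_field_subset_iff[OF \<psi>(1) K] eq[OF \<psi>(1) r] in_K by simp
  qed
  have "card {\<psi> \<in> characters G (K - {0}). ?rel \<psi>} = card (embeddings (evaluation_field H \<chi>'))"
    unfolding set_eq G.card_same_kernel[OF \<chi>(1)] using eq[OF \<chi>] by simp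
  moreover have "card {\<psi> \<in> characters G (K - {0}). ?rel \<psi>} > 0"
  proof -
    have "\<chi> \<in> {\<psi> \<in> dual G. same_kernel G (evaluation G \<chi>) (evaluation G \<psi>)}"
      using \<chi> by (simp add: same_kernel_def)
    moreover have "finite {\<psi> \<in> dual G. same_kernel G (evaluation G \<chi>) (evaluation G \<psi>)}"
      using G.finite_dual by auto
    ultimately show ?thesis unfolding set_eq by (auto simp: card_gt_0_iff)
  qed
  ultimately show ?thesis by simp
qed

text \<open>Matched characters generate the same field, and each one is matched with as many
  characters of the other group as this field has embeddings. Double counting applies.\<close>

theorem card_characters_eq:
  assumes K: "subfield_set K" "range to_ac \<subseteq> (K :: 'f alg_closure set)"
  shows "card (characters G (K - {0})) = card (characters H (K - {0}))"
proof -
  let ?rel = "\<lambda>\<chi> \<chi>'. same_kernel G (evaluation G \<chi>) (\<lambda>x. evaluation H \<chi>' (\<phi> x))"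
  have sub: "characters G (K - {0}) \<subseteq> dual G" "characters H (K - {0}) \<subseteq> dual H"
    by (auto simp: characters_def PiE_iff)
  show ?thesis
  proof (rule card_eq_by_double_counting[where rel = ?rel])
    show "finite (characters G (K - {0}))" "finite (characters H (K - {0}))"
      using sub G.finite_dual H.finite_dual finite_subset by blast+
  next
    fix \<chi>' assume "\<chi>' \<in> characters H (K - {0})"
    thus "card {\<chi> \<in> characters G (K - {0}). ?rel \<chi> \<chi>'} = card (embeddings (evaluation_field H \<chi>')) \<and>
      card (embeddings (evaluation_field H \<chi>')) > 0"
      by (rule card_matching_characters[OF K])
  next
    fix \<chi> assume \<chi>: "\<chi> \<in> characters G (K - {0})"
    have "{\<chi>' \<in> characters H (K - {0}). ?rel \<chi> \<chi>'} = {\<chi>' \<in> characters H (K - {0}).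
      same_kernel H (evaluation H \<chi>') (\<lambda>y. evaluation G \<chi> (inv_into (carrier (group_algebra G)) \<phi> y))}"
      using same_kernel_inverse same_kernel_inverse' by blast
    thus "card {\<chi>' \<in> characters H (K - {0}). ?rel \<chi> \<chi>'} = card (embeddings (evaluation_field G \<chi>)) \<and>
      card (embeddings (evaluation_field G \<chi>)) > 0"
      using group_algebra_iso.card_matching_characters[OF inverse_iso K \<chi>] by simp
  next
    fix \<chi> \<chi>' assume *: "\<chi> \<in> characters G (K - {0})" "\<chi>' \<in> characters H (K - {0})" "?rel \<chi> \<chi>'"
    have "evaluation_field G \<chi> = evaluation_field H \<chi>'"
      by (rule evaluation_field_eq) (use * sub in auto)
    thus "card (embeddings (evaluation_field G \<chi>)) = card (embeddings (evaluation_field H \<chi>'))" by simp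
  qed
qed

end

lemma subfield_mult_subgroup: "subfield_set K \<Longrightarrow> mult_subgroup (K - {0})"
  by (auto simp: subfield_set_def mult_subgroup_def)

lemma adjoin_subfield:
  "subfield_set (adjoin \<zeta>)" "range to_ac \<subseteq> adjoin \<zeta>" "\<zeta> \<in> adjoin \<zeta>"
  unfolding adjoin_def subfield_set_def by auto

lemma adjoin_range_to_ac: "adjoin (to_ac c) = range to_ac"
proof -
  have "subfield_set (range to_ac :: 'a alg_closure set)"
    by (rule subfield_of_alg_closure) (auto simp flip: to_ac_add to_ac_mult)
  thus ?thesis unfolding adjoin_def by blast
qed

section \<open>Cohomology classes and commutator forms\<close>

text \<open>For an abelian group, the scalar by which \<open>u_g u_h\<close> differs from
  \<open>u_h u_g\<close>.\<close>

definition commutator_form :: "('g, 'b) monoid_scheme \<Rightarrow> ('g \<Rightarrow> 'g \<Rightarrow> 'f::field) \<Rightarrow> 'g \<Rightarrow> 'g \<Rightarrow> 'f" where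
  "commutator_form G \<alpha> = (\<lambda>g\<in>carrier G. \<lambda>h\<in>carrier G. \<alpha> g h / \<alpha> h g)"

abbreviation cocycle_class :: "('g, 'b) monoid_scheme \<Rightarrow> ('g \<Rightarrow> 'g \<Rightarrow> 'f::field) \<Rightarrow> ('g \<Rightarrow> 'g \<Rightarrow> 'f) set" where
  "cocycle_class G \<alpha> \<equiv> cohomologous G `` {\<alpha>}"

lemma cocycles_nonzero: "\<alpha> \<in> cocycles G \<Longrightarrow> g \<in> carrier G \<Longrightarrow> h \<in> carrier G \<Longrightarrow> \<alpha> g h \<noteq> 0"
  by (simp add: cocycles_def)

lemma cocycles_eq:
  "\<alpha> \<in> cocycles G \<Longrightarrow> g \<in> carrier G \<Longrightarrow> h \<in> carrier G \<Longrightarrow> k \<in> carrier G \<Longrightarrow>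
    \<alpha> g h * \<alpha> (g \<otimes>\<^bsub>G\<^esub> h) k = \<alpha> h k * \<alpha> g (h \<otimes>\<^bsub>G\<^esub> k)"
  by (simp add: cocycles_def)

lemma cocyclesI:
  assumes "\<And>g h. g \<in> carrier G \<Longrightarrow> h \<in> carrier G \<Longrightarrow> \<alpha> g h \<noteq> 0"
    "\<And>g h k. g \<in> carrier G \<Longrightarrow> h \<in> carrier G \<Longrightarrow> k \<in> carrier G \<Longrightarrow>
      \<alpha> g h * \<alpha> (g \<otimes>\<^bsub>G\<^esub> h) k = \<alpha> h k * \<alpha> g (h \<otimes>\<^bsub>G\<^esub> k)"
  shows "\<alpha> \<in> cocycles G"
  using assms by (simp add: cocycles_def)

lemma cocycles_mult:
  assumes \<alpha>: "\<alpha> \<in> cocycles G" and \<beta>: "\<beta> \<in> cocycles G"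
  shows "(\<lambda>g h. \<alpha> g h * \<beta> g h) \<in> cocycles G"
proof (rule cocyclesI)
  fix g h k assume c: "g \<in> carrier G" "h \<in> carrier G" "k \<in> carrier G"
  have "\<alpha> g h * \<beta> g h * (\<alpha> (g \<otimes>\<^bsub>G\<^esub> h) k * \<beta> (g \<otimes>\<^bsub>G\<^esub> h) k) =
      (\<alpha> g h * \<alpha> (g \<otimes>\<^bsub>G\<^esub> h) k) * (\<beta> g h * \<beta> (g \<otimes>\<^bsub>G\<^esub> h) k)"
    by (simp add: mult_ac)
  also have "\<dots> = \<alpha> h k * \<beta> h k * (\<alpha> g (h \<otimes>\<^bsub>G\<^esub> k) * \<beta> g (h \<otimes>\<^bsub>G\<^esub> k))"
    unfolding cocycles_eq[OF \<alpha> c] cocycles_eq[OF \<beta> c] by (simp add: mult_ac)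
  finally show "\<alpha> g h * \<beta> g h * (\<alpha> (g \<otimes>\<^bsub>G\<^esub> h) k * \<beta> (g \<otimes>\<^bsub>G\<^esub> h) k) =
      \<alpha> h k * \<beta> h k * (\<alpha> g (h \<otimes>\<^bsub>G\<^esub> k) * \<beta> g (h \<otimes>\<^bsub>G\<^esub> k))" .
qed (simp add: cocycles_nonzero[OF \<alpha>] cocycles_nonzero[OF \<beta>])

lemma cocycles_power: "\<alpha> \<in> cocycles G \<Longrightarrow> (\<lambda>g h. \<alpha> g h ^ n) \<in> cocycles G"
  by (simp add: cocycles_def flip: power_mult_distrib)

lemma cocycles_one: "(\<lambda>_ _. 1) \<in> cocycles G"
  by (simp add: cocycles_def)

lemma cocycles_inverse: "\<alpha> \<in> cocycles G \<Longrightarrow> (\<lambda>g h. inverse (\<alpha> g h)) \<in> cocycles G"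
  by (simp add: cocycles_def flip: inverse_mult_distrib)

text \<open>Both sides of the cocycle identity expand to
  \<open>\<alpha> g h * \<alpha> g k * \<alpha> h k\<close>.\<close>

lemma bicharacters_cocycles:
  assumes "mult_subgroup U" "\<alpha> \<in> bicharacters G U"
  shows "\<alpha> \<in> cocycles G"
  unfolding cocycles_def
proof (intro CollectI conjI ballI)
  fix g h k assume "g \<in> carrier G" "h \<in> carrier G" "k \<in> carrier G"
  thus "\<alpha> g h * \<alpha> (g \<otimes>\<^bsub>G\<^esub> h) k = \<alpha> h k * \<alpha> g (h \<otimes>\<^bsub>G\<^esub> k)"
    by (simp add: bicharacters_mult[OF assms(2)])
next
  fix g h assume gh: "g \<in> carrier G" "h \<in> carrier G"
  hence "\<alpha> g h \<in> U" using assms(2) by (auto simp: bicharacters_def PiE_iff)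
  thus "\<alpha> g h \<noteq> 0" using assms(1) by (auto simp: mult_subgroup_def)
qed

lemma cohomologousI:
  assumes "\<alpha> \<in> cocycles G" "\<beta> \<in> cocycles G" "\<And>g. g \<in> carrier G \<Longrightarrow> c g \<noteq> 0"
    "\<And>g h. g \<in> carrier G \<Longrightarrow> h \<in> carrier G \<Longrightarrow> \<beta> g h = \<alpha> g h * c g * c h / c (g \<otimes>\<^bsub>G\<^esub> h)"
  shows "(\<alpha>, \<beta>) \<in> cohomologous G"
  using assms unfolding cohomologous_def by blast

lemma cohomologousE:
  assumes "(\<alpha>, \<beta>) \<in> cohomologous G"
  obtains c where "\<alpha> \<in> cocycles G" "\<beta> \<in> cocycles G" "\<And>g. g \<in> carrier G \<Longrightarrow> c g \<noteq> 0"
    "\<And>g h. g \<in> carrier G \<Longrightarrow> h \<in> carrier G \<Longrightarrow> \<beta> g h = \<alpha> g h * c g * c h / c (g \<otimes>\<^bsub>G\<^esub> h)"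
  using assms unfolding cohomologous_def by blast

context finite_comm_group begin

lemma equiv_cohomologous: "equiv (cocycles G) (cohomologous G)"
proof (rule equivI)
  show "cohomologous G \<subseteq> cocycles G \<times> cocycles G" by (auto simp: cohomologous_def)
  show "refl_on (cocycles G) (cohomologous G)"
    by (rule refl_onI) (auto intro: cohomologousI[where c = "\<lambda>_. 1"])
  show "sym (cohomologous G)"
  proof (rule symI)
    fix \<alpha> \<beta> assume "(\<alpha>, \<beta>) \<in> cohomologous G"
    then obtain c where c: "\<alpha> \<in> cocycles G" "\<beta> \<in> cocycles G" "\<And>g. g \<in> carrier G \<Longrightarrow> c g \<noteq> 0"
      "\<And>g h. g \<in> carrier G \<Longrightarrow> h \<in> carrier G \<Longrightarrow> \<beta> g h = \<alpha> g h * c g * c h / c (g \<otimes> h)"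
      by (erule cohomologousE)
    show "(\<beta>, \<alpha>) \<in> cohomologous G"
      by (rule cohomologousI[where c = "\<lambda>g. inverse (c g)"]) (use c in \<open>auto simp: field_simps\<close>)
  qed
  show "trans (cohomologous G)"
  proof (rule transI)
    fix \<alpha> \<beta> \<gamma> assume "(\<alpha>, \<beta>) \<in> cohomologous G" "(\<beta>, \<gamma>) \<in> cohomologous G"
    then obtain c d where c: "\<alpha> \<in> cocycles G" "\<beta> \<in> cocycles G" "\<And>g. g \<in> carrier G \<Longrightarrow> c g \<noteq> 0"
      "\<And>g h. g \<in> carrier G \<Longrightarrow> h \<in> carrier G \<Longrightarrow> \<beta> g h = \<alpha> g h * c g * c h / c (g \<otimes> h)"
      and d: "\<gamma> \<in> cocycles G" "\<And>g. g \<in> carrier G \<Longrightarrow> d g \<noteq> 0"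
      "\<And>g h. g \<in> carrier G \<Longrightarrow> h \<in> carrier G \<Longrightarrow> \<gamma> g h = \<beta> g h * d g * d h / d (g \<otimes> h)"
      by (elim cohomologousE) blast
    show "(\<alpha>, \<gamma>) \<in> cohomologous G"
      by (rule cohomologousI[where c = "\<lambda>g. c g * d g"]) (auto simp: c d field_simps)
  qed
qed

lemma cohomologous_mult:
  assumes "(\<alpha>, \<alpha>') \<in> cohomologous G" "(\<beta>, \<beta>') \<in> cohomologous G"
  shows "((\<lambda>g h. \<alpha> g h * \<beta> g h), (\<lambda>g h. \<alpha>' g h * \<beta>' g h)) \<in> cohomologous G"
proof -
  obtain c where c: "\<alpha> \<in> cocycles G" "\<alpha>' \<in> cocycles G" "\<And>g. g \<in> carrier G \<Longrightarrow> c g \<noteq> 0"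
    "\<And>g h. g \<in> carrier G \<Longrightarrow> h \<in> carrier G \<Longrightarrow> \<alpha>' g h = \<alpha> g h * c g * c h / c (g \<otimes> h)"
    using assms(1) by (erule cohomologousE)
  obtain d where d: "\<beta> \<in> cocycles G" "\<beta>' \<in> cocycles G" "\<And>g. g \<in> carrier G \<Longrightarrow> d g \<noteq> 0"
    "\<And>g h. g \<in> carrier G \<Longrightarrow> h \<in> carrier G \<Longrightarrow> \<beta>' g h = \<beta> g h * d g * d h / d (g \<otimes> h)"
    using assms(2) by (erule cohomologousE)
  show ?thesis
    by (rule cohomologousI[where c = "\<lambda>g. c g * d g"])
       (auto simp: c d field_simps intro: cocycles_mult)
qed

lemma carrier_H2: "C \<in> carrier (H2 G F) \<longleftrightarrow> (\<exists>\<alpha>\<in>cocycles G. C = cocycle_class G \<alpha>)"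
  by (auto simp: H2_def quotient_def)

lemma class_self: "\<alpha> \<in> cocycles G \<Longrightarrow> \<alpha> \<in> cocycle_class G \<alpha>"
  using equiv_class_self[OF equiv_cohomologous] .

lemma class_eq_of_mem:
  assumes "C \<in> carrier (H2 G F)" "\<alpha> \<in> C"
  shows "\<alpha> \<in> cocycles G" "C = cocycle_class G \<alpha>"
proof -
  obtain \<beta> where b: "\<beta> \<in> cocycles G" "C = cocycle_class G \<beta>" using assms(1) by (auto simp: carrier_H2)
  hence r: "(\<beta>, \<alpha>) \<in> cohomologous G" using assms(2) by auto
  thus "\<alpha> \<in> cocycles G" by (auto simp: cohomologous_def)
  show "C = cocycle_class G \<alpha>" using b equiv_class_eq[OF equiv_cohomologous r] by simp
qed

text \<open>The representatives picked by \<open>SOME\<close> in \<open>H2\<close> are cohomologous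
  to the given ones, and so are the products.\<close>

lemma class_mult:
  assumes "\<alpha> \<in> cocycles G" "\<beta> \<in> cocycles G"
  shows "cocycle_class G \<alpha> \<otimes>\<^bsub>H2 G F\<^esub> cocycle_class G \<beta> = cocycle_class G (\<lambda>g h. \<alpha> g h * \<beta> g h)"
proof -
  have "(SOME \<gamma>. \<gamma> \<in> cocycle_class G \<alpha>) \<in> cocycle_class G \<alpha>"
    "(SOME \<gamma>. \<gamma> \<in> cocycle_class G \<beta>) \<in> cocycle_class G \<beta>"
    using someI[of "\<lambda>\<gamma>. \<gamma> \<in> cocycle_class G \<alpha>", OF class_self[OF assms(1)]]
      someI[of "\<lambda>\<gamma>. \<gamma> \<in> cocycle_class G \<beta>", OF class_self[OF assms(2)]] by auto
  hence "((\<lambda>g h. \<alpha> g h * \<beta> g h), (\<lambda>g h. (SOME \<gamma>. \<gamma> \<in> cocycle_class G \<alpha>) g h * (SOME \<gamma>. \<gamma> \<in> cocycle_class G \<beta>) g h))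
      \<in> cohomologous G"
    by (intro cohomologous_mult) auto
  from equiv_class_eq[OF equiv_cohomologous this] show ?thesis by (simp add: H2_def)
qed

lemma mult_mem_class:
  assumes "C \<in> carrier (H2 G F)" "D \<in> carrier (H2 G F)" "\<alpha> \<in> C" "\<beta> \<in> D"
  shows "(\<lambda>g h. \<alpha> g h * \<beta> g h) \<in> C \<otimes>\<^bsub>H2 G F\<^esub> D"
proof -
  note \<alpha> = class_eq_of_mem[OF assms(1,3)] and \<beta> = class_eq_of_mem[OF assms(2,4)]
  show ?thesis unfolding \<alpha>(2) \<beta>(2) class_mult[OF \<alpha>(1) \<beta>(1)]
    by (intro class_self cocycles_mult \<alpha> \<beta>)
qed

lemma H2_mult_closed:
  assumes "C \<in> carrier (H2 G F)" "D \<in> carrier (H2 G F)"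
  shows "C \<otimes>\<^bsub>H2 G F\<^esub> D \<in> carrier (H2 G F)"
proof -
  obtain \<alpha> \<beta> where *: "\<alpha> \<in> cocycles G" "C = cocycle_class G \<alpha>" "\<beta> \<in> cocycles G" "D = cocycle_class G \<beta>"
    using assms unfolding carrier_H2 by blast
  show ?thesis unfolding * class_mult[OF *(1,3)] carrier_H2 using cocycles_mult[OF *(1,3)] by blast
qed

text \<open>Coboundaries are symmetric because \<open>g \<otimes> h = h \<otimes> g\<close>, so they
  cancel in the quotient.\<close>

lemma commutator_form_cong:
  assumes "(\<alpha>, \<beta>) \<in> cohomologous G"
  shows "commutator_form G \<alpha> = commutator_form G \<beta>"
proof -
  obtain c where c: "\<alpha> \<in> cocycles G" "\<beta> \<in> cocycles G" "\<And>g. g \<in> carrier G \<Longrightarrow> c g \<noteq> 0"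
    "\<And>g h. g \<in> carrier G \<Longrightarrow> h \<in> carrier G \<Longrightarrow> \<beta> g h = \<alpha> g h * c g * c h / c (g \<otimes> h)"
    using assms by (erule cohomologousE)
  have "\<beta> g h / \<beta> h g = \<alpha> g h / \<alpha> h g" if "g \<in> carrier G" "h \<in> carrier G" for g h
    using that by (simp add: c(3,4) cocycles_nonzero[OF c(1)] m_comm[of h g] field_simps)
  thus ?thesis by (auto simp: commutator_form_def fun_eq_iff)
qed

lemma commutator_form_class:
  assumes "C \<in> carrier (H2 G F)" "\<alpha> \<in> C" "\<beta> \<in> C"
  shows "commutator_form G \<alpha> = commutator_form G \<beta>"
  using class_eq_of_mem[OF assms(1,2)] assms(3) by (intro commutator_form_cong) auto

text \<open>Multiplicativity in the first argument combines the cocycle identities for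
  \<open>(g, h, k)\<close>, \<open>(g, k, h)\<close> and \<open>(k, g, h)\<close>; inverting gives
  the second argument.\<close>

lemma commutator_form_alternating:
  assumes \<alpha>: "\<alpha> \<in> cocycles G"
  shows "commutator_form G \<alpha> \<in> alternating_bicharacters G (UNIV - {0})"
proof -
  have co: "\<alpha> g h * \<alpha> (g \<otimes> h) k = \<alpha> h k * \<alpha> g (h \<otimes> k)"
    if "g \<in> carrier G" "h \<in> carrier G" "k \<in> carrier G" for g h k
    using \<alpha> that by (simp add: cocycles_def)
  note nz = cocycles_nonzero[OF \<alpha>]
  have m1: "\<alpha> (g \<otimes> h) k / \<alpha> k (g \<otimes> h) = (\<alpha> g k / \<alpha> k g) * (\<alpha> h k / \<alpha> k h)"
    if c: "g \<in> carrier G" "h \<in> carrier G" "k \<in> carrier G" for g h k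
  proof -
    have 1: "\<alpha> g h * \<alpha> (g \<otimes> h) k = \<alpha> h k * \<alpha> g (h \<otimes> k)"
      and 2: "\<alpha> g k * \<alpha> (g \<otimes> k) h = \<alpha> k h * \<alpha> g (h \<otimes> k)"
      and 3: "\<alpha> k g * \<alpha> (g \<otimes> k) h = \<alpha> g h * \<alpha> k (g \<otimes> h)"
      using co[of g h k] co[of g k h] co[of k g h] c by (simp_all add: m_comm[of k h] m_comm[of k g])
    have n: "\<alpha> g h \<noteq> 0" "\<alpha> g (h \<otimes> k) \<noteq> 0" "\<alpha> (g \<otimes> k) h \<noteq> 0" "\<alpha> k (g \<otimes> h) \<noteq> 0" "\<alpha> k g \<noteq> 0" "\<alpha> k h \<noteq> 0"
      using c nz by simp_all
    have e1: "\<alpha> (g \<otimes> h) k = \<alpha> h k * \<alpha> g (h \<otimes> k) / \<alpha> g h" using 1 n by (simp add: field_simps)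
    have e2: "\<alpha> k (g \<otimes> h) = \<alpha> k g * \<alpha> (g \<otimes> k) h / \<alpha> g h" using 3 n by (simp add: field_simps)
    have e3: "\<alpha> g k = \<alpha> k h * \<alpha> g (h \<otimes> k) / \<alpha> (g \<otimes> k) h" using 2 n by (simp add: field_simps)
    show ?thesis unfolding e1 e2 e3 using n by (simp add: field_simps)
  qed
  have m2: "\<alpha> k (g \<otimes> h) / \<alpha> (g \<otimes> h) k = (\<alpha> k g / \<alpha> g k) * (\<alpha> k h / \<alpha> h k)"
    if c: "g \<in> carrier G" "h \<in> carrier G" "k \<in> carrier G" for g h k
    using arg_cong[OF m1[OF c], of inverse] by simp
  show ?thesis unfolding alternating_bicharacters_def bicharacters_def
  proof (intro CollectI conjI ballI)
    show "commutator_form G \<alpha> \<in> carrier G \<rightarrow>\<^sub>E carrier G \<rightarrow>\<^sub>E UNIV - {0}"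
      using nz by (auto simp: commutator_form_def)
  qed (use m1 m2 nz in \<open>auto simp: commutator_form_def\<close>)
qed

lemma commutator_form_mult:
  "g \<in> carrier G \<Longrightarrow> h \<in> carrier G \<Longrightarrow>
    commutator_form G (\<lambda>g h. \<alpha> g h * \<beta> g h) g h = commutator_form G \<alpha> g h * commutator_form G \<beta> g h"
  by (simp add: commutator_form_def)

text \<open>Comparing \<open>u_g u_h\<close> with \<open>u_h u_g\<close> gives symmetry of
  \<open>\<alpha>\<close>; conversely, for symmetric \<open>\<alpha>\<close> swapping the pairs in
  the sum for a coefficient exchanges the factors.\<close>

lemma commutative_iff_symmetric:
  fixes \<alpha> :: "'g \<Rightarrow> 'g \<Rightarrow> 'f::field"
  assumes \<alpha>: "\<alpha> \<in> cocycles G"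
  shows "(\<forall>x\<in>carrier (twisted_group_algebra G \<alpha>). \<forall>y\<in>carrier (twisted_group_algebra G \<alpha>).
      x \<otimes>\<^bsub>twisted_group_algebra G \<alpha>\<^esub> y = y \<otimes>\<^bsub>twisted_group_algebra G \<alpha>\<^esub> x) \<longleftrightarrow>
    (\<forall>g\<in>carrier G. \<forall>h\<in>carrier G. commutator_form G \<alpha> g h = 1)" (is "?L \<longleftrightarrow> ?R")
proof
  assume L: ?L
  show ?R
  proof (intro ballI)
    fix g h assume gh: "g \<in> carrier G" "h \<in> carrier G"
    have "algebra_basis G g 1 \<otimes>\<^bsub>twisted_group_algebra G \<alpha>\<^esub> algebra_basis G h 1 =
      algebra_basis G h 1 \<otimes>\<^bsub>twisted_group_algebra G \<alpha>\<^esub> algebra_basis G g (1::'f)"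
      using L by (auto simp: twisted_group_algebra_simps algebra_basis_def)
    hence "algebra_basis G (g \<otimes> h) (\<alpha> g h) = algebra_basis G (h \<otimes> g) (\<alpha> h g)"
      using gh by (simp add: basis_mult)
    hence "algebra_basis G (g \<otimes> h) (\<alpha> g h) (g \<otimes> h) = algebra_basis G (h \<otimes> g) (\<alpha> h g) (g \<otimes> h)" by simp
    hence "\<alpha> g h = \<alpha> h g" using gh by (simp add: algebra_basis_def m_comm[of h g])
    thus "commutator_form G \<alpha> g h = 1" using gh cocycles_nonzero[OF \<alpha>] by (simp add: commutator_form_def)
  qed
next
  assume R: ?R
  have sym: "\<alpha> g h = \<alpha> h g" if "g \<in> carrier G" "h \<in> carrier G" for g h
    using R that cocycles_nonzero[OF \<alpha>] by (auto simp: commutator_form_def)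
  show ?L
  proof (intro ballI)
    fix x y :: "'g \<Rightarrow> 'f"
    have "(\<Sum>(g, h)\<in>{p \<in> carrier G \<times> carrier G. fst p \<otimes> snd p = k}. x g * y h * \<alpha> g h) =
      (\<Sum>(g, h)\<in>{p \<in> carrier G \<times> carrier G. fst p \<otimes> snd p = k}. y g * x h * \<alpha> g h)" for k
      by (rule sum.reindex_bij_witness[where i = prod.swap and j = prod.swap])
         (auto simp: m_comm sym)
    thus "x \<otimes>\<^bsub>twisted_group_algebra G \<alpha>\<^esub> y = y \<otimes>\<^bsub>twisted_group_algebra G \<alpha>\<^esub> x"
      by (simp add: twisted_group_algebra_mult)
  qed
qed

end

section \<open>Consequences of an equivalence for commutator forms and group algebras\<close>

lemma ring_iso_commutative:
  assumes h: "h \<in> ring_iso R S" and cl: "\<And>x y. x \<in> carrier R \<Longrightarrow> y \<in> carrier R \<Longrightarrow> x \<otimes>\<^bsub>R\<^esub> y \<in> carrier R"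
    and comm: "\<forall>x\<in>carrier S. \<forall>y\<in>carrier S. x \<otimes>\<^bsub>S\<^esub> y = y \<otimes>\<^bsub>S\<^esub> x"
  shows "\<forall>x\<in>carrier R. \<forall>y\<in>carrier R. x \<otimes>\<^bsub>R\<^esub> y = y \<otimes>\<^bsub>R\<^esub> x"
proof (intro ballI)
  fix x y assume xy: "x \<in> carrier R" "y \<in> carrier R"
  have inj: "inj_on h (carrier R)" using h by (simp add: ring_iso_def bij_betw_def)
  have hc: "h z \<in> carrier S" if "z \<in> carrier R" for z using h that by (auto simp: ring_iso_def ring_hom_def)
  have hm: "h (x \<otimes>\<^bsub>R\<^esub> y) = h x \<otimes>\<^bsub>S\<^esub> h y" if "x \<in> carrier R" "y \<in> carrier R" for x y
    using h that by (auto simp: ring_iso_def ring_hom_def)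
  have "h (x \<otimes>\<^bsub>R\<^esub> y) = h (y \<otimes>\<^bsub>R\<^esub> x)"
    using comm hc[OF xy(1)] hc[OF xy(2)] by (simp add: hm xy)
  thus "x \<otimes>\<^bsub>R\<^esub> y = y \<otimes>\<^bsub>R\<^esub> x" by (rule inj_onD[OF inj]) (use cl xy in auto)
qed

lemma twisted_algebra_closed:
  "x \<in> carrier (twisted_group_algebra G \<alpha>) \<Longrightarrow> y \<in> carrier (twisted_group_algebra G \<alpha>) \<Longrightarrow>
    x \<otimes>\<^bsub>twisted_group_algebra G \<alpha>\<^esub> y \<in> carrier (twisted_group_algebra G \<alpha>) \<and>
    x \<oplus>\<^bsub>twisted_group_algebra G \<alpha>\<^esub> y \<in> carrier (twisted_group_algebra G \<alpha>)"
  "\<one>\<^bsub>twisted_group_algebra G \<alpha>\<^esub> \<in> carrier (twisted_group_algebra G \<alpha>)"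
  by (simp_all add: twisted_group_algebra_def)

text \<open>Lets an inequality between the numbers of forms on \<open>G\<close> and \<open>H\<close>
  be used in both directions.\<close>

lemma twisted_equiv_sym:
  assumes G: "finite_comm_group G" and H: "finite_comm_group H" and eq: "twisted_equiv TYPE('f::field) G H"
  shows "twisted_equiv TYPE('f) H G"
proof -
  let ?HG = "H2 G TYPE('f)" and ?HH = "H2 H TYPE('f)"
  obtain \<psi> where \<psi>: "\<psi> \<in> iso ?HG ?HH"
    "\<And>C \<alpha> \<beta>. C \<in> carrier ?HG \<Longrightarrow> \<alpha> \<in> C \<Longrightarrow> \<beta> \<in> \<psi> C \<Longrightarrow>
       twisted_group_algebra G \<alpha> \<simeq> twisted_group_algebra H \<beta>"
    using eq unfolding twisted_equiv_def by blast
  have bij: "bij_betw \<psi> (carrier ?HG) (carrier ?HH)" and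
    hom: "\<And>C D. C \<in> carrier ?HG \<Longrightarrow> D \<in> carrier ?HG \<Longrightarrow> \<psi> (C \<otimes>\<^bsub>?HG\<^esub> D) = \<psi> C \<otimes>\<^bsub>?HH\<^esub> \<psi> D"
    using \<psi>(1) by (auto simp: iso_def hom_def)
  let ?k = "inv_into (carrier ?HG) \<psi>"
  have k: "?k D \<in> carrier ?HG" "\<psi> (?k D) = D" if "D \<in> carrier ?HH" for D
    using that bij by (auto simp: bij_betw_def inv_into_into f_inv_into_f)
  have k\<psi>: "?k (\<psi> C) = C" if "C \<in> carrier ?HG" for C
    using that bij by (auto simp: bij_betw_def inv_into_f_f)
  have "?k \<in> iso ?HH ?HG" unfolding iso_def hom_def
  proof (intro CollectI conjI ballI)
    show "bij_betw ?k (carrier ?HH) (carrier ?HG)" by (rule bij_betw_inv_into[OF bij])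
    fix C D assume CD: "C \<in> carrier ?HH" "D \<in> carrier ?HH"
    have c: "?k C \<otimes>\<^bsub>?HG\<^esub> ?k D \<in> carrier ?HG"
      by (intro finite_comm_group.H2_mult_closed[OF G] k CD)
    show "?k (C \<otimes>\<^bsub>?HH\<^esub> D) = ?k C \<otimes>\<^bsub>?HG\<^esub> ?k D"
      using k\<psi>[OF c] hom[OF k(1)[OF CD(1)] k(1)[OF CD(2)]] k(2)[OF CD(1)] k(2)[OF CD(2)] by simp
  qed (use k in auto)
  moreover have "twisted_group_algebra H \<beta> \<simeq> twisted_group_algebra G \<alpha>"
    if "D \<in> carrier ?HH" "\<beta> \<in> D" "\<alpha> \<in> ?k D" for D \<alpha> \<beta>
  proof -
    have "twisted_group_algebra G \<alpha> \<simeq> twisted_group_algebra H \<beta>"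
      using \<psi>(2)[of "?k D" \<alpha> \<beta>] k[OF that(1)] that by simp
    then obtain h where "h \<in> ring_iso (twisted_group_algebra G \<alpha>) (twisted_group_algebra H \<beta>)"
      by (auto simp: is_ring_iso_def)
    from ring_iso_inv_into[OF this twisted_algebra_closed] show ?thesis by (auto simp: is_ring_iso_def)
  qed
  ultimately show ?thesis unfolding twisted_equiv_def by blast
qed

locale twisted_equivalence = G: finite_comm_group G + H: finite_comm_group H
  for G :: "'g monoid" and H :: "'h monoid" +
  fixes F :: "'f::field itself" and \<psi> :: "('g \<Rightarrow> 'g \<Rightarrow> 'f) set \<Rightarrow> ('h \<Rightarrow> 'h \<Rightarrow> 'f) set"
  assumes \<psi>: "\<psi> \<in> iso (H2 G F) (H2 H F)"
    and algebras: "\<And>C \<alpha> \<beta>. C \<in> carrier (H2 G F) \<Longrightarrow> \<alpha> \<in> C \<Longrightarrow> \<beta> \<in> \<psi> C \<Longrightarrow>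
       twisted_group_algebra G \<alpha> \<simeq> twisted_group_algebra H \<beta>"
begin

lemma \<psi>_closed: "C \<in> carrier (H2 G F) \<Longrightarrow> \<psi> C \<in> carrier (H2 H F)"
  using \<psi> by (auto simp: iso_def hom_def)

lemma \<psi>_mult:
  "C \<in> carrier (H2 G F) \<Longrightarrow> D \<in> carrier (H2 G F) \<Longrightarrow> \<psi> (C \<otimes>\<^bsub>H2 G F\<^esub> D) = \<psi> C \<otimes>\<^bsub>H2 H F\<^esub> \<psi> D"
  using \<psi> by (auto simp: iso_def hom_def)

text \<open>A representative of the image class. It depends only on the class of
  \<open>\<alpha>\<close>, so cohomologous cocycles have equal images.\<close>

definition image_cocycle :: "('g \<Rightarrow> 'g \<Rightarrow> 'f) \<Rightarrow> ('h \<Rightarrow> 'h \<Rightarrow> 'f)" where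
  "image_cocycle \<alpha> = (SOME \<beta>. \<beta> \<in> \<psi> (cocycle_class G \<alpha>))"

lemma class_closed: "\<alpha> \<in> cocycles G \<Longrightarrow> cocycle_class G \<alpha> \<in> carrier (H2 G F)"
  by (auto simp: G.carrier_H2)

lemma image_cocycle:
  assumes "\<alpha> \<in> cocycles G"
  shows "image_cocycle \<alpha> \<in> \<psi> (cocycle_class G \<alpha>)" "image_cocycle \<alpha> \<in> cocycles H"
    "\<psi> (cocycle_class G \<alpha>) = cocycle_class H (image_cocycle \<alpha>)"
proof -
  note c = \<psi>_closed[OF class_closed[OF assms]]
  obtain \<beta> where "\<beta> \<in> cocycles H" "\<psi> (cocycle_class G \<alpha>) = cocycle_class H \<beta>"
    using c by (auto simp: H.carrier_H2)
  hence "\<beta> \<in> \<psi> (cocycle_class G \<alpha>)" using H.class_self by auto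
  thus m: "image_cocycle \<alpha> \<in> \<psi> (cocycle_class G \<alpha>)"
    unfolding image_cocycle_def by (rule someI[of "\<lambda>\<beta>. \<beta> \<in> \<psi> (cocycle_class G \<alpha>)"])
  show "image_cocycle \<alpha> \<in> cocycles H" "\<psi> (cocycle_class G \<alpha>) = cocycle_class H (image_cocycle \<alpha>)"
    using H.class_eq_of_mem[OF c m] by auto
qed

text \<open>The choice of representatives need not respect products, but \<open>\<psi>\<close> does
  on classes, and commutator forms depend on classes only.\<close>

lemma commutator_form_image_mult:
  assumes \<alpha>: "\<alpha> \<in> cocycles G" and \<beta>: "\<beta> \<in> cocycles G" and g: "g \<in> carrier H" and h: "h \<in> carrier H"
  shows "commutator_form H (image_cocycle (\<lambda>g h. \<alpha> g h * \<beta> g h)) g h =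
    commutator_form H (image_cocycle \<alpha>) g h * commutator_form H (image_cocycle \<beta>) g h"
proof -
  let ?\<gamma> = "\<lambda>g h. \<alpha> g h * \<beta> g h"
  have \<gamma>: "?\<gamma> \<in> cocycles G" by (intro cocycles_mult \<alpha> \<beta>)
  have "\<psi> (cocycle_class G ?\<gamma>) = \<psi> (cocycle_class G \<alpha>) \<otimes>\<^bsub>H2 H F\<^esub> \<psi> (cocycle_class G \<beta>)"
    by (simp add: \<psi>_mult class_closed \<alpha> \<beta> flip: G.class_mult[OF \<alpha> \<beta>, where F = F])
  hence "(\<lambda>g h. image_cocycle \<alpha> g h * image_cocycle \<beta> g h) \<in> \<psi> (cocycle_class G ?\<gamma>)"
    using H.mult_mem_class[OF \<psi>_closed[OF class_closed[OF \<alpha>]] \<psi>_closed[OF class_closed[OF \<beta>]]]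
      image_cocycle(1)[OF \<alpha>] image_cocycle(1)[OF \<beta>] by simp
  hence "commutator_form H (image_cocycle ?\<gamma>) =
      commutator_form H (\<lambda>g h. image_cocycle \<alpha> g h * image_cocycle \<beta> g h)"
    by (intro H.commutator_form_class[OF \<psi>_closed[OF class_closed[OF \<gamma>]]] image_cocycle(1)[OF \<gamma>])
  thus ?thesis using H.commutator_form_mult[OF g h] by simp
qed

text \<open>Each side expresses commutativity of one of two isomorphic twisted group
  algebras.\<close>

lemma trivial_commutator_form_iff:
  assumes \<alpha>: "\<alpha> \<in> cocycles G"
  shows "(\<forall>g\<in>carrier G. \<forall>h\<in>carrier G. commutator_form G \<alpha> g h = 1) \<longleftrightarrow>
    (\<forall>g\<in>carrier H. \<forall>h\<in>carrier H. commutator_form H (image_cocycle \<alpha>) g h = 1)"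
proof -
  obtain f where f: "f \<in> ring_iso (twisted_group_algebra G \<alpha>) (twisted_group_algebra H (image_cocycle \<alpha>))"
    using algebras[OF class_closed[OF \<alpha>] G.class_self[OF \<alpha>] image_cocycle(1)[OF \<alpha>]]
    by (auto simp: is_ring_iso_def)
  have f': "inv_into (carrier (twisted_group_algebra G \<alpha>)) f \<in>
      ring_iso (twisted_group_algebra H (image_cocycle \<alpha>)) (twisted_group_algebra G \<alpha>)"
    by (rule ring_iso_inv_into[OF f]) (erule (1) twisted_algebra_closed(1), rule twisted_algebra_closed(2))
  have "(\<forall>x\<in>carrier (twisted_group_algebra G \<alpha>). \<forall>y\<in>carrier (twisted_group_algebra G \<alpha>).
      x \<otimes>\<^bsub>twisted_group_algebra G \<alpha>\<^esub> y = y \<otimes>\<^bsub>twisted_group_algebra G \<alpha>\<^esub> x) \<longleftrightarrow>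
    (\<forall>x\<in>carrier (twisted_group_algebra H (image_cocycle \<alpha>)).
      \<forall>y\<in>carrier (twisted_group_algebra H (image_cocycle \<alpha>)).
      x \<otimes>\<^bsub>twisted_group_algebra H (image_cocycle \<alpha>)\<^esub> y = y \<otimes>\<^bsub>twisted_group_algebra H (image_cocycle \<alpha>)\<^esub> x)" (is "?L \<longleftrightarrow> ?R")
  proof
    assume ?L
    show ?R by (rule ring_iso_commutative[OF f' _ \<open>?L\<close>]) (rule twisted_algebra_closed(1)[THEN conjunct1])
  next
    assume ?R
    show ?L by (rule ring_iso_commutative[OF f _ \<open>?R\<close>]) (rule twisted_algebra_closed(1)[THEN conjunct1])
  qed
  thus ?thesis
    unfolding G.commutative_iff_symmetric[OF \<alpha>] H.commutative_iff_symmetric[OF image_cocycle(2)[OF \<alpha>]] .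
qed

text \<open>Lift \<open>b\<close> to a cocycle with values in the \<open>q\<close>-th roots of unity
  \<open>U\<close> and take the commutator form of its image. The resulting map
  \<open>\<theta>\<close> stays within forms with values in \<open>U\<close> and is injective,
  because products and the triviality of commutator forms are preserved.\<close>

lemma card_alternating_le:
  assumes q: "0 < q"
  defines "U \<equiv> {z \<in> UNIV - {0::'f}. z ^ q = 1}"
  assumes fin: "finite (alternating_bicharacters H U)"
  shows "card (alternating_bicharacters G U) \<le> card (alternating_bicharacters H U)"
proof -
  have U: "mult_subgroup U" unfolding U_def by (rule mult_subgroup_roots[OF mult_subgroup_UNIV q])
  obtain ns where ns: "decomposition G ns" by (rule G.exists_decomposition_self)
  define lift where "lift b = (SOME \<alpha>. \<alpha> \<in> bicharacters G U \<and> (\<forall>g\<in>carrier G. \<forall>h\<in>carrier G. b g h * \<alpha> h g = \<alpha> g h))" for b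
  have lift: "lift b \<in> bicharacters G U" "\<And>g h. g \<in> carrier G \<Longrightarrow> h \<in> carrier G \<Longrightarrow> b g h * lift b h g = lift b g h"
    if "b \<in> alternating_bicharacters G U" for b
    using someI_ex[of "\<lambda>\<alpha>. \<alpha> \<in> bicharacters G U \<and> (\<forall>g\<in>carrier G. \<forall>h\<in>carrier G. b g h * \<alpha> h g = \<alpha> g h)"]
      alternating_lift[OF ns U that] unfolding lift_def by blast+
  have liftc: "lift b \<in> cocycles G" if "b \<in> alternating_bicharacters G U" for b
    using bicharacters_cocycles[OF U lift(1)[OF that]] .
  have lift_comm: "commutator_form G (lift b) g h = b g h"
    if "b \<in> alternating_bicharacters G U" "g \<in> carrier G" "h \<in> carrier G" for b g h
    using lift(2)[OF that] cocycles_nonzero[OF liftc[OF that(1)] that(3,2)] that(2,3)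
    by (simp add: commutator_form_def field_simps)
  define \<theta> where "\<theta> b = commutator_form H (image_cocycle (lift b))" for b
  have "\<theta> b \<in> alternating_bicharacters H U" if b: "b \<in> alternating_bicharacters G U" for b
  proof -
    let ?\<alpha> = "lift b"
    have alt: "\<theta> b \<in> alternating_bicharacters H (UNIV - {0})"
      unfolding \<theta>_def by (rule H.commutator_form_alternating[OF image_cocycle(2)[OF liftc[OF b]]])
    \<comment> \<open>The induction starts at exponent one, where the claim is the definition of
      \<open>\<theta>\<close>.\<close>
    have pow: "commutator_form H (image_cocycle (\<lambda>g h. ?\<alpha> g h ^ Suc n)) g h = \<theta> b g h ^ Suc n"
      if "g \<in> carrier H" "h \<in> carrier H" for n g h
    proof (induction n)
      case (Suc n)
      have "commutator_form H (image_cocycle (\<lambda>g h. ?\<alpha> g h * ?\<alpha> g h ^ Suc n)) g h =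
        commutator_form H (image_cocycle ?\<alpha>) g h * commutator_form H (image_cocycle (\<lambda>g h. ?\<alpha> g h ^ Suc n)) g h"
        by (intro commutator_form_image_mult that liftc b cocycles_power)
      thus ?case using Suc by (simp add: \<theta>_def)
    qed (simp add: \<theta>_def)
    have "\<theta> b g h ^ q = 1" if gh: "g \<in> carrier H" "h \<in> carrier H" for g h
    proof -
      have q': "Suc (q - 1) = q" using q by simp
      \<comment> \<open>The lift takes values in \<open>U\<close>, so its \<open>q\<close>-th power
        is one on the carrier; the triviality of the commutator form of this power carries over to
        \<open>H\<close>.\<close>
      have "?\<alpha> g h \<in> U" if "g \<in> carrier G" "h \<in> carrier G" for g h
        using lift(1)[OF b] that by (auto simp: bicharacters_def PiE_iff)
      hence "\<forall>g\<in>carrier G. \<forall>h\<in>carrier G. commutator_form G (\<lambda>g h. ?\<alpha> g h ^ q) g h = 1"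
        by (simp add: commutator_form_def U_def)
      hence "\<forall>g\<in>carrier H. \<forall>h\<in>carrier H. commutator_form H (image_cocycle (\<lambda>g h. ?\<alpha> g h ^ q)) g h = 1"
        using trivial_commutator_form_iff[OF cocycles_power[OF liftc[OF b], of q]] by blast
      thus ?thesis using pow[OF gh, of "q - 1", unfolded q'] gh by simp
    qed
    thus ?thesis using alt by (auto simp: alternating_bicharacters_def bicharacters_def PiE_iff U_def)
  qed
  moreover have "inj_on \<theta> (alternating_bicharacters G U)"
  proof (rule inj_onI)
    fix b b' assume b: "b \<in> alternating_bicharacters G U" and b': "b' \<in> alternating_bicharacters G U"
      and eq: "\<theta> b = \<theta> b'"
    define \<gamma> where "\<gamma> = (\<lambda>g h. lift b g h * inverse (lift b' g h))"
    have \<gamma>: "\<gamma> \<in> cocycles G" unfolding \<gamma>_def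
      by (rule cocycles_mult[OF liftc[OF b] cocycles_inverse[OF liftc[OF b']]])
    define \<delta> where "\<delta> = (\<lambda>g h. \<gamma> g h * lift b' g h)"
    have \<delta>: "\<delta> \<in> cocycles G" unfolding \<delta>_def by (rule cocycles_mult[OF \<gamma> liftc[OF b']])
    \<comment> \<open>\<open>\<delta>\<close> agrees with \<open>lift b\<close> on the carrier, but
      perhaps not outside it, hence the detour through classes.\<close>
    have "(lift b, \<delta>) \<in> cohomologous G"
      by (rule cohomologousI[where c = "\<lambda>_. 1"])
         (use liftc[OF b] \<delta> cocycles_nonzero[OF liftc[OF b']] in \<open>auto simp: \<delta>_def \<gamma>_def\<close>)
    hence "cocycle_class G (lift b) = cocycle_class G \<delta>"
      by (rule equiv_class_eq[OF G.equiv_cohomologous])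
    hence i: "image_cocycle (lift b) = image_cocycle \<delta>" by (simp add: image_cocycle_def)
    have "commutator_form H (image_cocycle \<gamma>) g h = 1" if gh: "g \<in> carrier H" "h \<in> carrier H" for g h
    proof -
      have "\<theta> b g h = commutator_form H (image_cocycle \<gamma>) g h * \<theta> b' g h"
        unfolding \<theta>_def i unfolding \<delta>_def by (rule commutator_form_image_mult[OF \<gamma> liftc[OF b'] gh])
      moreover have "\<theta> b' g h \<noteq> 0"
        using gh cocycles_nonzero[OF image_cocycle(2)[OF liftc[OF b']]] by (simp add: \<theta>_def commutator_form_def)
      ultimately show ?thesis using eq by simp
    qed
    hence 1: "\<forall>g\<in>carrier G. \<forall>h\<in>carrier G. commutator_form G \<gamma> g h = 1"
      using trivial_commutator_form_iff[OF \<gamma>] by blast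
    have "b g h = b' g h" if gh: "g \<in> carrier G" "h \<in> carrier G" for g h
    proof -
      have "1 = commutator_form G \<gamma> g h" using 1 gh by simp
      also have "\<dots> = commutator_form G (lift b) g h * commutator_form G (\<lambda>g h. inverse (lift b' g h)) g h"
        unfolding \<gamma>_def by (rule G.commutator_form_mult[OF gh])
      also have "commutator_form G (\<lambda>g h. inverse (lift b' g h)) g h = inverse (commutator_form G (lift b') g h)"
        using gh by (simp add: commutator_form_def field_simps)
      finally have "1 = b g h * inverse (b' g h)" using gh b b' by (simp add: lift_comm)
      thus ?thesis by (metis inverse_unique inverse_inverse_eq mult.commute)
    qed
    moreover have "b g = b' g" if "g \<notin> carrier G" for g
      using b b' that by (auto simp: alternating_bicharacters_def bicharacters_def PiE_iff extensional_def)
    moreover have "b g h = b' g h" if "g \<in> carrier G" "h \<notin> carrier G" for g h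
      using b b' that by (auto simp: alternating_bicharacters_def bicharacters_def PiE_iff extensional_def)
    ultimately show "b = b'" by (metis ext)
  qed
  ultimately show ?thesis using fin by (intro card_inj_on_le[of \<theta>]) auto
qed

text \<open>The trivial class is idempotent, and therefore so is its image: the square of
  \<open>?\<beta>\<close> differs from \<open>?\<beta>\<close> by a coboundary. Cancelling
  \<open>?\<beta>\<close> shows that it is a coboundary itself, so the trivial cocycle of
  \<open>H\<close> lies in the image class.\<close>

lemma group_algebras_isomorphic:
  "(group_algebra G :: ('g \<Rightarrow> 'f) ring) \<simeq> (group_algebra H :: ('h \<Rightarrow> 'f) ring)"
proof -
  let ?one = "\<lambda>_ _. 1 :: 'f"
  let ?\<beta> = "image_cocycle ?one"
  have 1: "?one \<in> cocycles G" by (rule cocycles_one)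
  note \<beta> = image_cocycle[OF 1]
  note c = \<psi>_closed[OF class_closed[OF 1]]
  have "\<psi> (cocycle_class G ?one) \<otimes>\<^bsub>H2 H F\<^esub> \<psi> (cocycle_class G ?one) = \<psi> (cocycle_class G ?one)"
    using \<psi>_mult[OF class_closed[OF 1] class_closed[OF 1]] G.class_mult[OF 1 1, where F = F] by simp
  hence "(\<lambda>g h. ?\<beta> g h * ?\<beta> g h) \<in> cocycle_class H ?\<beta>"
    using H.mult_mem_class[OF c c \<beta>(1) \<beta>(1)] \<beta>(3) by simp
  hence "(?\<beta>, (\<lambda>g h. ?\<beta> g h * ?\<beta> g h)) \<in> cohomologous H" by simp
  then obtain d where d: "\<And>g. g \<in> carrier H \<Longrightarrow> d g \<noteq> 0"
    "\<And>g h. g \<in> carrier H \<Longrightarrow> h \<in> carrier H \<Longrightarrow> ?\<beta> g h * ?\<beta> g h = ?\<beta> g h * d g * d h / d (g \<otimes>\<^bsub>H\<^esub> h)"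
    unfolding cohomologous_def by blast
  have "((\<lambda>_ _. 1), ?\<beta>) \<in> cohomologous H"
  proof (rule cohomologousI[where c = d])
    fix g h assume gh: "g \<in> carrier H" "h \<in> carrier H"
    have "?\<beta> g h * ?\<beta> g h = ?\<beta> g h * (1 * d g * d h / d (g \<otimes>\<^bsub>H\<^esub> h))" using d(2)[OF gh] by simp
    thus "?\<beta> g h = 1 * d g * d h / d (g \<otimes>\<^bsub>H\<^esub> h)"
      using cocycles_nonzero[OF \<beta>(2) gh] by (simp only: mult_cancel_left) simp
  qed (use d \<beta> cocycles_one in auto)
  hence "(\<lambda>_ _. 1) \<in> \<psi> (cocycle_class G ?one)"
    using \<beta>(3) H.equiv_cohomologous by (auto simp: equiv_def sym_def)
  thus ?thesis by (intro algebras[OF class_closed[OF 1] G.class_self[OF 1]])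
qed

end

section \<open>Recovering the invariant factors\<close>

text \<open>Raising the cut-off from \<open>k\<close> to \<open>Suc k\<close> adds the total weight
  of the indices whose entry reaches \<open>Suc k\<close>. By monotonicity these form an initial
  segment, and two initial segments of equal weight cannot differ at an index of positive
  weight.\<close>

lemma threshold_eq_of_weighted_sums:
  fixes a b w :: "nat \<Rightarrow> nat"
  assumes a: "antimono a" "\<And>j. j \<ge> N \<Longrightarrow> a j = 0" and b: "antimono b" "\<And>j. j \<ge> N \<Longrightarrow> b j = 0"
    and eq: "(\<Sum>j<N. w j * min (a j) k) = (\<Sum>j<N. w j * min (b j) k)"
      "(\<Sum>j<N. w j * min (a j) (Suc k)) = (\<Sum>j<N. w j * min (b j) (Suc k))"
    and w: "w j > 0"
  shows "Suc k \<le> a j \<longleftrightarrow> Suc k \<le> b j"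
proof -
  have step: "(\<Sum>j<N. w j * min (c j) (Suc k)) = (\<Sum>j<N. w j * min (c j) k) + (\<Sum>j<N. w j * of_bool (Suc k \<le> c j))"
    for c :: "nat \<Rightarrow> nat"
  proof -
    have "min (c j) (Suc k) = min (c j) k + of_bool (Suc k \<le> c j)" for j
      by (auto simp: min_def of_bool_def)
    thus ?thesis by (simp add: distrib_left sum.distrib)
  qed
  have count: "(\<Sum>j<N. w j * of_bool (Suc k \<le> a j)) = (\<Sum>j<N. w j * of_bool (Suc k \<le> b j))"
    using eq step[of a] step[of b] by simp
  have less: "(\<Sum>j<N. w j * of_bool (Suc k \<le> d j)) < (\<Sum>j<N. w j * of_bool (Suc k \<le> c j))"
    if c: "antimono c" "\<And>j. j \<ge> N \<Longrightarrow> c j = 0" "Suc k \<le> c j" and d: "antimono d" "\<not> Suc k \<le> d j" for c d :: "nat \<Rightarrow> nat"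
  proof (rule sum_strict_mono_ex1)
    show "\<forall>i\<in>{..<N}. w i * of_bool (Suc k \<le> d i) \<le> w i * of_bool (Suc k \<le> c i)"
    proof
      fix i
      have "Suc k \<le> c i" if "Suc k \<le> d i"
      proof -
        have "i \<le> j"
        proof (rule ccontr)
          assume "\<not> i \<le> j"
          hence "d i \<le> d j" using d(1) by (simp add: antimonoD)
          thus False using that d(2) by simp
        qed
        thus ?thesis using c(3) antimonoD[OF c(1)] le_trans by blast
      qed
      thus "w i * of_bool (Suc k \<le> d i) \<le> w i * of_bool (Suc k \<le> c i)" by (auto simp: of_bool_def)
    qed
    have "j < N" using c(2)[of j] c(3) by (cases "j < N") auto
    thus "\<exists>i\<in>{..<N}. w i * of_bool (Suc k \<le> d i) < w i * of_bool (Suc k \<le> c i)"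
      using c(3) d(2) w by (intro bexI[of _ j]) auto
  qed simp
  show ?thesis using less[OF a _ b(1)] less[OF b _ a(1)] count by fastforce
qed

text \<open>With weight \<open>j\<close>, \<open>alt\<close> decides all thresholds up to
  \<open>m\<close> except at index zero; \<open>trunc\<close> decides those from
  \<open>Suc m\<close> to \<open>a 0\<close> at every index. The entry at index zero and the absence
  of thresholds above \<open>a 0\<close> come from \<open>total\<close>, with \<open>trunc\<close>
  if \<open>m < a 0\<close>.\<close>

lemma antimono_eq_of_sums:
  fixes a b :: "nat \<Rightarrow> nat"
  assumes a: "antimono a" "\<And>j. j \<ge> N \<Longrightarrow> a j = 0" and b: "antimono b" "\<And>j. j \<ge> N \<Longrightarrow> b j = 0"
    and total: "(\<Sum>j<N. a j) = (\<Sum>j<N. b j)"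
    and alt: "\<And>k. k \<le> m \<Longrightarrow> (\<Sum>j<N. j * min (a j) k) = (\<Sum>j<N. j * min (b j) k)"
    and trunc: "\<And>k. m < a 0 \<Longrightarrow> m \<le> k \<Longrightarrow> k \<le> a 0 \<Longrightarrow> (\<Sum>j<N. min (a j) k) = (\<Sum>j<N. min (b j) k)"
    and m: "m \<le> a 0"
  shows "a = b"
proof -
  have a_le: "a j \<le> a 0" and b_le: "b j \<le> b 0" for j using a(1) b(1) by (auto intro: antimonoD)
  have low: "Suc k \<le> a j \<longleftrightarrow> Suc k \<le> b j" if "Suc k \<le> m" "j > 0" for j k
    using that by (intro threshold_eq_of_weighted_sums[OF a b, where w = id]) (auto intro: alt)
  have tail: "a j = b j" if "b 0 \<le> a 0" and th: "\<And>k. Suc k \<le> a 0 \<Longrightarrow> Suc k \<le> a j \<longleftrightarrow> Suc k \<le> b j" for j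
  proof -
    have "a j \<le> b j" using th[of "a j - 1"] a_le[of j] by (cases "a j") auto
    moreover have "b j \<le> a j" using th[of "b j - 1"] b_le[of j] that(1) by (cases "b j") auto
    ultimately show ?thesis by simp
  qed
  show ?thesis
  proof (cases "m < a 0")
    case True
    have high: "Suc k \<le> a j \<longleftrightarrow> Suc k \<le> b j" if "m \<le> k" "Suc k \<le> a 0" for j k
      using that True
      by (intro threshold_eq_of_weighted_sums[OF a b, where w = "\<lambda>_. 1"]) (auto intro: trunc)
    \<comment> \<open>Otherwise cutting off at \<open>a 0\<close> would lower the sum of
      \<open>b\<close> but not that of \<open>a\<close>, although both the full and the truncated
      sums agree.\<close>
    have "b 0 \<le> a 0"
    proof (rule ccontr)
      assume n: "\<not> b 0 \<le> a 0"
      hence "N > 0" using b(2)[of 0] by (cases N) auto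
      have "(\<Sum>j<N. min (b j) (a 0)) < (\<Sum>j<N. b j)"
        by (rule sum_strict_mono_ex1) (use n \<open>N > 0\<close> in \<open>auto intro!: bexI[of _ 0]\<close>)
      moreover have "(\<Sum>j<N. min (a j) (a 0)) = (\<Sum>j<N. a j)" using a_le by (simp add: min_absorb1)
      ultimately show False using trunc[OF True, of "a 0"] total m by simp
    qed
    moreover have "Suc k \<le> a j \<longleftrightarrow> Suc k \<le> b j" if k: "Suc k \<le> a 0" for j k
    proof (cases "m \<le> k")
      case False
      show ?thesis
      proof (cases "j > 0")
        case j: False
        \<comment> \<open>At index zero, where \<open>alt\<close> has weight zero, both sequences
          exceed \<open>m\<close> and thus pass every threshold up to \<open>m\<close>.\<close>
        have "Suc m \<le> b 0" using high[of m 0] True by simp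
        thus ?thesis using j k False by simp
      qed (use low False in simp)
    qed (use high k in simp)
    ultimately have "a j = b j" for j using tail by blast
    thus ?thesis by blast
  next
    case False
    hence ma: "m = a 0" using m by simp
    \<comment> \<open>Since \<open>m = a 0\<close>, the thresholds decided by \<open>alt\<close> are
      all that matter for \<open>a\<close> at positive indices. So \<open>a\<close> is bounded by
      \<open>b\<close> there, and \<open>total\<close> leaves no room for \<open>b 0\<close> above
      \<open>a 0\<close>.\<close>
    have le: "a j \<le> b j" if "j > 0" for j
      using low[of "a j - 1" j] that a_le[of j] ma by (cases "a j") auto
    have b0: "b 0 \<le> a 0"
    proof (cases N)
      case (Suc N')
      have "(\<Sum>j<N'. a (Suc j)) \<le> (\<Sum>j<N'. b (Suc j))" by (intro sum_mono le) auto
      thus ?thesis using total by (simp add: Suc sum.lessThan_Suc_shift del: sum.lessThan_Suc)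
    qed (use b(2) in auto)
    have pos: "a j = b j" if "j > 0" for j
      using that low ma by (intro tail b0) auto
    have "a 0 = b 0"
    proof (cases N)
      case (Suc N')
      thus ?thesis using total pos by (simp add: sum.lessThan_Suc_shift del: sum.lessThan_Suc)
    qed (use a(2) b(2) in auto)
    thus ?thesis using pos by (metis gr0I ext)
  qed
qed

text \<open>Padding with trivial factors, of multiplicity zero at every prime, allows lists of
  different lengths to be compared over one index range.\<close>

definition entry :: "nat list \<Rightarrow> nat \<Rightarrow> nat" where
  "entry ns j = (if j < length ns then ns ! j else 1)"

lemma entry_pos:
  assumes "\<forall>n\<in>set ns. n > 1"
  shows "entry ns j > 0"
proof (cases "j < length ns")
  case True
  hence "ns ! j > 1" using assms nth_mem by blast
  thus ?thesis using True by (simp add: entry_def)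
qed (simp add: entry_def)

text \<open>Genuine factors exceed one, so the padding is recognisable and the length can be read
  off.\<close>

lemma entry_inject:
  assumes "entry ns = entry ms" "\<forall>n\<in>set ns. n > 1" "\<forall>m\<in>set ms. m > 1"
  shows "ns = ms"
proof (rule nth_equalityI)
  have "length ns \<le> length ms" if "entry ns = entry ms" "\<forall>n\<in>set ns. n > 1" for ns ms
  proof (rule ccontr)
    assume l: "\<not> length ns \<le> length ms"
    hence "entry ns (length ms) > 1" using that(2) by (auto simp: entry_def)
    thus False using that(1) by (simp add: entry_def)
  qed
  from this[OF assms(1,2)] this[OF assms(1)[symmetric] assms(3)] show l: "length ns = length ms" by simp
  fix i assume "i < length ns"
  thus "ns ! i = ms ! i" using fun_cong[OF assms(1), of i] l by (simp add: entry_def)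
qed

lemma antimono_multiplicity_entry:
  assumes "sorted_wrt (\<lambda>a b. b dvd a) ns" "\<forall>n\<in>set ns. n > 1"
  shows "antimono (\<lambda>j. multiplicity p (entry ns j))"
proof (rule antimonoI)
  fix i j :: nat assume "i \<le> j"
  have "entry ns j dvd entry ns i"
    using assms(1) \<open>i \<le> j\<close> by (cases "i = j") (auto simp: entry_def sorted_wrt_iff_nth_less)
  moreover have "entry ns i \<noteq> 0" using entry_pos[OF assms(2)] by simp
  ultimately show "multiplicity p (entry ns j) \<le> multiplicity p (entry ns i)"
    by (rule dvd_imp_multiplicity_le)
qed

lemma sum_entry:
  assumes "length ns \<le> N" "f 1 = (0::nat)"
  shows "(\<Sum>j<N. w j * f (entry ns j)) = (\<Sum>j<length ns. w j * f (ns ! j))"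
  by (rule sum.mono_neutral_cong_right) (use assms in \<open>auto simp: entry_def\<close>)

lemma multiplicity_prod_list:
  assumes "Factorial_Ring.prime (p::nat)" "0 \<notin> set xs"
  shows "multiplicity p (prod_list xs) = (\<Sum>x\<leftarrow>xs. multiplicity p x)"
  using assms(2)
proof (induction xs)
  case (Cons x xs)
  thus ?case using assms(1) by (simp add: prime_elem_multiplicity_mult_distrib prod_list_zero_iff)
qed simp

text \<open>Counting from zero, the entry with index \<open>j\<close> is paired with the
  \<open>j\<close> entries before it, hence contributes \<open>j\<close> times.\<close>

lemma multiplicity_card_alternating:
  assumes p: "Factorial_Ring.prime (p::nat)" and f: "\<And>n. n \<in> set ns \<Longrightarrow> f n \<noteq> 0"
  shows "card_alternating f ns \<noteq> 0 \<and> multiplicity p (card_alternating f ns) = (\<Sum>j<length ns. j * multiplicity p (f (ns ! j)))"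
  using f
proof (induction ns)
  case (Cons n ns)
  have z: "0 \<notin> set (map f ns)" using Cons.prems by (metis image_iff list.set_intros(2) list.set_map)
  hence nz: "(\<Prod>m\<leftarrow>ns. f m) \<noteq> 0" by (simp add: prod_list_zero_iff)
  have "multiplicity p (\<Prod>m\<leftarrow>ns. f m) = (\<Sum>m\<leftarrow>ns. multiplicity p (f m))"
    using multiplicity_prod_list[OF p z] by (simp add: comp_def)
  also have "\<dots> = (\<Sum>j<length ns. multiplicity p (f (ns ! j)))"
    by (simp add: sum_list_sum_nth atLeast0LessThan)
  finally show ?case using Cons nz p
    by (simp add: prime_elem_multiplicity_mult_distrib sum.lessThan_Suc_shift sum.distrib del: sum.lessThan_Suc)
qed simp

lemma sum_list_entry:
  assumes "length ns \<le> N" "f 1 = (0::nat)"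
  shows "(\<Sum>n\<leftarrow>ns. f n) = (\<Sum>j<N. f (entry ns j))"
  using sum_entry[of ns N f "\<lambda>_. 1", OF assms] by (simp add: sum_list_sum_nth atLeast0LessThan)

lemma multiplicity_card_characters:
  assumes ns: "decomposition G ns" and p: "Factorial_Ring.prime p" and U: "mult_subgroup U"
    and prim: "\<exists>z\<in>U. primitive_root_of_unity (p ^ k) z" "\<not> (\<exists>z\<in>U. primitive_root_of_unity (p ^ (k + 1)) z)"
    and N: "length ns \<le> N"
  shows "multiplicity p (card (characters G U)) = (\<Sum>j<N. min (multiplicity p (entry ns j)) k)"
proof -
  have n0: "n > 0" if "n \<in> set ns" for n using decomposition_gt_1[OF ns] that by fastforce
  have c0: "card {z \<in> U. z ^ n = 1} \<noteq> 0" if "n \<in> set ns" for n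
    by (rule card_roots_nonzero[OF U n0[OF that]])
  have "multiplicity p (card (characters G U)) = (\<Sum>n\<leftarrow>ns. multiplicity p (card {z \<in> U. z ^ n = 1}))"
  proof -
    have "0 \<notin> set (map (\<lambda>n. card {z \<in> U. z ^ n = 1}) ns)" using c0 by (metis (no_types, lifting) image_iff list.set_map)
    thus ?thesis using card_characters[OF ns U] multiplicity_prod_list[OF p] by (simp add: comp_def)
  qed
  also have "map (\<lambda>n. multiplicity p (card {z \<in> U. z ^ n = 1})) ns = map (\<lambda>n. min (multiplicity p n) k) ns"
    using multiplicity_card_roots[OF U p n0 prim] by (intro map_cong) auto
  also have "sum_list \<dots> = (\<Sum>j<N. min (multiplicity p (entry ns j)) k)"
    by (rule sum_list_entry[OF N]) simp
  finally show ?thesis .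
qed

lemma multiplicity_card_alternating_bicharacters:
  assumes ns: "decomposition G ns" and p: "Factorial_Ring.prime p" and U: "mult_subgroup U"
    and prim: "\<exists>z\<in>U. primitive_root_of_unity (p ^ k) z" "\<not> (\<exists>z\<in>U. primitive_root_of_unity (p ^ (k + 1)) z)"
    and N: "length ns \<le> N"
  shows "multiplicity p (card (alternating_bicharacters G U)) = (\<Sum>j<N. j * min (multiplicity p (entry ns j)) k)"
proof -
  have n0: "n > 0" if "n \<in> set ns" for n using decomposition_gt_1[OF ns] that by fastforce
  have c0: "card {z \<in> U. z ^ n = 1} \<noteq> 0" if "n \<in> set ns" for n
    by (rule card_roots_nonzero[OF U n0[OF that]])
  have "multiplicity p (card (alternating_bicharacters G U)) =
      (\<Sum>j<length ns. j * multiplicity p (card {z \<in> U. z ^ (ns ! j) = 1}))"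
    using card_alternating_bicharacters[OF ns U] multiplicity_card_alternating[OF p c0] by simp
  also have "\<dots> = (\<Sum>j<length ns. j * min (multiplicity p (ns ! j)) k)"
    using multiplicity_card_roots[OF U p n0 prim] by (intro sum.cong) auto
  also have "\<dots> = (\<Sum>j<N. j * min (multiplicity p (entry ns j)) k)"
    by (rule sum_entry[OF N, symmetric]) simp
  finally show ?thesis .
qed

lemma primitive_root_to_ac_iff [simp]: "primitive_root_of_unity n (to_ac x) \<longleftrightarrow> primitive_root_of_unity n x"
proof -
  have "to_ac x ^ k = 1 \<longleftrightarrow> x ^ k = 1" for k
    using to_ac_eq_iff[of "x ^ k" 1] by simp
  thus ?thesis by (simp add: primitive_root_of_unity_def)
qed

theorem theorem3p4:
  fixes G :: "'g monoid" and H :: "'h monoid"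
  assumes "comm_group G" and "finite (carrier G)"
    and "comm_group H" and "finite (carrier H)"
    and "\<not> CHAR('f::field) dvd card (carrier G)"
    and "\<And>p n. Factorial_Ring.prime (p::nat) \<Longrightarrow> p ^ n dvd group_exponent G \<Longrightarrow>
           \<not> (\<exists>x::'f. primitive_root_of_unity (p ^ n) x) \<Longrightarrow>
           \<forall>\<zeta>::'f alg_closure. primitive_root_of_unity (p ^ n) \<zeta> \<longrightarrow>
             \<not> (\<exists>y\<in>adjoin \<zeta>. primitive_root_of_unity (p ^ (n + 1)) y)"
    and "twisted_equiv TYPE('f) G H"
  shows "G \<cong> H"
proof -
  have G: "finite_comm_group G" and H: "finite_comm_group H"
    using assms(1-4) by (auto simp: finite_comm_group_def finite_comm_group_axioms_def)
  have equivalence: "\<exists>\<psi>. twisted_equivalence G H TYPE('f) \<psi>"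
    if "finite_comm_group G" "finite_comm_group H" "twisted_equiv TYPE('f) G H" for G :: "'c monoid" and H :: "'d monoid"
    using that unfolding twisted_equiv_def twisted_equivalence_def twisted_equivalence_axioms_def by blast
  obtain \<psi> where \<psi>: "twisted_equivalence G H TYPE('f) \<psi>" using equivalence[OF G H assms(7)] by blast
  \<comment> \<open>The inverse equivalence supplies the second of the two inequalities between
    numbers of alternating bicharacters.\<close>
  obtain \<psi>' where \<psi>': "twisted_equivalence H G TYPE('f) \<psi>'"
    using equivalence[OF H G twisted_equiv_sym[OF G H assms(7)]] by blast
  have cG: "of_nat (card (carrier G)) \<noteq> (0::'f)" using assms(5) by (simp add: of_nat_eq_0_iff_char_dvd)
  obtain \<phi> where "\<phi> \<in> ring_iso (group_algebra G :: ('g \<Rightarrow> 'f) ring) (group_algebra H :: ('h \<Rightarrow> 'f) ring)"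
    using twisted_equivalence.group_algebras_isomorphic[OF \<psi>] by (auto simp: is_ring_iso_def)
  with G H cG interpret iso: group_algebra_iso G H \<phi>
    by (simp add: group_algebra_iso_def group_algebra_iso_axioms_def)
  obtain ns where ns: "decomposition G ns" "card (carrier G) = prod_list ns"
    by (rule iso.G.exists_decomposition_self)
  obtain ms where ms: "decomposition H ms" "card (carrier H) = prod_list ms"
    by (rule iso.H.exists_decomposition_self)
  have gt1: "\<forall>n\<in>set ns. n > 1" "\<forall>n\<in>set ms. n > 1"
    using decomposition_gt_1 ns(1) ms(1) by blast+
  \<comment> \<open>Take the whole closure as intermediate field: both orders are nonzero in
    \<open>F\<close>, so each group has as many characters as elements.\<close>
  have prod_eq: "prod_list ns = prod_list ms"
  proof -
    have "card (dual G :: ('g \<Rightarrow> 'f alg_closure) set) = prod_list ns"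
      using of_nat_alg_closure_nonzero[OF iso.card_nonzero] ns by (intro card_dual) auto
    moreover have "card (dual H :: ('h \<Rightarrow> 'f alg_closure) set) = prod_list ms"
      using of_nat_alg_closure_nonzero[OF iso.card_nonzero'] ms by (intro card_dual) auto
    moreover have "subfield_set (UNIV :: 'f alg_closure set)" by (simp add: subfield_set_def)
    ultimately show ?thesis using iso.card_characters_eq[of UNIV] by simp
  qed
  define N where "N = max (length ns) (length ms)"
  have N: "length ns \<le> N" "length ms \<le> N" by (auto simp: N_def)
  have exponent: "group_exponent G = entry ns 0"
    using decomposition_group_exponent[OF ns(1)] by (cases ns) (auto simp: entry_def)
  have mult_eq: "multiplicity p (entry ns j) = multiplicity p (entry ms j)" if p: "Factorial_Ring.prime p" for p j
  proof -
    define a b where "a = (\<lambda>j. multiplicity p (entry ns j))" and "b = (\<lambda>j. multiplicity p (entry ms j))"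
    have a: "antimono a" "\<And>j. j \<ge> N \<Longrightarrow> a j = 0"
      using antimono_multiplicity_entry[OF decomposition_sorted[OF ns(1)] gt1(1)] N by (auto simp: a_def entry_def)
    have b: "antimono b" "\<And>j. j \<ge> N \<Longrightarrow> b j = 0"
      using antimono_multiplicity_entry[OF decomposition_sorted[OF ms(1)] gt1(2)] N by (auto simp: b_def entry_def)
    have total: "(\<Sum>j<N. a j) = (\<Sum>j<N. b j)"
    proof -
      have "0 \<notin> set ns" "0 \<notin> set ms" using gt1 by auto
      hence "(\<Sum>n\<leftarrow>ns. multiplicity p n) = (\<Sum>n\<leftarrow>ms. multiplicity p n)"
        using prod_eq by (simp flip: multiplicity_prod_list[OF p])
      thus ?thesis by (simp add: a_def b_def sum_list_entry[OF N(1)] sum_list_entry[OF N(2)])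
    qed
    let ?P = "\<lambda>k. \<exists>x::'f. primitive_root_of_unity (p ^ k) x"
    have P0: "?P 0" by (auto simp: primitive_root_of_unity_def intro: exI[of _ 1])
    have P_down: "?P k" if "?P l" "k \<le> l" for k l
    proof -
      have "p ^ l = p ^ k * p ^ (l - k)" using that(2) by (simp flip: power_add)
      thus ?thesis using that(1) primitive_root_power by metis
    qed
    \<comment> \<open>The search is bounded by \<open>a 0\<close>, the multiplicity of
      \<open>p\<close> in the exponent of \<open>G\<close>, because \<open>F\<close> may contain
      primitive roots of unity for all powers of \<open>p\<close>.\<close>
    define m where "m = (GREATEST k. k \<le> a 0 \<and> ?P k)"
    have m: "m \<le> a 0" "?P m"
      using GreatestI_nat[of "\<lambda>k. k \<le> a 0 \<and> ?P k" 0 "a 0"] P0 by (auto simp: m_def)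
    have m_max: "k \<le> m" if "k \<le> a 0" "?P k" for k
      unfolding m_def using that by (intro Greatest_le_nat[of "\<lambda>k. k \<le> a 0 \<and> ?P k" _ "a 0"]) auto
    have alt: "(\<Sum>j<N. j * min (a j) k) = (\<Sum>j<N. j * min (b j) k)" if k: "k \<le> m" for k
    proof -
      \<comment> \<open>Restricting the values to exponent \<open>p ^ k\<close> excludes primitive
        roots of order \<open>p ^ (k + 1)\<close>, so multiplicities are cut off exactly at
        \<open>k\<close>.\<close>
      define U where "U = {z \<in> UNIV - {0::'f}. z ^ (p ^ k) = 1}"
      have q: "0 < p ^ k" using p prime_gt_0_nat by simp
      have U: "mult_subgroup U" unfolding U_def by (rule mult_subgroup_roots[OF mult_subgroup_UNIV q])
      obtain x :: 'f where x: "primitive_root_of_unity (p ^ k) x" using P_down[OF m(2) k] by blast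
      have "x \<noteq> 0" using x q by (auto simp: primitive_root_of_unity_def power_0_left)
      hence prim: "\<exists>z\<in>U. primitive_root_of_unity (p ^ k) z"
        using x by (intro bexI[of _ x]) (auto simp: U_def primitive_root_of_unity_def)
      have noprim: "\<not> (\<exists>z\<in>U. primitive_root_of_unity (p ^ (k + 1)) z)"
      proof
        assume "\<exists>z\<in>U. primitive_root_of_unity (p ^ (k + 1)) z"
        then obtain z where z: "z \<in> U" "primitive_root_of_unity (p ^ (k + 1)) z" by blast
        hence "p ^ (k + 1) dvd p ^ k" using primitive_root_power_eq_1[OF z(2)] by (simp add: U_def)
        thus False using p prime_gt_1_nat[OF p] by (simp add: dvd_imp_le power_dvd_imp_le)
      qed
      have finite: "finite (alternating_bicharacters G U)" "finite (alternating_bicharacters H U)"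
        using card_alternating_bicharacters[OF ns(1) U] card_alternating_bicharacters[OF ms(1) U] by auto
      have "card (alternating_bicharacters G U) = card (alternating_bicharacters H U)"
        using twisted_equivalence.card_alternating_le[OF \<psi> q] twisted_equivalence.card_alternating_le[OF \<psi>' q] finite
        by (fastforce simp: U_def)
      thus ?thesis
        using multiplicity_card_alternating_bicharacters[OF ns(1) p U prim noprim N(1)]
          multiplicity_card_alternating_bicharacters[OF ms(1) p U prim noprim N(2)]
        by (simp add: a_def b_def)
    qed
    have trunc: "(\<Sum>j<N. min (a j) k) = (\<Sum>j<N. min (b j) k)" if "m < a 0" "m \<le> k" "k \<le> a 0" for k
    proof -
      have "\<exists>\<zeta>::'f alg_closure. primitive_root_of_unity (p ^ k) \<zeta> \<and> \<not> (\<exists>y\<in>adjoin \<zeta>. primitive_root_of_unity (p ^ (k + 1)) y)"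
      \<comment> \<open>For \<open>k = m\<close> a root in \<open>F\<close> serves: then
        \<open>F(\<zeta>)\<close> is \<open>F\<close>, and \<open>m\<close> is maximal while
        \<open>m + 1\<close> is still within the bound. For larger \<open>k\<close> the field
        \<open>F\<close> has no primitive root, and the hypothesis on \<open>F(\<zeta>)\<close>
        applies.\<close>
      proof (cases "k = m")
        case True
        obtain x :: 'f where x: "primitive_root_of_unity (p ^ k) x" using m(2) True by blast
        have "\<not> ?P (k + 1)" using m_max[of "k + 1"] that True by auto
        hence "\<not> (\<exists>y\<in>adjoin (to_ac x). primitive_root_of_unity (p ^ (k + 1)) y)"
          unfolding adjoin_range_to_ac by auto
        thus ?thesis using x by (intro exI[of _ "to_ac x"]) simp
      next
        case False
        hence nP: "\<not> ?P k" using m_max[of k] that by auto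
        have dvd: "p ^ k dvd group_exponent G"
          unfolding exponent using that(3) by (simp add: a_def multiplicity_dvd')
        \<comment> \<open>\<open>p ^ k\<close> divides the order of \<open>G\<close>, which is
          nonzero in \<open>F\<close>; so the closure has a primitive root of this order.\<close>
        have "ns \<noteq> []" using that(1) by (auto simp: a_def entry_def)
        hence "entry ns 0 dvd prod_list ns" by (cases ns) (auto simp: entry_def)
        hence "p ^ k dvd prod_list ns" using dvd exponent dvd_trans by metis
        hence "of_nat (p ^ k) \<noteq> (0::'f)" using cG ns(2) by (metis dvdE mult_zero_left of_nat_mult)
        hence "of_nat (p ^ k) \<noteq> (0::'f alg_closure)" by (rule of_nat_alg_closure_nonzero)
        then obtain \<zeta> :: "'f alg_closure" where "primitive_root_of_unity (p ^ k) \<zeta>"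
          using exists_primitive_root_alg_closed[OF p] by blast
        thus ?thesis using assms(6)[OF p dvd nP] by blast
      qed
      then obtain \<zeta> :: "'f alg_closure" where \<zeta>: "primitive_root_of_unity (p ^ k) \<zeta>"
        "\<not> (\<exists>y\<in>adjoin \<zeta>. primitive_root_of_unity (p ^ (k + 1)) y)" by blast
      note K = adjoin_subfield[of \<zeta>]
      have U: "mult_subgroup (adjoin \<zeta> - {0})" by (rule subfield_mult_subgroup[OF K(1)])
      have "\<zeta> \<noteq> 0" using \<zeta>(1) by (auto simp: primitive_root_of_unity_def power_0_left)
      hence prim: "\<exists>z\<in>adjoin \<zeta> - {0}. primitive_root_of_unity (p ^ k) z" using \<zeta>(1) K(3) by blast
      have noprim: "\<not> (\<exists>z\<in>adjoin \<zeta> - {0}. primitive_root_of_unity (p ^ (k + 1)) z)" using \<zeta>(2) by blast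
      show ?thesis
        using iso.card_characters_eq[OF K(1,2)]
          multiplicity_card_characters[OF ns(1) p U prim noprim N(1)]
          multiplicity_card_characters[OF ms(1) p U prim noprim N(2)]
        by (simp add: a_def b_def)
    qed
    have "a = b" by (rule antimono_eq_of_sums[OF a b total alt trunc m(1)])
    thus ?thesis by (simp add: a_def b_def fun_eq_iff)
  qed
  have "entry ns = entry ms"
  proof
    fix j
    have "entry ns j > 0" "entry ms j > 0" using gt1 by (simp_all add: entry_pos)
    thus "entry ns j = entry ms j" by (rule multiplicity_eq_nat) (rule mult_eq)
  qed
  hence "ns = ms" using gt1 by (rule entry_inject)
  thus ?thesis using decomposition_iso ns(1) ms(1) by blast
qed

end
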